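(* Let $\Bbbk$ be a field of characteristic $0$. Krichever-Novikov type algebras have non-noetherian universal enveloping algebras. That is, for every affine curve $C$ over $\Bbbk$ and every finite-dimensional Lie algebra $\mathfrak{g}$ over $\Bbbk$, none of $U(\mathcal{L}(C))$, $U(\mathcal{D}^1(C))$ and $U(\overline{\mathfrak{g}}(C))$ is noetherian.
   Context: Let $C$ be an affine curve (possibly singular) with coordinate ring $\Bbbk[C]$. The Krichever-Novikov algebra $\mathcal{L}(C) = \operatorname{Der}(\Bbbk[C])$ is the Lie algebra of $\Bbbk$-linear derivations of $\Bbbk[C]$ (vector fields on $C$) with the commutator bracket. The Lie algebra of differential operators of degree $\leq 1$ on $C$ is the semidirect sum $\mathcal{D}^1(C) = \Bbbk[C] \rtimes \mathcal{L}(C)$, i.e. $\Bbbk[C] \oplus \mathcal{L}(C)$ as a vector space with bracket $[(f_1,v_1),(f_2,v_2)] = (v_1(f_2) - v_2(f_1), [v_1,v_2])$ for $f_1,f_2 \in \Bbbk[C]$ and $v_1,v_2 \in \mathcal{L}(C)$. For a finite-dimensional Lie algebra $\mathfrak{g}$, the current algebra is $\overline{\mathfrak{g}}(C) = \mathfrak{g} \otimes_{\Bbbk} \Bbbk[C]$ with bracket $[x\otimes f, y \otimes g] = [x,y]\otimes fg$ for $x,y \in \mathfrak{g}$ and $f,g \in \Bbbk[C]$. The Lie algebras $\mathcal{L}(C)$, $\mathcal{D}^1(C)$ and $\overline{\mathfrak{g}}(C)$ are called Krichever-Novikov type algebras. $U(\cdot)$ denotes the universal enveloping algebra. Noetherian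 means left and right noetherian (left and right noetherianity are equivalent for universal enveloping algebras).
   Formalization: The finite-dimensional Lie algebra 𝔤 is assumed nonzero in the claim about the current algebra, since for 𝔤 = 0 the current algebra is 0 and its enveloping algebra is the field 𝕜, which is noetherian. *)

theory Defs
  imports
    "HOL-Algebra.QuotRing"
    "HOL-Algebra.Algebraic_Closure_Type"
    "HOL-Library.Poly_Mapping"
begin

section \<open>Lie algebras over a field\<close>

text \<open>
  The ground field is a type. A Lie algebra is a \<open>module\<close> record whose \<open>mult\<close> field is the Lie
  bracket. Its field \<open>one\<close> has no meaning and is left \<open>undefined\<close> in the constructions below.
\<close>

locale lie_algebra = Module.module "ring_of_type_algebra :: 'k::field ring" L
  for L :: "('k::field, 'l) module" (structure) +
  assumes bracket_closed: "\<lbrakk>x \<in> carrier L; y \<in> carrier L\<rbrakk> \<Longrightarrow> x \<otimes> y \<in> carrier L"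
    and bracket_add_left: "\<lbrakk>x \<in> carrier L; y \<in> carrier L; z \<in> carrier L\<rbrakk> \<Longrightarrow>
      (x \<oplus> y) \<otimes> z = (x \<otimes> z) \<oplus> (y \<otimes> z)"
    and bracket_add_right: "\<lbrakk>x \<in> carrier L; y \<in> carrier L; z \<in> carrier L\<rbrakk> \<Longrightarrow>
      x \<otimes> (y \<oplus> z) = (x \<otimes> y) \<oplus> (x \<otimes> z)"
    and bracket_smult_left: "\<lbrakk>x \<in> carrier L; y \<in> carrier L\<rbrakk> \<Longrightarrow> (c \<odot> x) \<otimes> y = c \<odot> (x \<otimes> y)"
    and bracket_smult_right: "\<lbrakk>x \<in> carrier L; y \<in> carrier L\<rbrakk> \<Longrightarrow> x \<otimes> (c \<odot> y) = c \<odot> (x \<otimes> y)"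
    and bracket_alternating: "x \<in> carrier L \<Longrightarrow> x \<otimes> x = \<zero>"
    and jacobi: "\<lbrakk>x \<in> carrier L; y \<in> carrier L; z \<in> carrier L\<rbrakk> \<Longrightarrow>
      (x \<otimes> (y \<otimes> z)) \<oplus> (y \<otimes> (z \<otimes> x)) \<oplus> (z \<otimes> (x \<otimes> y)) = \<zero>"

definition finite_dimensional :: "('k::field, 'l) module \<Rightarrow> bool" where
  "finite_dimensional L \<longleftrightarrow>
     (\<exists>B. finite B \<and> B \<subseteq> carrier L \<and>
          (\<forall>x\<in>carrier L. \<exists>c :: 'l \<Rightarrow> 'k. x = (\<Oplus>\<^bsub>L\<^esub>b\<in>B. c b \<odot>\<^bsub>L\<^esub> b)))"


section \<open>Universal enveloping algebras\<close>

text \<open>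
  \<open>'b \<Rightarrow>\<^sub>0 'k\<close> is the vector space with basis \<open>'b\<close>; \<open>bilinear_ext\<close> extends an operation on the bases
  bilinearly.
\<close>

definition bilinear_ext ::
    "('b \<Rightarrow> 'c \<Rightarrow> 'd) \<Rightarrow> ('b \<Rightarrow>\<^sub>0 'k) \<Rightarrow> ('c \<Rightarrow>\<^sub>0 'k) \<Rightarrow> ('d \<Rightarrow>\<^sub>0 'k::field)" where
  "bilinear_ext m p q =
     (\<Sum>x\<in>Poly_Mapping.keys p. \<Sum>y\<in>Poly_Mapping.keys q.
        Poly_Mapping.single (m x y) (Poly_Mapping.lookup p x * Poly_Mapping.lookup q y))"

text \<open>The free associative unital algebra on the set \<open>S\<close>: its basis consists of the words over \<open>S\<close>.\<close>

definition free_algebra :: "'l set \<Rightarrow> ('l list \<Rightarrow>\<^sub>0 'k::field) ring" where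
  "free_algebra S =
     \<lparr>carrier = {p. Poly_Mapping.keys p \<subseteq> lists S},
      monoid.mult = bilinear_ext (@),
      one = Poly_Mapping.single [] 1,
      ring.zero = 0,
      add = (+)\<rparr>"

text \<open>
  The first two families of relations turn the free algebra on the set \<open>carrier L\<close> into the tensor
  algebra of the vector space \<open>L\<close>; the third one identifies commutators with Lie brackets.
\<close>

definition enveloping_relations :: "('k::field, 'l) module \<Rightarrow> ('l list \<Rightarrow>\<^sub>0 'k) set" where
  "enveloping_relations L =
     {Poly_Mapping.single [x \<oplus>\<^bsub>L\<^esub> y] 1 - Poly_Mapping.single [x] 1 - Poly_Mapping.single [y] 1
       | x y. x \<in> carrier L \<and> y \<in> carrier L} \<union>
     {Poly_Mapping.single [c \<odot>\<^bsub>L\<^esub> x] 1 - Poly_Mapping.single [x] c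
       | c x. x \<in> carrier L} \<union>
     {Poly_Mapping.single [x, y] 1 - Poly_Mapping.single [y, x] 1 - Poly_Mapping.single [x \<otimes>\<^bsub>L\<^esub> y] 1
       | x y. x \<in> carrier L \<and> y \<in> carrier L}"

definition universal_enveloping_algebra ::
    "('k::field, 'l) module \<Rightarrow> ('l list \<Rightarrow>\<^sub>0 'k) set ring" where
  "universal_enveloping_algebra L =
     free_algebra (carrier L) Quot
       (Idl\<^bsub>free_algebra (carrier L)\<^esub> (enveloping_relations L))"


section \<open>Noetherian rings\<close>

text \<open>
  \<open>HOL-Algebra\<close>'s \<open>noetherian_ring\<close> concerns two-sided ideals, so it is not the right notion for
  noncommutative rings.
\<close>

definition left_ideal :: "'a set \<Rightarrow> 'a ring \<Rightarrow> bool" where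
  "left_ideal I R \<longleftrightarrow> additive_subgroup I R \<and> (\<forall>r\<in>carrier R. \<forall>x\<in>I. r \<otimes>\<^bsub>R\<^esub> x \<in> I)"

definition right_ideal :: "'a set \<Rightarrow> 'a ring \<Rightarrow> bool" where
  "right_ideal I R \<longleftrightarrow> additive_subgroup I R \<and> (\<forall>r\<in>carrier R. \<forall>x\<in>I. x \<otimes>\<^bsub>R\<^esub> r \<in> I)"

definition left_noetherian :: "'a ring \<Rightarrow> bool" where
  "left_noetherian R \<longleftrightarrow>
     (\<forall>I :: nat \<Rightarrow> 'a set. (\<forall>n. left_ideal (I n) R) \<and> (\<forall>n. I n \<subseteq> I (Suc n)) \<longrightarrow>
        (\<exists>n. \<forall>m\<ge>n. I m = I n))"

definition right_noetherian :: "'a ring \<Rightarrow> bool" where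
  "right_noetherian R \<longleftrightarrow>
     (\<forall>I :: nat \<Rightarrow> 'a set. (\<forall>n. right_ideal (I n) R) \<and> (\<forall>n. I n \<subseteq> I (Suc n)) \<longrightarrow>
        (\<exists>n. \<forall>m\<ge>n. I m = I n))"

definition noetherian :: "'a ring \<Rightarrow> bool" where
  "noetherian R \<longleftrightarrow> left_noetherian R \<and> right_noetherian R"


section \<open>Affine curves\<close>

definition prime_chain :: "nat \<Rightarrow> (nat \<Rightarrow> 'a set) \<Rightarrow> 'a ring \<Rightarrow> bool" where
  "prime_chain n P R \<longleftrightarrow> (\<forall>i\<le>n. primeideal (P i) R) \<and> (\<forall>i<n. P i \<subset> P (Suc i))"

definition has_krull_dim :: "'a ring \<Rightarrow> nat \<Rightarrow> bool" where
  "has_krull_dim R n \<longleftrightarrow> (\<exists>P. prime_chain n P R) \<and> (\<nexists>P. prime_chain (Suc n) P R)"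

text \<open>
  An affine curve \<open>C\<close> is given by its coordinate ring \<open>k[C]\<close>, here the type \<open>'a\<close> with
  scalar multiplication \<open>scale\<close>: a finitely generated reduced commutative algebra of Krull
  dimension 1. Neither irreducibility nor smoothness is required.
\<close>

locale affine_curve = vector_space scale
  for scale :: "'k::field_char_0 \<Rightarrow> 'a::comm_ring_1 \<Rightarrow> 'a" +
  assumes scale_mult_left: "scale c (a * b) = scale c a * b"
    and finitely_generated:
      "\<exists>S. finite S \<and>
         (\<forall>B. S \<subseteq> B \<and> 1 \<in> B \<and> (\<forall>a\<in>B. \<forall>b\<in>B. a + b \<in> B) \<and> (\<forall>a\<in>B. \<forall>b\<in>B. a * b \<in> B) \<and>
              (\<forall>c. \<forall>a\<in>B. scale c a \<in> B) \<longrightarrow> B = UNIV)"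
    and reduced: "a ^ n = 0 \<Longrightarrow> a = 0"
    and krull_dim_1: "has_krull_dim (ring_of_type_algebra :: 'a ring) 1"


section \<open>Krichever-Novikov type algebras\<close>

definition derivations :: "('k::field \<Rightarrow> 'a::comm_ring_1 \<Rightarrow> 'a) \<Rightarrow> ('a \<Rightarrow> 'a) set" where
  "derivations scale =
     {D. Vector_Spaces.linear scale scale D \<and> (\<forall>a b. D (a * b) = D a * b + a * D b)}"

definition commutator :: "('a \<Rightarrow> 'a) \<Rightarrow> ('a \<Rightarrow> 'a) \<Rightarrow> ('a \<Rightarrow> 'a::ab_group_add)" where
  "commutator D E = (\<lambda>a. D (E a) - E (D a))"

definition krichever_novikov ::
    "('k::field \<Rightarrow> 'a::comm_ring_1 \<Rightarrow> 'a) \<Rightarrow> ('k, 'a \<Rightarrow> 'a) module" where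
  "krichever_novikov scale =
     \<lparr>carrier = derivations scale,
      monoid.mult = commutator,
      one = undefined,
      ring.zero = (\<lambda>_. 0),
      add = (\<lambda>D E a. D a + E a),
      module.smult = (\<lambda>c D a. scale c (D a))\<rparr>"

definition diff_operators_le_1 ::
    "('k::field \<Rightarrow> 'a::comm_ring_1 \<Rightarrow> 'a) \<Rightarrow> ('k, 'a \<times> ('a \<Rightarrow> 'a)) module" where
  "diff_operators_le_1 scale =
     \<lparr>carrier = UNIV \<times> derivations scale,
      monoid.mult = (\<lambda>(f, v) (g, w). (v g - w f, commutator v w)),
      one = undefined,
      ring.zero = (0, \<lambda>_. 0),
      add = (\<lambda>(f, v) (g, w). (f + g, \<lambda>a. v a + w a)),
      module.smult = (\<lambda>c (f, v). (scale c f, \<lambda>a. scale c (v a)))\<rparr>"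

text \<open>
  The tensor product \<open>\<gg> \<otimes> A\<close> is the vector space with basis \<open>carrier \<gg> \<times> A\<close>, modulo
  the subspace spanned by the bilinearity relations; its elements are the cosets.
\<close>

definition pm_scale :: "'k \<Rightarrow> ('b \<Rightarrow>\<^sub>0 'k) \<Rightarrow> ('b \<Rightarrow>\<^sub>0 'k::field)" where
  "pm_scale c = Poly_Mapping.map ((*) c)"

definition tensor_free :: "('k::field, 'g) module \<Rightarrow> ('g \<times> 'a \<Rightarrow>\<^sub>0 'k) set" where
  "tensor_free \<gg> = {p. Poly_Mapping.keys p \<subseteq> carrier \<gg> \<times> UNIV}"

definition tensor_relations ::
    "('k::field, 'g) module \<Rightarrow> ('k \<Rightarrow> 'a::comm_ring_1 \<Rightarrow> 'a) \<Rightarrow> ('g \<times> 'a \<Rightarrow>\<^sub>0 'k) set" where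
  "tensor_relations \<gg> scale =
     {Poly_Mapping.single (x \<oplus>\<^bsub>\<gg>\<^esub> y, f) 1 - Poly_Mapping.single (x, f) 1 - Poly_Mapping.single (y, f) 1
       | x y f. x \<in> carrier \<gg> \<and> y \<in> carrier \<gg>} \<union>
     {Poly_Mapping.single (x, f + g) 1 - Poly_Mapping.single (x, f) 1 - Poly_Mapping.single (x, g) 1
       | x f g. x \<in> carrier \<gg>} \<union>
     {Poly_Mapping.single (c \<odot>\<^bsub>\<gg>\<^esub> x, f) 1 - Poly_Mapping.single (x, f) c
       | c x f. x \<in> carrier \<gg>} \<union>
     {Poly_Mapping.single (x, scale c f) 1 - Poly_Mapping.single (x, f) c
       | c x f. x \<in> carrier \<gg>}"

definition tensor_equiv ::
    "('k::field, 'g) module \<Rightarrow> ('k \<Rightarrow> 'a::comm_ring_1 \<Rightarrow> 'a) \<Rightarrow> ('g \<times> 'a \<Rightarrow>\<^sub>0 'k) rel" where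
  "tensor_equiv \<gg> scale =
     {(p, q). p \<in> tensor_free \<gg> \<and> q \<in> tensor_free \<gg> \<and>
        p - q \<in> Modules.module.span pm_scale (tensor_relations \<gg> scale)}"

definition current_algebra ::
    "('k::field, 'g) module \<Rightarrow> ('k \<Rightarrow> 'a::comm_ring_1 \<Rightarrow> 'a) \<Rightarrow> ('k, ('g \<times> 'a \<Rightarrow>\<^sub>0 'k) set) module" where
  "current_algebra \<gg> scale =
     \<lparr>carrier = tensor_free \<gg> // tensor_equiv \<gg> scale,
      monoid.mult = (\<lambda>U V. \<Union>p\<in>U. \<Union>q\<in>V. tensor_equiv \<gg> scale ``
        {bilinear_ext (\<lambda>(x, f) (y, g). (x \<otimes>\<^bsub>\<gg>\<^esub> y, f * g)) p q}),
      one = undefined,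
      ring.zero = tensor_equiv \<gg> scale `` {0},
      add = (\<lambda>U V. \<Union>p\<in>U. \<Union>q\<in>V. tensor_equiv \<gg> scale `` {p + q}),
      module.smult = (\<lambda>c U. \<Union>p\<in>U. tensor_equiv \<gg> scale `` {pm_scale c p})\<rparr>"

end

theory Submission
  imports Defs "HOL-Library.Product_Plus" "HOL-Library.Function_Algebras"
begin

text \<open>
  All three statements follow from one obstruction to noetherianity. Let \<open>M\<close> be a module over a Lie
  algebra \<open>L\<close> and \<open>\<phi> : L \<rightarrow> M\<close> a 1-cocycle. Then \<open>E = k e \<oplus> M\<close> is an \<open>L\<close>-module with \<open>x e = \<phi> x\<close>, and for
  every subspace \<open>V\<close> of \<open>M\<close> the set of all \<open>u\<close> in \<open>U(L)\<close> with \<open>u M = 0\<close> and \<open>u e \<in> V\<close> is a right ideal: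
  for \<open>x\<close> in \<open>L\<close> the product \<open>u x\<close> annihilates \<open>M\<close>, and it annihilates \<open>e\<close> as well, because \<open>x e\<close> lies in
  \<open>M\<close>. Hence \<open>U(L)\<close> is not right noetherian as soon as there are elements \<open>u\<^sub>0, u\<^sub>1, \<dots>\<close> that annihilate \<open>M\<close>
  while the vectors \<open>u\<^sub>n e\<close> are linearly independent (locale \<open>lie_cocycle\<close>).

  The modules come from geometry. Let \<open>F\<close> be the function field of an irreducible component of the
  curve that is not a point, \<open>A \<rightarrow> F\<close> the restriction of functions, \<open>D\<close> a vector field and \<open>t\<close> a function
  such that \<open>D t \<noteq> 0\<close> in \<open>F\<close> and \<open>t\<close> is transcendental in \<open>F\<close>.

  For \<open>\<L>(C)\<close> take \<open>M = F\<close>, on which vector fields act by their unique extensions to derivations of \<open>F\<close>,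
  and for \<open>\<phi>\<close> the divergence. For a function \<open>p\<close> put
  \<open>u = (p t\<^sup>2 D) D - 2 (p t D) (t D) + (p D) (t\<^sup>2 D)\<close>, the element obtained from the square of
  \<open>t \<otimes> 1 - 1 \<otimes> t\<close>. A product \<open>(a D) (b D)\<close> acts on \<open>F\<close> by \<open>a b D\<^sup>2 + a D(b) D\<close>, which involves at most the
  first derivative of \<open>b\<close>, so \<open>u\<close> kills \<open>F\<close>; but \<open>(a D) (b D) e = a D(b div D + D b)\<close> involves
  \<open>a D\<^sup>2 b\<close>, and \<open>u e = 2 p (D t)\<^sup>2\<close>. The powers of \<open>t\<close> as choices of \<open>p\<close> give independent vectors.
  Since \<open>\<D>\<^sup>1(C)\<close> maps onto \<open>\<L>(C)\<close>, the same module and cocycle serve for it.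

  For a current algebra with \<open>[x, y] \<noteq> 0\<close> in \<open>\<gg>\<close>, take for \<open>M\<close> a form of the adjoint module \<open>\<gg> \<otimes> F\<close> and
  \<open>\<phi> (x \<otimes> f) = x \<otimes> D f\<close>. The element \<open>(x \<otimes> p t) (y \<otimes> 1) - (x \<otimes> p) (y \<otimes> t)\<close> kills \<open>M\<close>, where functions act by
  multiplication, and sends \<open>e\<close> to \<open>- [x, y] \<otimes> p D t\<close>. If \<open>\<gg>\<close> is abelian, then any linear map to the
  trivial module \<open>F\<close> is a cocycle, and \<open>x \<otimes> p\<close> itself kills the trivial module.

  It remains to find \<open>D\<close> and \<open>t\<close>. A component that is not a point corresponds to a minimal prime \<open>P\<close>
  strictly contained in another prime \<open>Q\<close>, and every element of \<open>Q\<close> outside \<open>P\<close> is transcendental modulo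
  \<open>P\<close>. In characteristic \<open>0\<close> the derivation \<open>d/dt\<close> extends from \<open>k[t]\<close> to a derivation from \<open>A/P\<close> to \<open>F\<close>,
  one generator of \<open>A\<close> at a time; multiplication by a common denominator makes its values regular. By
  Hilbert's basis theorem \<open>P\<close> is finitely generated, so some \<open>s \<notin> P\<close> satisfies \<open>s P = 0\<close>, and
  multiplication by \<open>s\<close> turns a derivation of \<open>A/P\<close> into one of \<open>A\<close>.
\<close>

section \<open>Linear extension from a basis\<close>

lemma sum_keys_superset:
  assumes "finite A" "Poly_Mapping.keys p \<subseteq> A" "\<And>x. f x 0 = 0"
  shows "(\<Sum>x\<in>Poly_Mapping.keys p. f x (Poly_Mapping.lookup p x)) = (\<Sum>x\<in>A. f x (Poly_Mapping.lookup p x))"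
  by (rule sum.mono_neutral_left) (use assms in \<open>auto simp: in_keys_iff\<close>)

lemma lookup_pm_scale: "Poly_Mapping.lookup (pm_scale a p) x = a * Poly_Mapping.lookup p x"
  by (simp add: pm_scale_def map.rep_eq when_def)

interpretation pm: vector_space pm_scale
  by standard (rule poly_mapping_eqI; simp add: lookup_pm_scale lookup_add algebra_simps)+

lemma keys_pm_scale: "Poly_Mapping.keys (pm_scale a p) \<subseteq> Poly_Mapping.keys p"
  by (auto simp: in_keys_iff lookup_pm_scale)

lemma pm_scale_single: "pm_scale a (Poly_Mapping.single x b) = Poly_Mapping.single x (a * b)"
  by (rule poly_mapping_eqI) (simp add: lookup_pm_scale lookup_single when_def)

definition linear_ext :: "('k::field \<Rightarrow> 'w::ab_group_add \<Rightarrow> 'w) \<Rightarrow> ('b \<Rightarrow> 'w) \<Rightarrow> ('b \<Rightarrow>\<^sub>0 'k) \<Rightarrow> 'w" where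
  "linear_ext sc f p = (\<Sum>x\<in>Poly_Mapping.keys p. sc (Poly_Mapping.lookup p x) (f x))"

context vector_space
begin

lemma linear_ext_superset:
  "finite A \<Longrightarrow> Poly_Mapping.keys p \<subseteq> A \<Longrightarrow> linear_ext scale f p = (\<Sum>x\<in>A. scale (Poly_Mapping.lookup p x) (f x))"
  unfolding linear_ext_def by (rule sum_keys_superset) auto

lemma linear_ext_add: "linear_ext scale f (p + q) = linear_ext scale f p + linear_ext scale f q"
  using keys_add[of p q]
  by (simp add: linear_ext_superset[of "Poly_Mapping.keys p \<union> Poly_Mapping.keys q"] lookup_add
    scale_left_distrib sum.distrib)

lemma linear_ext_uminus: "linear_ext scale f (- p) = - linear_ext scale f p"
  by (simp add: linear_ext_def sum_negf)

lemma linear_ext_diff: "linear_ext scale f (p - q) = linear_ext scale f p - linear_ext scale f q"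
  using linear_ext_add[of f p "- q"] by (simp add: linear_ext_uminus)

lemma linear_ext_zero: "linear_ext scale f 0 = 0"
  by (simp add: linear_ext_def)

lemma linear_ext_single: "linear_ext scale f (Poly_Mapping.single x c) = scale c (f x)"
  by (simp add: linear_ext_def)

lemma linear_ext_pm_scale: "linear_ext scale f (pm_scale c p) = scale c (linear_ext scale f p)"
  by (subst linear_ext_superset[OF _ keys_pm_scale])
    (simp_all add: lookup_pm_scale linear_ext_def scale_sum_right)

lemma linear_ext_sum: "linear_ext scale f (\<Sum>i\<in>A. p i) = (\<Sum>i\<in>A. linear_ext scale f (p i))"
  by (induction A rule: infinite_finite_induct) (simp_all add: linear_ext_add linear_ext_zero)

lemma linear_ext_bilinear_ext:
  "linear_ext scale f (bilinear_ext m p q) = (\<Sum>x\<in>Poly_Mapping.keys p. \<Sum>y\<in>Poly_Mapping.keys q.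
     scale (Poly_Mapping.lookup p x * Poly_Mapping.lookup q y) (f (m x y)))"
  by (simp add: bilinear_ext_def linear_ext_sum linear_ext_single)

end

section \<open>The free algebra\<close>

text \<open>
  Words form the free monoid under concatenation. Writing this monoid additively turns the free
  algebra into a subring of the monoid algebra of words, whose ring laws are those of the
  convolution product of \<open>Poly_Mapping\<close>.
\<close>

instantiation list :: (type) monoid_add
begin
definition zero_list :: "'a list" where "0 = []"
definition plus_list :: "'a list \<Rightarrow> 'a list \<Rightarrow> 'a list" where "xs + ys = xs @ ys"
instance by standard (simp_all add: zero_list_def plus_list_def)
end

lemma lookup_sum_single:
  "finite A \<Longrightarrow> Poly_Mapping.lookup (\<Sum>x\<in>A. Poly_Mapping.single x (f x)) y = (if y \<in> A then f y else 0)"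
  by (induction A rule: finite_induct) (auto simp: lookup_add lookup_single when_def)

lemma poly_mapping_eq_sum_single:
  "p = (\<Sum>x\<in>Poly_Mapping.keys p. Poly_Mapping.single x (Poly_Mapping.lookup p x))"
  by (rule poly_mapping_eqI) (simp add: lookup_sum_single in_keys_iff)

lemma bilinear_ext_append: "bilinear_ext (@) p q = p * q"
proof -
  have "p * q = (\<Sum>x\<in>Poly_Mapping.keys p. Poly_Mapping.single x (Poly_Mapping.lookup p x)) *
    (\<Sum>x\<in>Poly_Mapping.keys q. Poly_Mapping.single x (Poly_Mapping.lookup q x))"
    using poly_mapping_eq_sum_single[of p] poly_mapping_eq_sum_single[of q] by simp
  then show ?thesis
    by (simp add: bilinear_ext_def sum_product mult_single plus_list_def)
qed

lemma free_algebra_simps [simp]: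
  "carrier (free_algebra S) = {p. Poly_Mapping.keys p \<subseteq> lists S}"
  "monoid.mult (free_algebra S) = (*)"
  "one (free_algebra S) = 1"
  "ring.zero (free_algebra S) = 0"
  "add (free_algebra S) = (+)"
  by (simp_all add: free_algebra_def bilinear_ext_append fun_eq_iff single_one[symmetric] zero_list_def)

lemma keys_mult_lists:
  fixes p q :: "'a list \<Rightarrow>\<^sub>0 'b::semiring_0"
  assumes "Poly_Mapping.keys p \<subseteq> lists S" "Poly_Mapping.keys q \<subseteq> lists S"
  shows "Poly_Mapping.keys (p * q) \<subseteq> lists S"
proof
  fix w assume "w \<in> Poly_Mapping.keys (p * q)"
  then obtain u v where "u \<in> Poly_Mapping.keys p" "v \<in> Poly_Mapping.keys q" "w = u @ v"
    using keys_mult[of p q] by (auto simp: plus_list_def)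
  with assms show "w \<in> lists S" by auto
qed

lemma ring_free_algebra:
  fixes S :: "'a set"
  shows "ring (free_algebra S :: ('a list \<Rightarrow>\<^sub>0 'b::field) ring)" (is "ring ?R")
proof (rule ringI)
  show "abelian_group ?R"
  proof (rule abelian_groupI)
    fix p q assume p: "p \<in> carrier ?R" "q \<in> carrier ?R"
    then show "p \<oplus>\<^bsub>?R\<^esub> q \<in> carrier ?R" using keys_add[of p q] by auto
  next
    fix p assume "p \<in> carrier ?R"
    then show "\<exists>q\<in>carrier ?R. q \<oplus>\<^bsub>?R\<^esub> p = \<zero>\<^bsub>?R\<^esub>" by (intro bexI[of _ "- p"]) auto
  qed (auto simp: algebra_simps)
  show "monoid ?R"
  proof (rule monoidI)
    fix p q assume "p \<in> carrier ?R" "q \<in> carrier ?R"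
    then show "p \<otimes>\<^bsub>?R\<^esub> q \<in> carrier ?R" using keys_mult_lists[of p S q] by simp
  qed (auto simp: mult.assoc zero_list_def in_keys_iff lookup_one when_def)
qed (auto simp: algebra_simps)

lemma additive_subgroup_free_algebraI:
  fixes S :: "'a set" and N :: "('a list \<Rightarrow>\<^sub>0 'b::field) set"
  assumes "\<And>p. p \<in> N \<Longrightarrow> Poly_Mapping.keys p \<subseteq> lists S" "0 \<in> N" "\<And>p q. p \<in> N \<Longrightarrow> q \<in> N \<Longrightarrow> p - q \<in> N"
  shows "additive_subgroup N (free_algebra S)" (is "additive_subgroup _ ?R")
proof -
  interpret R: ring ?R by (rule ring_free_algebra)
  have minus: "- p \<in> N" if "p \<in> N" for p using assms(3)[OF assms(2) that] by simp
  have plus: "p + q \<in> N" if "p \<in> N" "q \<in> N" for p q using assms(3)[OF that(1) minus[OF that(2)]] by simp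
  have "subgroup N (add_monoid ?R)"
  proof (rule group.subgroupI[OF R.a_group])
    fix p assume p: "p \<in> N"
    have "inv\<^bsub>add_monoid ?R\<^esub> p = - p"
      using assms(1)[OF p] R.minus_equality[of "- p" p] by (auto simp: a_inv_def)
    with p show "inv\<^bsub>add_monoid ?R\<^esub> p \<in> N" by (auto simp: minus)
  qed (use assms(1,2) plus in auto)
  then show ?thesis by (simp add: additive_subgroup_def)
qed

lemma ideal_free_algebraI:
  fixes S :: "'a set" and N :: "('a list \<Rightarrow>\<^sub>0 'b::field) set"
  assumes "\<And>p. p \<in> N \<Longrightarrow> Poly_Mapping.keys p \<subseteq> lists S" "0 \<in> N" "\<And>p q. p \<in> N \<Longrightarrow> q \<in> N \<Longrightarrow> p - q \<in> N"
    and "\<And>p q. p \<in> N \<Longrightarrow> Poly_Mapping.keys q \<subseteq> lists S \<Longrightarrow> q * p \<in> N \<and> p * q \<in> N"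
  shows "ideal N (free_algebra S)"
  using additive_subgroup_free_algebraI[of N S] assms ring_free_algebra[of S]
  by (intro idealI) (auto simp: additive_subgroup_def)

section \<open>Chains of right ideals in quotient rings\<close>

lemma right_ideal_image_quotient:
  assumes "ideal J R" "right_ideal I R"
  shows "right_ideal ((+>\<^bsub>R\<^esub>) J ` I) (R Quot J)"
proof -
  interpret ideal J R by fact
  interpret q: ring_hom_ring R "R Quot J" "(+>\<^bsub>R\<^esub>) J" by (rule rcos_ring_hom_ring)
  have I: "subgroup I (add_monoid R)" "\<And>r x. r \<in> carrier R \<Longrightarrow> x \<in> I \<Longrightarrow> x \<otimes>\<^bsub>R\<^esub> r \<in> I"
    using assms(2) by (auto simp: right_ideal_def additive_subgroup_def)
  have sub: "I \<subseteq> carrier R" using subgroup.subset[OF I(1)] by simp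
  have "subgroup ((+>\<^bsub>R\<^esub>) J ` I) (add_monoid (R Quot J))"
    using q.img_is_add_subgroup[OF I(1)] .
  moreover have "x \<otimes>\<^bsub>R Quot J\<^esub> r \<in> (+>\<^bsub>R\<^esub>) J ` I"
    if "r \<in> carrier (R Quot J)" "x \<in> (+>\<^bsub>R\<^esub>) J ` I" for r x
  proof -
    from that obtain a i where a: "a \<in> carrier R" "r = J +>\<^bsub>R\<^esub> a" and i: "i \<in> I" "x = J +>\<^bsub>R\<^esub> i"
      unfolding FactRing_def A_RCOSETS_def' by (auto simp del: a_r_coset_def')
    then have "x \<otimes>\<^bsub>R Quot J\<^esub> r = J +>\<^bsub>R\<^esub> (i \<otimes>\<^bsub>R\<^esub> a)" using q.hom_mult[of i a] sub by blast
    with I(2)[OF a(1) i(1)] show ?thesis by blast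
  qed
  ultimately show ?thesis by (auto simp: right_ideal_def additive_subgroup_def)
qed

lemma mem_if_coset_mem_image:
  assumes "ideal J R" "right_ideal I R" "J \<subseteq> I" "u \<in> carrier R" "J +>\<^bsub>R\<^esub> u \<in> (+>\<^bsub>R\<^esub>) J ` I"
  shows "u \<in> I"
proof -
  interpret ideal J R by fact
  interpret I: additive_subgroup I R using assms(2) by (simp add: right_ideal_def)
  from assms(5) obtain i where i: "i \<in> I" "J +>\<^bsub>R\<^esub> u = J +>\<^bsub>R\<^esub> i" by auto
  have "u \<in> J +>\<^bsub>R\<^esub> i" using a_rcos_self[OF assms(4)] i(2) by simp
  then obtain j where "j \<in> J" "u = j \<oplus>\<^bsub>R\<^esub> i" by (auto simp: a_r_coset_def')
  with i(1) assms(3) show ?thesis by auto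
qed

text \<open>
  A chain of right ideals above \<open>J\<close> stays strictly increasing in the quotient: \<open>u n\<close> separates two
  successive terms, and a coset can only lie in the image of a right ideal containing \<open>J\<close> if its
  representatives lie in that ideal.
\<close>

lemma not_right_noetherian_quotient:
  assumes J: "ideal J R"
    and I: "\<And>n. right_ideal (I n) R" "\<And>n. J \<subseteq> I n" "\<And>n. I n \<subseteq> I (Suc n)"
    and u: "\<And>n. u n \<in> I (Suc n)" "\<And>n. u n \<notin> I n"
  shows "\<not> right_noetherian (R Quot J)"
proof
  assume "right_noetherian (R Quot J)"
  moreover have "\<forall>n. (+>\<^bsub>R\<^esub>) J ` I n \<subseteq> (+>\<^bsub>R\<^esub>) J ` I (Suc n)"
    using I(3) by (simp add: image_mono)
  ultimately obtain n where "\<forall>m\<ge>n. (+>\<^bsub>R\<^esub>) J ` I m = (+>\<^bsub>R\<^esub>) J ` I n"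
    using right_ideal_image_quotient[OF J I(1)] unfolding right_noetherian_def
    by (auto dest!: spec[of _ "\<lambda>n. (+>\<^bsub>R\<^esub>) J ` I n"])
  from this[rule_format, of "Suc n"]
  have "(+>\<^bsub>R\<^esub>) J ` I (Suc n) = (+>\<^bsub>R\<^esub>) J ` I n" by simp
  then have "J +>\<^bsub>R\<^esub> u n \<in> (+>\<^bsub>R\<^esub>) J ` I n" using u(1)[of n] by blast
  moreover have "u n \<in> carrier R"
    using u(1)[of n] I(1)[of "Suc n"] additive_subgroup.a_subset unfolding right_ideal_def by blast
  ultimately show False using mem_if_coset_mem_image[OF J I(1) I(2)] u(2) by blast
qed

section \<open>Extensions of modules by cocycles\<close>

text \<open>
  The action of the free algebra on a space on which the letters act by arbitrary operators \<open>\<rho>\<close>; a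
  word acts by composition. It descends to an enveloping algebra when the operators satisfy the
  defining relations.
\<close>

definition alg_act ::
    "('k::field \<Rightarrow> 'm::ab_group_add \<Rightarrow> 'm) \<Rightarrow> ('l \<Rightarrow> 'm \<Rightarrow> 'm) \<Rightarrow> ('l list \<Rightarrow>\<^sub>0 'k) \<Rightarrow> 'm \<Rightarrow> 'm" where
  "alg_act sc \<rho> p m = linear_ext sc (\<lambda>w. foldr \<rho> w m) p"

context vector_space
begin

lemma alg_act_add: "alg_act scale \<rho> (p + q) m = alg_act scale \<rho> p m + alg_act scale \<rho> q m"
  and alg_act_diff: "alg_act scale \<rho> (p - q) m = alg_act scale \<rho> p m - alg_act scale \<rho> q m"
  and alg_act_zero: "alg_act scale \<rho> 0 m = 0"
  and alg_act_single: "alg_act scale \<rho> (Poly_Mapping.single w c) m = scale c (foldr \<rho> w m)"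
  by (simp_all add: alg_act_def linear_ext_add linear_ext_diff linear_ext_zero linear_ext_single)

lemma linear_foldr:
  assumes "\<And>x. x \<in> S \<Longrightarrow> Vector_Spaces.linear scale scale (\<rho> x)" "w \<in> lists S"
  shows "Vector_Spaces.linear scale scale (foldr \<rho> w)"
  using assms(2)
proof (induction w)
  case Nil
  then show ?case using linear_id by (simp add: id_def[symmetric])
next
  case (Cons x w)
  then show ?case unfolding foldr.simps
    by (intro Vector_Spaces.linear_compose) (use assms(1) in auto)
qed

lemma linear_alg_act:
  assumes "\<And>x. x \<in> S \<Longrightarrow> Vector_Spaces.linear scale scale (\<rho> x)" "Poly_Mapping.keys p \<subseteq> lists S"
  shows "Vector_Spaces.linear scale scale (alg_act scale \<rho> p)"
proof -
  interpret vector_space_pair scale scale by standard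
  have "Vector_Spaces.linear scale scale (foldr \<rho> w)" if "w \<in> Poly_Mapping.keys p" for w
    using that assms(2) by (intro linear_foldr[of S, OF assms(1)]) auto
  then show ?thesis
    unfolding alg_act_def linear_ext_def by (intro linear_compose_sum ballI linear_compose_scale_right)
qed

lemma alg_act_mult:
  assumes lin: "\<And>x. x \<in> S \<Longrightarrow> Vector_Spaces.linear scale scale (\<rho> x)"
    and p: "Poly_Mapping.keys p \<subseteq> lists S"
  shows "alg_act scale \<rho> (p * q) m = alg_act scale \<rho> p (alg_act scale \<rho> q m)"
proof -
  have "alg_act scale \<rho> (p * q) m = (\<Sum>x\<in>Poly_Mapping.keys p. \<Sum>y\<in>Poly_Mapping.keys q.
     scale (Poly_Mapping.lookup p x * Poly_Mapping.lookup q y) (foldr \<rho> x (foldr \<rho> y m)))"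
    unfolding alg_act_def bilinear_ext_append[symmetric]
    by (simp add: linear_ext_bilinear_ext foldr_append)
  also have "\<dots> = (\<Sum>x\<in>Poly_Mapping.keys p. scale (Poly_Mapping.lookup p x) (foldr \<rho> x (alg_act scale \<rho> q m)))"
  proof (rule sum.cong[OF refl])
    fix x assume "x \<in> Poly_Mapping.keys p"
    with p have "x \<in> lists S" by blast
    then interpret f: Vector_Spaces.linear scale scale "foldr \<rho> x"
      using linear_foldr[of S \<rho>, OF lin] by simp
    show "(\<Sum>y\<in>Poly_Mapping.keys q.
       scale (Poly_Mapping.lookup p x * Poly_Mapping.lookup q y) (foldr \<rho> x (foldr \<rho> y m))) =
       scale (Poly_Mapping.lookup p x) (foldr \<rho> x (alg_act scale \<rho> q m))"
      by (simp add: alg_act_def linear_ext_def f.sum f.scale scale_sum_right)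
  qed
  finally show ?thesis by (simp add: alg_act_def linear_ext_def)
qed

end

definition pair_scale :: "('k::field \<Rightarrow> 'm \<Rightarrow> 'm) \<Rightarrow> 'k \<Rightarrow> 'k \<times> 'm \<Rightarrow> 'k \<times> 'm"
  where "pair_scale sc a = map_prod ((*) a) (sc a)"

text \<open>
  The pair \<open>(c, m)\<close> stands for \<open>c e + m\<close> in the extension \<open>k e \<oplus> M\<close>. As \<open>x e = \<phi> x\<close> has no component
  along \<open>e\<close>, the first coordinate of the result is \<open>0\<close>.
\<close>

definition cocycle_act :: "('k::field \<Rightarrow> 'm::ab_group_add \<Rightarrow> 'm) \<Rightarrow> ('l \<Rightarrow> 'm \<Rightarrow> 'm) \<Rightarrow> ('l \<Rightarrow> 'm) \<Rightarrow> 'l \<Rightarrow> 'k \<times> 'm \<Rightarrow> 'k \<times> 'm"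
  where "cocycle_act sc \<rho> \<phi> x = (\<lambda>(c, m). (0, sc c (\<phi> x) + \<rho> x m))"

text \<open>
  The module \<open>M\<close> is a subspace of an ambient space on which the operators are defined and linear;
  only on \<open>M\<close> do they have to represent \<open>L\<close>. This allows modules of maps that respect some linear
  structure inside a space of all maps.
\<close>

locale lie_cocycle = vector_space sc
  for sc :: "'k::field \<Rightarrow> 'm::ab_group_add \<Rightarrow> 'm" +
  fixes L :: "('k, 'l) module" (structure)
    and M :: "'m set" and \<rho> :: "'l \<Rightarrow> 'm \<Rightarrow> 'm" and \<phi> :: "'l \<Rightarrow> 'm"
  assumes add_closed: "\<lbrakk>x \<in> carrier L; y \<in> carrier L\<rbrakk> \<Longrightarrow> x \<oplus> y \<in> carrier L"
    and smult_closed: "x \<in> carrier L \<Longrightarrow> c \<odot> x \<in> carrier L"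
    and bracket_closed: "\<lbrakk>x \<in> carrier L; y \<in> carrier L\<rbrakk> \<Longrightarrow> x \<otimes> y \<in> carrier L"
    and subspace_M: "subspace M"
    and linear_\<rho>: "x \<in> carrier L \<Longrightarrow> Vector_Spaces.linear sc sc (\<rho> x)"
    and \<rho>_closed: "\<lbrakk>x \<in> carrier L; m \<in> M\<rbrakk> \<Longrightarrow> \<rho> x m \<in> M"
    and \<rho>_add: "\<lbrakk>x \<in> carrier L; y \<in> carrier L; m \<in> M\<rbrakk> \<Longrightarrow> \<rho> (x \<oplus> y) m = \<rho> x m + \<rho> y m"
    and \<rho>_smult: "\<lbrakk>x \<in> carrier L; m \<in> M\<rbrakk> \<Longrightarrow> \<rho> (c \<odot> x) m = sc c (\<rho> x m)"
    and \<rho>_bracket: "\<lbrakk>x \<in> carrier L; y \<in> carrier L; m \<in> M\<rbrakk> \<Longrightarrow>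
      \<rho> (x \<otimes> y) m = \<rho> x (\<rho> y m) - \<rho> y (\<rho> x m)"
    and \<phi>_closed: "x \<in> carrier L \<Longrightarrow> \<phi> x \<in> M"
    and \<phi>_add: "\<lbrakk>x \<in> carrier L; y \<in> carrier L\<rbrakk> \<Longrightarrow> \<phi> (x \<oplus> y) = \<phi> x + \<phi> y"
    and \<phi>_smult: "x \<in> carrier L \<Longrightarrow> \<phi> (c \<odot> x) = sc c (\<phi> x)"
    and \<phi>_bracket: "\<lbrakk>x \<in> carrier L; y \<in> carrier L\<rbrakk> \<Longrightarrow> \<phi> (x \<otimes> y) = \<rho> x (\<phi> y) - \<rho> y (\<phi> x)"
begin

abbreviation E :: "('k \<times> 'm) set" where "E \<equiv> UNIV \<times> M"
abbreviation act :: "('l list \<Rightarrow>\<^sub>0 'k) \<Rightarrow> 'k \<times> 'm \<Rightarrow> 'k \<times> 'm"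
  where "act \<equiv> alg_act (pair_scale sc) (cocycle_act sc \<rho> \<phi>)"

sublocale pair: vector_space "pair_scale sc"
  by standard (auto simp: pair_scale_def algebra_simps)

lemma linear_cocycle_act:
  assumes "x \<in> carrier L"
  shows "Vector_Spaces.linear (pair_scale sc) (pair_scale sc) (cocycle_act sc \<rho> \<phi> x)"
proof -
  interpret f: Vector_Spaces.linear sc sc "\<rho> x" using linear_\<rho>[OF assms] .
  show ?thesis
    by standard (auto simp: cocycle_act_def pair_scale_def algebra_simps f.add f.scale)
qed

lemma act_mult: "Poly_Mapping.keys p \<subseteq> lists (carrier L) \<Longrightarrow> act (p * q) m = act p (act q m)"
  by (rule pair.alg_act_mult[OF linear_cocycle_act])

lemma cocycle_act_mem: "x \<in> carrier L \<Longrightarrow> m \<in> E \<Longrightarrow> cocycle_act sc \<rho> \<phi> x m \<in> {0} \<times> M"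
  using \<rho>_closed \<phi>_closed subspace_M by (auto simp: cocycle_act_def subspace_add subspace_scale)

lemma foldr_mem: 
  assumes "w \<in> lists (carrier L)" "m \<in> E" 
  shows "foldr (cocycle_act sc \<rho> \<phi>) w m - (if w = [] then m else 0) \<in> {0} \<times> M"
  using assms
proof (induction w)
  case Nil
  then show ?case using subspace_0[OF subspace_M] by (auto simp: zero_prod_def)
next
  case (Cons x w)
  then have "foldr (cocycle_act sc \<rho> \<phi>) w m \<in> E" by (cases "w = []") (auto simp: mem_Times_iff)
  with Cons(1) cocycle_act_mem[of x "foldr (cocycle_act sc \<rho> \<phi>) w m"] show ?case by simp
qed

text \<open>
  Modulo \<open>M\<close>, every element acts on the extension by its constant term.
\<close>

lemma act_mem:
  assumes "Poly_Mapping.keys p \<subseteq> lists (carrier L)" "m \<in> E"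
  shows "act p m - pair_scale sc (Poly_Mapping.lookup p []) m \<in> {0} \<times> M"
proof -
  have sub: "pair.subspace ({0} \<times> M)"
    using subspace_M unfolding pair.subspace_def subspace_def by (auto simp: pair_scale_def zero_prod_def)
  let ?K = "insert [] (Poly_Mapping.keys p)"
  have "act p m = (\<Sum>w\<in>?K. pair_scale sc (Poly_Mapping.lookup p w) (foldr (cocycle_act sc \<rho> \<phi>) w m))"
    unfolding alg_act_def by (rule pair.linear_ext_superset) auto
  also have "\<dots> - pair_scale sc (Poly_Mapping.lookup p []) m =
     (\<Sum>w\<in>?K. pair_scale sc (Poly_Mapping.lookup p w) (foldr (cocycle_act sc \<rho> \<phi>) w m - (if w = [] then m else 0)))"
    unfolding pair.scale_right_diff_distrib sum_subtractf
    by (simp add: if_distrib[of "pair_scale sc _"] sum.delta cong: if_cong)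
  also have "\<dots> \<in> {0} \<times> M"
    using assms by (intro pair.subspace_sum[OF sub] pair.subspace_scale[OF sub] foldr_mem) auto
  finally show ?thesis .
qed

lemma act_closed:
  assumes "Poly_Mapping.keys p \<subseteq> lists (carrier L)" "m \<in> E" shows "act p m \<in> E"
proof -
  have "snd (act p m) - sc (Poly_Mapping.lookup p []) (snd m) \<in> M" using act_mem[OF assms] by (auto simp: pair_scale_def mem_Times_iff)
  then have "snd (act p m) - sc (Poly_Mapping.lookup p []) (snd m) + sc (Poly_Mapping.lookup p []) (snd m) \<in> M" 
    using assms subspace_M by (intro subspace_add subspace_scale) auto
  then show ?thesis by (auto simp: mem_Times_iff)
qed

definition annihilator :: "('l list \<Rightarrow>\<^sub>0 'k) set" where
  "annihilator = {p. Poly_Mapping.keys p \<subseteq> lists (carrier L) \<and> (\<forall>m\<in>E. act p m = 0)}"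

lemma act_zero_right: "Poly_Mapping.keys p \<subseteq> lists (carrier L) \<Longrightarrow> act p 0 = 0"
  using act_mult[of p 0 0] by (simp add: pair.alg_act_zero)

lemma annihilator_ideal: "ideal annihilator (free_algebra (carrier L))"
proof (rule ideal_free_algebraI)
  fix p q :: "'l list \<Rightarrow>\<^sub>0 'k"
  assume pq: "p \<in> annihilator" "Poly_Mapping.keys q \<subseteq> lists (carrier L)"
  then have "Poly_Mapping.keys (q * p) \<subseteq> lists (carrier L)" "Poly_Mapping.keys (p * q) \<subseteq> lists (carrier L)"
    using keys_mult_lists[of p "carrier L" q] keys_mult_lists[of q "carrier L" p] by (simp_all add: annihilator_def)
  moreover have "act (q * p) m = 0" "act (p * q) m = 0" if "m \<in> E" for m
  proof -
    have p: "Poly_Mapping.keys p \<subseteq> lists (carrier L)" "\<And>m. m \<in> E \<Longrightarrow> act p m = 0"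
      using pq(1) by (auto simp: annihilator_def)
    show "act (q * p) m = 0" using p(2)[OF that] act_zero_right[OF pq(2)] by (simp add: act_mult[OF pq(2)])
    show "act (p * q) m = 0" using p(2)[OF act_closed[OF pq(2) that]] by (simp add: act_mult[OF p(1)])
  qed
  ultimately show "q * p \<in> annihilator \<and> p * q \<in> annihilator" by (auto simp: annihilator_def)
next
  fix p q assume "p \<in> annihilator" "q \<in> annihilator"
  then show "p - q \<in> annihilator"
    using order_trans[OF keys_diff[of p q]] by (simp add: annihilator_def pair.alg_act_diff)
qed (auto simp: annihilator_def pair.alg_act_zero)

text \<open>
  This is where \<open>M\<close> being a module and \<open>\<phi>\<close> being a cocycle are needed: together they say that the
  extension is a module over \<open>L\<close>.
\<close>

lemma relations_annihilate: "enveloping_relations L \<subseteq> annihilator"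
proof
  have M: "sc c m \<in> M" "m + m' \<in> M" if "m \<in> M" "m' \<in> M" for c m m'
    using that subspace_M by (auto simp: subspace_add subspace_scale)
  have keys: "Poly_Mapping.keys p \<subseteq> lists (carrier L)" 
    if "p = Poly_Mapping.single u a - Poly_Mapping.single v b - Poly_Mapping.single w c"
       "{u, v, w} \<subseteq> lists (carrier L)" for p :: "'l list \<Rightarrow>\<^sub>0 'k" and u v w a b c
    using that by (auto simp: in_keys_iff lookup_minus lookup_single when_def split: if_splits)
  fix p assume "p \<in> enveloping_relations L"
  then consider
      (add) x y where "x \<in> carrier L" "y \<in> carrier L"
        "p = Poly_Mapping.single [x \<oplus> y] 1 - Poly_Mapping.single [x] 1 - Poly_Mapping.single [y] 1"
    | (smult) c x where "x \<in> carrier L"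
        "p = Poly_Mapping.single [c \<odot> x] 1 - Poly_Mapping.single [x] c - Poly_Mapping.single [] 0"
    | (bracket) x y where "x \<in> carrier L" "y \<in> carrier L"
        "p = Poly_Mapping.single [x, y] 1 - Poly_Mapping.single [y, x] 1 - Poly_Mapping.single [x \<otimes> y] 1"
    unfolding enveloping_relations_def by auto
  then show "p \<in> annihilator"
  proof cases
    case add
    then have "act p (c, m) = 0" if "m \<in> M" for c m
      using that unfolding add(3) pair.alg_act_diff pair.alg_act_single
      by (simp add: cocycle_act_def pair_scale_def \<rho>_add \<phi>_add
        zero_prod_def algebra_simps)
    with keys[OF add(3)] add show ?thesis by (auto simp: annihilator_def add_closed)
  next
    case smult
    then have "act p (d, m) = 0" if "m \<in> M" for d m
      using that unfolding smult(2) pair.alg_act_diff pair.alg_act_single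
      by (simp add: cocycle_act_def pair_scale_def
        \<rho>_smult \<phi>_smult zero_prod_def algebra_simps)
    with keys[OF smult(2)] smult show ?thesis by (auto simp: annihilator_def smult_closed)
  next
    case bracket
    interpret x: Vector_Spaces.linear sc sc "\<rho> x" using linear_\<rho> bracket by blast
    interpret y: Vector_Spaces.linear sc sc "\<rho> y" using linear_\<rho> bracket by blast
    have "act p (c, m) = 0" if "m \<in> M" for c m
      using that bracket(1,2) unfolding bracket(3) pair.alg_act_diff pair.alg_act_single
      by (simp add: cocycle_act_def pair_scale_def \<rho>_bracket
        \<phi>_bracket zero_prod_def x.add x.scale y.add y.scale algebra_simps)
    with keys[OF bracket(3)] bracket show ?thesis by (auto simp: annihilator_def bracket_closed)
  qed
qed

text \<open>
  The right ideals are those of the elements that annihilate \<open>M\<close> and send \<open>e\<close> into the span of the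
  first \<open>n\<close> vectors. They are closed under right multiplication because \<open>q e\<close> differs from a multiple
  of \<open>e\<close> only by an element of \<open>M\<close>, which the left factor annihilates.
\<close>

theorem not_right_noetherian:
  fixes u :: "nat \<Rightarrow> 'l list \<Rightarrow>\<^sub>0 'k"
  assumes u: "\<And>n. Poly_Mapping.keys (u n) \<subseteq> lists (carrier L)"
    and kills: "\<And>n m. m \<in> M \<Longrightarrow> act (u n) (0, m) = 0"
    and indep: "\<And>n. act (u n) (1, 0) \<notin> pair.span ((\<lambda>i. act (u i) (1, 0)) ` {..<n})"
  shows "\<not> right_noetherian (universal_enveloping_algebra L)"
proof -
  let ?F = "free_algebra (carrier L) :: ('l list \<Rightarrow>\<^sub>0 'k) ring"
  interpret F: ring ?F by (rule ring_free_algebra)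
  define V where "V n = pair.span ((\<lambda>i. act (u i) (1, 0)) ` {..<n})" for n
  define I where "I n = {p. Poly_Mapping.keys p \<subseteq> lists (carrier L) \<and> (\<forall>m\<in>M. act p (0, m) = 0) \<and> act p (1, 0) \<in> V n}" for n
  have "Idl\<^bsub>?F\<^esub> (enveloping_relations L) \<subseteq> annihilator"
    by (rule F.genideal_minimal[OF annihilator_ideal relations_annihilate])
  moreover have "annihilator \<subseteq> I n" for n
    using subspace_0[OF subspace_M] by (auto simp: annihilator_def I_def V_def pair.span_zero)
  moreover have "right_ideal (I n) ?F" for n
  proof -
    have "p * q \<in> I n" if p: "p \<in> I n" and q: "Poly_Mapping.keys q \<subseteq> lists (carrier L)" for p q
    proof -
      have keys: "Poly_Mapping.keys p \<subseteq> lists (carrier L)" using p by (simp add: I_def)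
      have act: "act (p * q) m = pair_scale sc (Poly_Mapping.lookup q []) (act p m)" if "m \<in> E" for m
      proof -
        interpret f: Vector_Spaces.linear "pair_scale sc" "pair_scale sc" "act p"
          by (rule pair.linear_alg_act[of "carrier L", OF linear_cocycle_act keys])
        have "act p (act q m - pair_scale sc (Poly_Mapping.lookup q []) m) = 0"
          using act_mem[OF q that] p by (auto simp: I_def)
        then show ?thesis by (simp add: act_mult[OF keys] f.diff f.scale)
      qed
      moreover have "Poly_Mapping.keys (p * q) \<subseteq> lists (carrier L)"
        using keys q by (rule keys_mult_lists)
      ultimately show ?thesis using p subspace_0[OF subspace_M] by (auto simp: I_def V_def pair.span_scale)
    qed
    moreover have "additive_subgroup (I n) ?F"
    proof (rule additive_subgroup_free_algebraI)
      fix p q assume "p \<in> I n" "q \<in> I n"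
      then show "p - q \<in> I n"
        using keys_diff[of p q] by (auto simp: I_def V_def pair.alg_act_diff pair.span_diff)
    qed (auto simp: I_def V_def pair.alg_act_zero pair.span_zero)
    ultimately show ?thesis by (auto simp: right_ideal_def)
  qed
  moreover have "I n \<subseteq> I (Suc n)" for n
  proof -
    have "(\<lambda>i. act (u i) (1, 0)) ` {..<n} \<subseteq> (\<lambda>i. act (u i) (1, 0)) ` {..<Suc n}" by auto
    from pair.span_mono[OF this] show ?thesis unfolding I_def V_def by blast
  qed
  moreover have "u n \<in> I (Suc n)" "u n \<notin> I n" for n
    using u kills indep by (auto simp: I_def V_def intro!: pair.span_base)
  moreover have "ideal (Idl\<^bsub>?F\<^esub> (enveloping_relations L)) ?F"
    using relations_annihilate by (intro F.genideal_ideal) (auto simp: annihilator_def)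
  ultimately show ?thesis unfolding universal_enveloping_algebra_def
    by (intro not_right_noetherian_quotient[of _ _ I u]) blast+
qed

lemma act_word2:
  assumes "x \<in> carrier L"
  shows "act (Poly_Mapping.single [x, y] c) (d, m) = (0, sc c (sc d (\<rho> x (\<phi> y)) + \<rho> x (\<rho> y m)))"
proof -
  interpret f: Vector_Spaces.linear sc sc "\<rho> x" using linear_\<rho>[OF assms] .
  show ?thesis
    by (simp add: pair.alg_act_single cocycle_act_def pair_scale_def f.add f.scale)
qed

lemma act_word1:
  "act (Poly_Mapping.single [x] c) (d, m) = (0, sc c (sc d (\<phi> x) + \<rho> x m))"
  by (simp add: pair.alg_act_single cocycle_act_def pair_scale_def)

corollary not_noetherian:
  fixes u :: "nat \<Rightarrow> 'l list \<Rightarrow>\<^sub>0 'k"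
  assumes u: "\<And>n. Poly_Mapping.keys (u n) \<subseteq> lists (carrier L)"
    and kills: "\<And>n m. m \<in> M \<Longrightarrow> act (u n) (0, m) = 0"
    and v: "\<And>n. act (u n) (1, 0) = (0, v n)"
    and indep: "\<And>n. v n \<notin> span (v ` {..<n})"
  shows "\<not> noetherian (universal_enveloping_algebra L)"
proof -
  have sub: "pair.subspace (UNIV \<times> span (v ` {..<n}))" for n
    unfolding pair.subspace_def by (auto simp: pair_scale_def zero_prod_def intro: span_add span_scale span_zero)
  have "pair.span ((\<lambda>i. (0, v i)) ` {..<n}) \<subseteq> UNIV \<times> span (v ` {..<n})" for n
    by (rule pair.span_minimal[OF _ sub]) (auto intro: span_base)
  then have "act (u n) (1, 0) \<notin> pair.span ((\<lambda>i. act (u i) (1, 0)) ` {..<n})" for n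
    using indep[of n] by (auto simp: v)
  from not_right_noetherian[OF u kills this] show ?thesis by (simp add: noetherian_def)
qed

end

section \<open>Hilbert's basis theorem\<close>

definition is_subring :: "'a::comm_ring_1 set \<Rightarrow> bool" where
  "is_subring B \<longleftrightarrow> 1 \<in> B \<and> (\<forall>a\<in>B. \<forall>b\<in>B. a - b \<in> B \<and> a * b \<in> B)"

lemma is_subring_0: "is_subring B \<Longrightarrow> 0 \<in> B"
  unfolding is_subring_def by (metis diff_self)

lemma is_subring_uminus: "is_subring B \<Longrightarrow> a \<in> B \<Longrightarrow> - a \<in> B"
  using is_subring_0 unfolding is_subring_def by (metis diff_0)

lemma is_subring_add: "is_subring B \<Longrightarrow> a \<in> B \<Longrightarrow> b \<in> B \<Longrightarrow> a + b \<in> B"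
  using is_subring_uminus[of B b] unfolding is_subring_def by (metis diff_minus_eq_add)

lemma is_subring_diff: "is_subring B \<Longrightarrow> a \<in> B \<Longrightarrow> b \<in> B \<Longrightarrow> a - b \<in> B"
  and is_subring_mult: "is_subring B \<Longrightarrow> a \<in> B \<Longrightarrow> b \<in> B \<Longrightarrow> a * b \<in> B"
  and is_subring_1: "is_subring B \<Longrightarrow> 1 \<in> B"
  unfolding is_subring_def by auto

lemma is_subring_power: "is_subring B \<Longrightarrow> a \<in> B \<Longrightarrow> a ^ n \<in> B"
  by (induction n) (auto intro: is_subring_1 is_subring_mult)

lemma is_subring_sum: "is_subring B \<Longrightarrow> (\<And>i. i \<in> A \<Longrightarrow> f i \<in> B) \<Longrightarrow> sum f A \<in> B"
  by (induction A rule: infinite_finite_induct) (auto intro: is_subring_0 is_subring_add)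

lemmas is_subring_intros = is_subring_0 is_subring_1 is_subring_add is_subring_diff is_subring_mult
  is_subring_uminus is_subring_power is_subring_sum

inductive_set ideal_gen :: "'a::comm_ring_1 set \<Rightarrow> 'a set \<Rightarrow> 'a set" for B G where
  zero: "0 \<in> ideal_gen B G"
| step: "c \<in> B \<Longrightarrow> g \<in> G \<Longrightarrow> r \<in> ideal_gen B G \<Longrightarrow> c * g + r \<in> ideal_gen B G"

lemma ideal_gen_add: "a \<in> ideal_gen B G \<Longrightarrow> b \<in> ideal_gen B G \<Longrightarrow> a + b \<in> ideal_gen B G"
  by (induction rule: ideal_gen.induct) (auto simp: add.assoc intro: ideal_gen.intros)

lemma ideal_gen_mult: "is_subring B \<Longrightarrow> a \<in> ideal_gen B G \<Longrightarrow> b \<in> B \<Longrightarrow> b * a \<in> ideal_gen B G"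
  by (rotate_tac 1, induction rule: ideal_gen.induct)
    (auto simp: distrib_left mult.assoc[symmetric] intro: ideal_gen.intros is_subring_mult)

definition is_ideal :: "'a::comm_ring_1 set \<Rightarrow> 'a set \<Rightarrow> bool" where
  "is_ideal B I \<longleftrightarrow> I \<subseteq> B \<and> 0 \<in> I \<and> (\<forall>a\<in>I. \<forall>b\<in>I. a + b \<in> I) \<and> (\<forall>c\<in>B. \<forall>a\<in>I. c * a \<in> I)"

definition noetherian_subring :: "'a::comm_ring_1 set \<Rightarrow> bool" where
  "noetherian_subring B \<longleftrightarrow> is_subring B \<and>
     (\<forall>I. is_ideal B I \<longrightarrow> (\<exists>G. finite G \<and> G \<subseteq> I \<and> I \<subseteq> ideal_gen B G))"

text \<open>
  Polynomials over \<open>B\<close> enter only through their values at \<open>x\<close>: this set consists of the values of the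
  polynomials of degree less than the last argument.
\<close>

primrec values_below :: "'a::comm_ring_1 set \<Rightarrow> 'a \<Rightarrow> nat \<Rightarrow> 'a set" where
  "values_below B x 0 = {0}"
| "values_below B x (Suc d) = {b * x ^ d + r |b r. b \<in> B \<and> r \<in> values_below B x d}"

definition adjoin :: "'a::comm_ring_1 set \<Rightarrow> 'a \<Rightarrow> 'a set" where
  "adjoin B x = (\<Union>d. values_below B x d)"

lemma values_below_Suc: "is_subring B \<Longrightarrow> values_below B x d \<subseteq> values_below B x (Suc d)"
  using is_subring_0[of B] by force

lemma values_below_mono: "is_subring B \<Longrightarrow> d \<le> e \<Longrightarrow> values_below B x d \<subseteq> values_below B x e"
  by (rule lift_Suc_mono_le[of "values_below B x", OF values_below_Suc])

lemma values_below_add: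
  "is_subring B \<Longrightarrow> a \<in> values_below B x d \<Longrightarrow> b \<in> values_below B x d \<Longrightarrow> a + b \<in> values_below B x d"
proof (induction d arbitrary: a b)
  case (Suc d)
  then obtain p r q s where "a = p * x ^ d + r" "b = q * x ^ d + s" "p \<in> B" "q \<in> B"
    "r \<in> values_below B x d" "s \<in> values_below B x d" by auto
  then have "a + b = (p + q) * x ^ d + (r + s)" "p + q \<in> B" "r + s \<in> values_below B x d"
    using Suc.IH Suc.prems(1) by (simp_all add: algebra_simps is_subring_add)
  then show ?case by auto
qed simp

lemma values_below_mult:
  "is_subring B \<Longrightarrow> c \<in> B \<Longrightarrow> a \<in> values_below B x d \<Longrightarrow> c * a \<in> values_below B x d"
proof (induction d arbitrary: a)
  case (Suc d)
  then obtain p r where "a = p * x ^ d + r" "p \<in> B" "r \<in> values_below B x d" by auto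
  then have "c * a = (c * p) * x ^ d + c * r" "c * p \<in> B" "c * r \<in> values_below B x d"
    using Suc.IH[of r] Suc.prems(1,2) by (simp_all add: is_subring_mult) (simp add: algebra_simps)
  then show ?case by auto
qed simp

lemma values_below_shift:
  "is_subring B \<Longrightarrow> a \<in> values_below B x d \<Longrightarrow> x * a \<in> values_below B x (Suc d)"
proof (induction d arbitrary: a)
  case (Suc d)
  then obtain p r where "a = p * x ^ d + r" "p \<in> B" "r \<in> values_below B x d" by auto
  then have "x * a = p * x ^ Suc d + x * r" "x * r \<in> values_below B x (Suc d)"
    using Suc.IH Suc.prems(1) by (simp_all add: algebra_simps del: values_below.simps)
  with \<open>p \<in> B\<close> show ?case using values_below.simps(2)[of B x "Suc d"] by blast
next
  case 0
  then show ?case using is_subring_0[of B] by auto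
qed

lemma values_below_shift_power:
  "is_subring B \<Longrightarrow> a \<in> values_below B x d \<Longrightarrow> x ^ k * a \<in> values_below B x (d + k)"
  by (induction k) (auto simp: mult.assoc simp del: values_below.simps intro: values_below_shift)

lemma adjoin_mono_degree:
  assumes "is_subring B" "a \<in> adjoin B x" "b \<in> adjoin B x"
  obtains d where "a \<in> values_below B x d" "b \<in> values_below B x d"
proof -
  from assms obtain d e where "a \<in> values_below B x d" "b \<in> values_below B x e" by (auto simp: adjoin_def)
  then have "a \<in> values_below B x (max d e)" "b \<in> values_below B x (max d e)"
    using values_below_mono[OF assms(1)] by (meson max.cobounded1 max.cobounded2 subsetD)+
  then show ?thesis by (rule that)
qed

lemma adjoin_add: "is_subring B \<Longrightarrow> a \<in> adjoin B x \<Longrightarrow> b \<in> adjoin B x \<Longrightarrow> a + b \<in> adjoin B x"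
  using values_below_add[of B a x _ b] adjoin_mono_degree[of B a x b] unfolding adjoin_def by blast

lemma adjoin_smult: "is_subring B \<Longrightarrow> c \<in> B \<Longrightarrow> a \<in> adjoin B x \<Longrightarrow> c * a \<in> adjoin B x"
  by (auto simp: adjoin_def intro: values_below_mult)

lemma adjoin_shift: "is_subring B \<Longrightarrow> a \<in> adjoin B x \<Longrightarrow> x ^ k * a \<in> adjoin B x"
  by (auto simp: adjoin_def intro: values_below_shift_power)

lemma adjoin_mult:
  assumes "is_subring B" "a \<in> adjoin B x" "b \<in> adjoin B x" shows "a * b \<in> adjoin B x"
proof -
  from assms(2) obtain d where "a \<in> values_below B x d" by (auto simp: adjoin_def)
  then show ?thesis
  proof (induction d arbitrary: a)
    case 0
    then show ?case by (auto simp: adjoin_def intro: exI[of _ 0])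
  next
    case (Suc d)
    then obtain p r where pr: "a = p * x ^ d + r" "p \<in> B" "r \<in> values_below B x d" by auto
    then have "a * b = p * (x ^ d * b) + r * b" by (simp add: algebra_simps)
    then show ?case using Suc.IH[OF pr(3)] pr(2) assms
      by (auto intro!: adjoin_add adjoin_smult adjoin_shift)
  qed
qed

lemma subset_adjoin: "is_subring B \<Longrightarrow> B \<subseteq> adjoin B x"
proof
  fix b assume "b \<in> B"
  then have "b \<in> values_below B x (Suc 0)" by force
  then show "b \<in> adjoin B x" unfolding adjoin_def by blast
qed

lemma mem_adjoin: "is_subring B \<Longrightarrow> x \<in> adjoin B x"
  using adjoin_shift[of B 1 x 1] subset_adjoin[of B x] is_subring_1[of B] by auto

lemma is_subring_adjoin: "is_subring B \<Longrightarrow> is_subring (adjoin B x)"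
  using subset_adjoin[of B x] adjoin_mult adjoin_add[of B _ x "- _"] adjoin_smult[of B "- 1" _ x]
  unfolding is_subring_def[of "adjoin B x"]
  by (metis is_subring_1 is_subring_uminus mult_minus1 subsetD uminus_add_conv_diff adjoin_add add.commute)

text \<open>
  The usual proof by leading coefficients, carried out for a subring \<open>B\<close> and an element \<open>x\<close> of an
  ambient ring. Since \<open>x\<close> may be algebraic over \<open>B\<close>, an element has no well-defined degree or leading
  coefficient; \<open>L d\<close> collects all \<open>b\<close> such that the ideal contains some \<open>b x\<^sup>d + r\<close> with \<open>r\<close> of lower
  degree. The ideals \<open>L d\<close> of \<open>B\<close> increase to an ideal generated by a finite subset of \<open>L N\<close>. Lifts of
  generators of \<open>L 0, \<dots>, L N\<close> generate, by induction on the degree of an expression.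
\<close>

theorem hilbert_basis:
  fixes B :: "'a::comm_ring_1 set"
  assumes "noetherian_subring B"
  shows "noetherian_subring (adjoin B x)"
proof -
  have B: "is_subring B" and noeth: "\<And>I. is_ideal B I \<Longrightarrow> \<exists>G. finite G \<and> G \<subseteq> I \<and> I \<subseteq> ideal_gen B G"
    using assms by (auto simp: noetherian_subring_def)
  let ?C = "adjoin B x"
  have C: "is_subring ?C" by (rule is_subring_adjoin[OF B])
  have "\<exists>G. finite G \<and> G \<subseteq> I \<and> I \<subseteq> ideal_gen ?C G" if I: "is_ideal ?C I" for I
  proof -
    have I_add: "a + b \<in> I" and I_mult: "c * a \<in> I" if "a \<in> I" "b \<in> I" "c \<in> ?C" for a b c
      using I that by (auto simp: is_ideal_def)
    have I0: "0 \<in> I" using I by (simp add: is_ideal_def)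
    define L where "L d = {b \<in> B. \<exists>r\<in>values_below B x d. b * x ^ d + r \<in> I}" for d
    have L_Suc: "L d \<subseteq> L (Suc d)" for d
    proof
      fix b assume "b \<in> L d"
      then obtain r where b: "b \<in> B" "r \<in> values_below B x d" "b * x ^ d + r \<in> I" by (auto simp: L_def)
      have "x * (b * x ^ d + r) = b * x ^ Suc d + x * r" by (simp add: algebra_simps)
      moreover have "x * (b * x ^ d + r) \<in> I" using I_mult[OF b(3) b(3) mem_adjoin[OF B]] .
      ultimately show "b \<in> L (Suc d)" using b values_below_shift[OF B b(2)] by (auto simp: L_def)
    qed
    then have L_mono: "L d \<subseteq> L e" if "d \<le> e" for d e using that by (rule lift_Suc_mono_le)
    have L_add: "a + b \<in> L d" if ab: "a \<in> L d" "b \<in> L d" for a b d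
    proof -
      obtain r s where "a \<in> B" "b \<in> B" "r \<in> values_below B x d" "s \<in> values_below B x d"
        "a * x ^ d + r \<in> I" "b * x ^ d + s \<in> I" using ab unfolding L_def by blast
      moreover from this have "(a + b) * x ^ d + (r + s) \<in> I"
        using I_add[of "a * x ^ d + r" "b * x ^ d + s" 0] is_subring_0[OF C] by (simp add: algebra_simps)
      ultimately show ?thesis using is_subring_add[OF B] values_below_add[OF B] by (auto simp: L_def)
    qed
    have L_mult: "c * a \<in> L d" if c: "c \<in> B" "a \<in> L d" for a c d
    proof -
      obtain r where r: "a \<in> B" "r \<in> values_below B x d" "a * x ^ d + r \<in> I" using c by (auto simp: L_def)
      moreover have "c * (a * x ^ d + r) \<in> I" using I_mult[OF r(3) r(3)] c(1) subset_adjoin[OF B] by blast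
      then have "(c * a) * x ^ d + c * r \<in> I" by (simp add: algebra_simps)
      ultimately show ?thesis using c is_subring_mult[OF B] values_below_mult[OF B] by (auto simp: L_def)
    qed
    have L0: "0 \<in> L d" for d
    proof -
      have "0 \<in> values_below B x d" using values_below_mono[OF B, of 0 d x] by auto
      then show ?thesis using I0 is_subring_0[OF B] by (force simp: L_def)
    qed
    have idealL: "is_ideal B (L d)" for d
      using L_add L_mult L0 by (auto simp: is_ideal_def) (simp add: L_def)
    have "is_ideal B (\<Union>d. L d)"
      unfolding is_ideal_def
    proof (intro conjI ballI)
      fix a b assume "a \<in> (\<Union>d. L d)" "b \<in> (\<Union>d. L d)"
      then obtain d e where "a \<in> L d" "b \<in> L e" by auto
      then have "a \<in> L (max d e)" "b \<in> L (max d e)" using L_mono by (meson max.cobounded1 max.cobounded2 subsetD)+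
      then show "a + b \<in> (\<Union>d. L d)" using L_add by blast
    next
      show "(\<Union>d. L d) \<subseteq> B" by (auto simp: L_def)
    qed (use L0 L_mult in blast)+
    from noeth[OF this] obtain G0 where G0: "finite G0" "G0 \<subseteq> (\<Union>d. L d)" "(\<Union>d. L d) \<subseteq> ideal_gen B G0" by auto
    have "\<exists>N. G0 \<subseteq> L N"
      using G0(1,2)
    proof (induction G0 rule: finite_induct)
      case (insert g G)
      then obtain N d where "G \<subseteq> L N" "g \<in> L d" by auto
      then have "insert g G \<subseteq> L (max N d)" using L_mono by (meson insert_subset max.cobounded1 max.cobounded2 subset_trans subsetD)
      then show ?case ..
    qed simp
    then obtain N where N: "G0 \<subseteq> L N" ..
    have "\<exists>G. finite G \<and> G \<subseteq> L d \<and> L d \<subseteq> ideal_gen B G" for d using noeth[OF idealL] .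
    then obtain G where G: "\<And>d. finite (G d)" "\<And>d. G d \<subseteq> L d" "\<And>d. L d \<subseteq> ideal_gen B (G d)" by metis
    define f where "f d g = (SOME a. a \<in> I \<and> (\<exists>r\<in>values_below B x d. a = g * x ^ d + r))" for d g
    have "\<exists>a. a \<in> I \<and> (\<exists>r\<in>values_below B x d. a = g * x ^ d + r)" if "g \<in> L d" for g d
      using that by (auto simp: L_def)
    from someI_ex[OF this]
    have f: "f d g \<in> I" "\<exists>r\<in>values_below B x d. f d g = g * x ^ d + r" if "g \<in> L d" for g d
      using that unfolding f_def by blast+
    define H where "H = (\<Union>d\<le>N. f d ` G d) \<union> f N ` G0"
    have H: "finite H" "H \<subseteq> I" using G(1) f(1) G(2) N G0(1) by (auto simp: H_def subset_iff)
    \<comment> \<open>A combination of leading coefficients is realised by the same combination of the lifts.\<close>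
    have lead: "\<exists>h\<in>ideal_gen ?C H. \<exists>r\<in>values_below B x d. h = b * x ^ d + r"
      if b: "b \<in> ideal_gen B K" and K: "f d ` K \<subseteq> H" "K \<subseteq> L d" for b d K
      using b
    proof (induction rule: ideal_gen.induct)
      case zero
      have "0 \<in> values_below B x d" using values_below_mono[OF B, of 0 d x] by auto
      then show ?case using ideal_gen.zero by force
    next
      case (step c g b)
      then obtain h r where h: "h \<in> ideal_gen ?C H" "r \<in> values_below B x d" "h = b * x ^ d + r" by auto
      obtain s where s: "s \<in> values_below B x d" "f d g = g * x ^ d + s" using f(2) step(2) K(2) by blast
      have "c * f d g + h \<in> ideal_gen ?C H" using step(1,2) K(1) subset_adjoin[OF B] h(1) by (auto intro!: ideal_gen.step)
      moreover have "c * f d g + h = (c * g + b) * x ^ d + (c * s + r)" by (simp add: s h algebra_simps)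
      moreover have "c * s + r \<in> values_below B x d" using s h step(1) values_below_add[OF B] values_below_mult[OF B] by auto
      ultimately show ?case by blast
    qed
    have lead_all: "\<exists>h\<in>ideal_gen ?C H. \<exists>r\<in>values_below B x d. h = b * x ^ d + r" if "b \<in> L d" for b d
    proof (cases "d \<le> N")
      case True
      then have "f d ` G d \<subseteq> H" by (auto simp: H_def)
      then show ?thesis using lead[of b "G d" d] G(2,3)[of d] that by blast
    next
      case False
      have "b \<in> ideal_gen B G0" using that G0(3) by auto
      then obtain h r where h: "h \<in> ideal_gen ?C H" "r \<in> values_below B x N" "h = b * x ^ N + r"
        using lead[of b G0 N] N by (auto simp: H_def)
      have "x ^ (d - N) * h \<in> ideal_gen ?C H"
        using h(1) mem_adjoin[OF B] by (intro ideal_gen_mult[OF C] is_subring_power[OF C])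
      moreover have "x ^ (d - N) * h = b * x ^ d + x ^ (d - N) * r"
        using False by (simp add: h algebra_simps power_add[symmetric])
      moreover have "x ^ (d - N) * r \<in> values_below B x d"
        using values_below_shift_power[OF B h(2), of "d - N"] False by simp
      ultimately show ?thesis by blast
    qed
    have "a \<in> ideal_gen ?C H" if "a \<in> I" "a \<in> values_below B x d" for a d
      using that
    proof (induction d arbitrary: a)
      case 0
      then show ?case by (auto intro: ideal_gen.zero)
    next
      case (Suc d)
      then obtain b r where a: "a = b * x ^ d + r" "b \<in> B" "r \<in> values_below B x d" by auto
      then have "b \<in> L d" using Suc.prems(1) by (auto simp: L_def)
      then obtain h s where h: "h \<in> ideal_gen ?C H" "s \<in> values_below B x d" "h = b * x ^ d + s"
        using lead_all by blast
      have "h \<in> I" using h(1)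
        by (induction rule: ideal_gen.induct) (use H I0 I_add I_mult in auto)
      have "- 1 \<in> ?C" "- 1 \<in> B" using B C by (auto intro: is_subring_intros)
      have "a - h = r + (- 1) * s" by (simp add: a h)
      also have "\<dots> \<in> values_below B x d" using a(3) h(2) \<open>- 1 \<in> B\<close> values_below_add[OF B] values_below_mult[OF B] by blast
      finally have "a - h \<in> values_below B x d" .
      moreover have "a + (- 1) * h \<in> I" using I_add I_mult Suc.prems(1) \<open>h \<in> I\<close> \<open>- 1 \<in> ?C\<close> by blast
      ultimately have "a - h \<in> ideal_gen ?C H" using Suc.IH[of "a - h"] by simp
      then show ?case using ideal_gen_add[OF _ h(1), of "a - h"] by simp
    qed
    then have "I \<subseteq> ideal_gen ?C H" using I by (auto simp: is_ideal_def adjoin_def)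
    with H show ?thesis by blast
  qed
  with C show ?thesis by (auto simp: noetherian_subring_def)
qed


context affine_curve
begin

lemma scale_1_mult: "scale c 1 * a = scale c a"
  using scale_mult_left[of c 1 a] by simp

lemma scale_1_mult_scale_1: "scale c 1 * scale d 1 = scale (c * d) 1"
  by (simp add: scale_1_mult)

lemma noetherian_subring_scalars: "noetherian_subring (range (\<lambda>c. scale c 1))"
proof -
  let ?K = "range (\<lambda>c. scale c 1)"
  have "is_subring ?K"
    unfolding is_subring_def
  proof (intro conjI ballI)
    show "1 \<in> ?K" by (rule range_eqI[of _ _ 1]) simp
    fix a b assume "a \<in> ?K" "b \<in> ?K"
    then obtain c d where "a = scale c 1" "b = scale d 1" by auto
    then show "a - b \<in> ?K" "a * b \<in> ?K"
      by (auto simp: scale_1_mult_scale_1 scale_left_diff_distrib[symmetric])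
  qed
  moreover have "\<exists>G. finite G \<and> G \<subseteq> I \<and> I \<subseteq> ideal_gen ?K G" if I: "is_ideal ?K I" for I
  proof (cases "I = {0}")
    case True
    then show ?thesis by (intro exI[of _ "{}"]) (auto intro: ideal_gen.zero)
  next
    case False
    then obtain a where a: "a \<in> I" "a \<noteq> 0" using I by (auto simp: is_ideal_def)
    then obtain c where c: "a = scale c 1" using I by (auto simp: is_ideal_def)
    have "I \<subseteq> ideal_gen ?K {a}"
    proof
      fix b assume "b \<in> I"
      then obtain d where "b = scale d 1" using I by (auto simp: is_ideal_def)
      moreover have "c \<noteq> 0" using a c by auto
      ultimately have "b = scale (d / c) 1 * a + 0" by (simp add: c scale_1_mult_scale_1)
      then show "b \<in> ideal_gen ?K {a}" using ideal_gen.step[OF _ _ ideal_gen.zero, of "scale (d / c) 1" ?K a "{a}"] by auto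
    qed
    with a show ?thesis by blast
  qed
  ultimately show ?thesis by (auto simp: noetherian_subring_def)
qed

text \<open>
  The scalars form a field, and finitely many generators are adjoined to them.
\<close>

lemma noetherian_coordinate_ring: "noetherian_subring (UNIV :: 'a set)"
proof -
  obtain S :: "'a set" where S: "finite S" "\<And>B. \<lbrakk>S \<subseteq> B; 1 \<in> B; \<forall>a\<in>B. \<forall>b\<in>B. a + b \<in> B;
    \<forall>a\<in>B. \<forall>b\<in>B. a * b \<in> B; \<forall>c. \<forall>a\<in>B. scale c a \<in> B\<rbrakk> \<Longrightarrow> B = UNIV"
    using finitely_generated by metis
  have "\<exists>B. noetherian_subring B \<and> range (\<lambda>c. scale c 1) \<subseteq> B \<and> S \<subseteq> B"
    using S(1)
  proof (induction S rule: finite_induct)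
    case empty
    then show ?case using noetherian_subring_scalars by blast
  next
    case (insert x S)
    then obtain B where B: "noetherian_subring B" "range (\<lambda>c. scale c 1) \<subseteq> B" "S \<subseteq> B" by blast
    then have "is_subring B" by (simp add: noetherian_subring_def)
    with hilbert_basis[OF B(1), of x] B(2,3) subset_adjoin[of B x] mem_adjoin[of B x] show ?case
      by (intro exI[of _ "adjoin B x"]) auto
  qed
  then obtain B where B: "noetherian_subring B" "range (\<lambda>c. scale c 1) \<subseteq> B" "S \<subseteq> B" by blast
  then have sub: "is_subring B" by (simp add: noetherian_subring_def)
  have "scale c a \<in> B" if "a \<in> B" for c a
    using is_subring_mult[OF sub, of "scale c 1" a] B(2) that by (auto simp: scale_1_mult)
  then have "B = UNIV" using B(3) sub by (intro S(2)) (auto intro: is_subring_intros)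
  with B(1) show ?thesis by simp
qed

end

section \<open>Components of a curve\<close>

definition is_prime :: "'a::comm_ring_1 set \<Rightarrow> bool" where
  "is_prime P \<longleftrightarrow> is_ideal UNIV P \<and> 1 \<notin> P \<and> (\<forall>a b. a * b \<in> P \<longrightarrow> a \<in> P \<or> b \<in> P)"

definition mult_closed :: "'a::comm_ring_1 set \<Rightarrow> bool" where
  "mult_closed S \<longleftrightarrow> 1 \<in> S \<and> 0 \<notin> S \<and> (\<forall>a\<in>S. \<forall>b\<in>S. a * b \<in> S)"

text \<open>
  The complements of these sets are the minimal primes. Working with the complements makes Zorn's
  lemma directly applicable and yields the annihilators that describe a minimal prime.
\<close>

definition is_maximal_mult_closed :: "'a::comm_ring_1 set \<Rightarrow> bool" where
  "is_maximal_mult_closed S \<longleftrightarrow> mult_closed S \<and> (\<forall>T. mult_closed T \<longrightarrow> S \<subseteq> T \<longrightarrow> T = S)"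

lemma exists_maximal_mult_closed:
  assumes "mult_closed S"
  shows "\<exists>T. is_maximal_mult_closed T \<and> S \<subseteq> T"
proof -
  let ?A = "{T. mult_closed T \<and> S \<subseteq> T}"
  have "\<exists>M\<in>?A. \<forall>T\<in>?A. M \<subseteq> T \<longrightarrow> T = M"
  proof (rule subset_Zorn_nonempty)
    show "?A \<noteq> {}" using assms by auto
    fix \<C> assume "\<C> \<noteq> {}" and chain: "subset.chain ?A \<C>"
    then have C: "\<And>T. T \<in> \<C> \<Longrightarrow> mult_closed T \<and> S \<subseteq> T" by (auto simp: subset.chain_def)
    have "a * b \<in> \<Union>\<C>" if ab: "a \<in> \<Union>\<C>" "b \<in> \<Union>\<C>" for a b
    proof -
      obtain T U where TU: "T \<in> \<C>" "U \<in> \<C>" "a \<in> T" "b \<in> U" using ab by auto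
      then consider "T \<subseteq> U" | "U \<subseteq> T" using subset.chain_total[OF chain] by blast
      then show ?thesis
      proof cases
        case 1
        with TU have "a * b \<in> U" using C[OF TU(2)] by (auto simp: mult_closed_def)
        with TU show ?thesis by blast
      next
        case 2
        with TU have "a * b \<in> T" using C[OF TU(1)] by (auto simp: mult_closed_def)
        with TU show ?thesis by blast
      qed
    qed
    with C \<open>\<C> \<noteq> {}\<close> show "\<Union>\<C> \<in> ?A" by (fastforce simp: mult_closed_def)
  qed
  then obtain M where M: "mult_closed M" "S \<subseteq> M" "\<And>T. mult_closed T \<Longrightarrow> S \<subseteq> T \<Longrightarrow> M \<subseteq> T \<Longrightarrow> T = M" by auto
  then have "is_maximal_mult_closed M" unfolding is_maximal_mult_closed_def by auto
  with M(2) show ?thesis by blast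
qed

text \<open>
  Otherwise the products \<open>s a\<^sup>n\<close> would form a larger multiplicatively closed set avoiding \<open>0\<close>.
\<close>

lemma maximal_mult_closed_annihilator:
  assumes "is_maximal_mult_closed S" "a \<notin> S"
  shows "\<exists>s\<in>S. \<exists>n. s * a ^ n = 0"
proof (rule ccontr)
  assume no: "\<not> ?thesis"
  have S: "1 \<in> S" "\<And>a b. a \<in> S \<Longrightarrow> b \<in> S \<Longrightarrow> a * b \<in> S"
    using assms(1) by (auto simp: is_maximal_mult_closed_def mult_closed_def)
  let ?T = "{s * a ^ n |s n. s \<in> S}"
  have "x * y \<in> ?T" if xy: "x \<in> ?T" "y \<in> ?T" for x y
  proof -
    obtain s m t n where "x = s * a ^ m" "y = t * a ^ n" "s \<in> S" "t \<in> S" using xy by auto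
    then have "x * y = (s * t) * a ^ (m + n)" "s * t \<in> S" using S by (auto simp: power_add algebra_simps)
    then show ?thesis by blast
  qed
  moreover have in_T: "s * a ^ n \<in> ?T" if "s \<in> S" for s n using that by blast
  ultimately have "mult_closed ?T" using no in_T[OF S(1), of 0] by (auto simp: mult_closed_def)
  moreover have "S \<subseteq> ?T" using in_T[of _ 0] by auto
  ultimately have "?T = S" using assms(1) by (auto simp: is_maximal_mult_closed_def)
  moreover have "a \<in> ?T" using in_T[OF S(1), of 1] by simp
  ultimately show False using assms(2) by simp
qed

text \<open>
  The complement is closed under addition by the binomial theorem: if \<open>s a\<^sup>m = 0\<close> and \<open>t b\<^sup>n = 0\<close>, then
  \<open>s t\<close> annihilates every term of \<open>(a + b)\<^bsup>m+n\<^esup>\<close>.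
\<close>

lemma is_prime_Compl:
  assumes "is_maximal_mult_closed S"
  shows "is_prime (- S)"
proof -
  have S: "1 \<in> S" "0 \<notin> S" "\<And>a b. a \<in> S \<Longrightarrow> b \<in> S \<Longrightarrow> a * b \<in> S"
    using assms by (auto simp: is_maximal_mult_closed_def mult_closed_def)
  have power: "a ^ n \<in> S" if "a \<in> S" for a n using that S by (induction n) auto
  have mem: "a \<notin> S" if "s \<in> S" "s * a ^ n = 0" for s a n using that S power by metis
  note ann = maximal_mult_closed_annihilator[OF assms]
  have mult: "c * a \<notin> S" if "a \<notin> S" for a c
  proof -
    from ann[OF that] obtain s n where "s \<in> S" "s * a ^ n = 0" by blast
    moreover have "s * (c * a) ^ n = c ^ n * (s * a ^ n)" by (simp add: power_mult_distrib ac_simps)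
    ultimately have "s * (c * a) ^ n = 0" by simp
    then show ?thesis using mem \<open>s \<in> S\<close> by blast
  qed
  have "a + b \<notin> S" if ab: "a \<notin> S" "b \<notin> S" for a b
  proof -
    from ann ab obtain s m t n where st: "s \<in> S" "t \<in> S" "s * a ^ m = 0" "t * b ^ n = 0" by metis
    have "s * t * (of_nat ((m + n) choose k) * a ^ k * b ^ (m + n - k)) = 0" if "k \<le> m + n" for k
    proof (cases "m \<le> k")
      case True
      then have "a ^ k = a ^ m * a ^ (k - m)" by (simp add: power_add[symmetric])
      then have "s * t * (of_nat ((m + n) choose k) * a ^ k * b ^ (m + n - k)) =
        (s * a ^ m) * (t * of_nat ((m + n) choose k) * a ^ (k - m) * b ^ (m + n - k))"
        by (simp add: ac_simps)
      then show ?thesis by (simp add: st)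
    next
      case False
      then have "b ^ (m + n - k) = b ^ n * b ^ (m - k)" by (simp add: power_add[symmetric] add.commute)
      then have "s * t * (of_nat ((m + n) choose k) * a ^ k * b ^ (m + n - k)) =
        (t * b ^ n) * (s * of_nat ((m + n) choose k) * a ^ k * b ^ (m - k))"
        by (simp add: ac_simps)
      then show ?thesis by (simp add: st)
    qed
    then have "s * t * (a + b) ^ (m + n) = 0"
      by (simp add: binomial_ring sum_distrib_left)
    then show ?thesis using mem S(3)[OF st(1,2)] by blast
  qed
  then show ?thesis using S mult by (auto simp: is_prime_def is_ideal_def)
qed

lemma mult_closed_Compl: "is_prime P \<Longrightarrow> mult_closed (- P)"
  by (auto simp: is_prime_def mult_closed_def is_ideal_def)

text \<open>
  Minimal primes of components that are not points: a point would give a maximal ideal.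
\<close>

definition is_component :: "'a::comm_ring_1 set \<Rightarrow> bool" where
  "is_component P \<longleftrightarrow> is_maximal_mult_closed (- P) \<and> (\<exists>Q. is_prime Q \<and> P \<subset> Q)"

text \<open>
  The function field is to be a type, so its prime must depend on the ring \<open>'a\<close> alone and not on the
  curve. For rings without a suitable component any prime will do.
\<close>

definition component_prime :: "'a::comm_ring_1 set" where
  "component_prime = (SOME P. is_prime P \<and> ((\<exists>P :: 'a set. is_component P) \<longrightarrow> is_component P))"

lemma component_prime:
  "is_prime (component_prime :: 'a::comm_ring_1 set) \<and>
   ((\<exists>P :: 'a set. is_component P) \<longrightarrow> is_component (component_prime :: 'a set))"
  unfolding component_prime_def
proof (rule someI_ex)
  have "mult_closed {1 :: 'a}" by (simp add: mult_closed_def)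
  then obtain S :: "'a set" where "is_maximal_mult_closed S" using exists_maximal_mult_closed by blast
  then have "is_prime (- S)" by (rule is_prime_Compl)
  moreover have "is_prime P" if "is_component P" for P :: "'a set"
    using that is_prime_Compl[of "- P"] by (simp add: is_component_def)
  ultimately show "\<exists>P :: 'a set. is_prime P \<and> ((\<exists>P :: 'a set. is_component P) \<longrightarrow> is_component P)" by blast
qed

lemma is_prime_if_primeideal:
  assumes "primeideal P (ring_of_type_algebra :: 'a::comm_ring_1 ring)"
  shows "is_prime P"
proof -
  interpret primeideal P "ring_of_type_algebra :: 'a ring" by fact
  have "1 \<notin> P" using one_imp_carrier I_notcarr by (auto simp: ring_of_type_algebra_def)
  then show ?thesis using I_l_closed I_prime 
    additive_subgroup.zero_closed[OF is_additive_subgroup] additive_subgroup.a_closed[OF is_additive_subgroup]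
    by (auto simp: is_prime_def is_ideal_def ring_of_type_algebra_def)
qed

context affine_curve
begin

text \<open>
  A chain of two primes exists in dimension 1; a minimal prime below the smaller one belongs to a
  component that is not a point.
\<close>

lemma is_component_component_prime: "is_component (component_prime :: 'a set)"
proof -
  obtain P where "prime_chain 1 P (ring_of_type_algebra :: 'a ring)"
    using krull_dim_1 by (auto simp: has_krull_dim_def)
  then have P: "is_prime (P 0)" "is_prime (P 1)" "P 0 \<subset> P 1"
    using is_prime_if_primeideal by (auto simp: prime_chain_def)
  obtain S where "is_maximal_mult_closed S" "- P 0 \<subseteq> S"
    using exists_maximal_mult_closed[OF mult_closed_Compl[OF P(1)]] by blast
  then have "is_maximal_mult_closed (- (- S))" "- S \<subset> P 1" using P by auto
  then have "is_component (- S)" using P unfolding is_component_def by blast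
  then show ?thesis using component_prime[where 'a = 'a] by blast
qed

text \<open>
  In a reduced ring each element of a minimal prime is annihilated by an element outside it. For a
  finitely generated prime the product of the annihilators of the generators annihilates everything.
\<close>

lemma component_prime_annihilated: "\<exists>s::'a. s \<notin> component_prime \<and> (\<forall>a\<in>component_prime. s * a = 0)"
proof -
  let ?P = "component_prime :: 'a set"
  have P: "is_prime ?P" "is_maximal_mult_closed (- ?P)"
    using component_prime[where 'a = 'a] is_component_component_prime by (auto simp: is_component_def)
  then have ideal: "is_ideal UNIV ?P" and mult: "\<And>a b. a * b \<in> ?P \<Longrightarrow> a \<in> ?P \<or> b \<in> ?P" and one: "1 \<notin> ?P"
    by (auto simp: is_prime_def)
  have single: "\<exists>s. s \<notin> ?P \<and> s * a = 0" if a: "a \<in> ?P" for a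
  proof -
    obtain s n where s: "s \<notin> ?P" "s * a ^ n = 0" using maximal_mult_closed_annihilator[OF P(2), of a] a by auto
    have "(s * a) ^ Suc n = 0" using s(2) by (simp add: power_mult_distrib) (metis mult.assoc mult.left_commute mult_zero_right)
    then have "s * a = 0" by (rule reduced)
    with s show ?thesis by blast
  qed
  obtain G where G: "finite G" "G \<subseteq> ?P" "?P \<subseteq> ideal_gen UNIV G"
    using noetherian_coordinate_ring ideal unfolding noetherian_subring_def by blast
  have "\<exists>s. s \<notin> ?P \<and> (\<forall>g\<in>G. s * g = 0)"
    using G(1,2)
  proof (induction G rule: finite_induct)
    case empty
    then show ?case using one by auto
  next
    case (insert g G)
    then obtain s t where "s \<notin> ?P" "\<forall>g\<in>G. s * g = 0" "t \<notin> ?P" "t * g = 0" using single by blast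
    moreover from this have "s * t * h = 0" if "h \<in> insert g G" for h
      using that by (auto simp: mult.assoc) (metis mult.left_commute mult_zero_right)
    ultimately have "s * t \<notin> ?P" "\<forall>h\<in>insert g G. s * t * h = 0" using mult by blast+
    then show ?case by blast
  qed
  then obtain s where s: "s \<notin> ?P" "\<forall>g\<in>G. s * g = 0" by blast
  have "s * a = 0" if "a \<in> ideal_gen UNIV G" for a
    using that by (induction rule: ideal_gen.induct) (auto simp: s distrib_left mult.left_commute)
  with s(1) G(3) show ?thesis by blast
qed

end

section \<open>The function field of a component\<close>

quotient_type (overloaded) 'a component_ring = "'a::comm_ring_1" / "\<lambda>a b. a - b \<in> component_prime"
proof (rule equivpI)
  have P: "is_ideal UNIV (component_prime :: 'a set)"
    using component_prime[where 'a = 'a] by (simp add: is_prime_def)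
  have neg: "- a \<in> component_prime" if "a \<in> component_prime" for a :: 'a
    using P that mult_minus1[of a] unfolding is_ideal_def by (metis UNIV_I)
  show "reflp (\<lambda>a b :: 'a. a - b \<in> component_prime)" using P by (auto simp: reflp_def is_ideal_def)
  show "symp (\<lambda>a b :: 'a. a - b \<in> component_prime)"
    using neg by (auto simp: symp_def) (metis minus_diff_eq)
  show "transp (\<lambda>a b :: 'a. a - b \<in> component_prime)"
    using P unfolding transp_def is_ideal_def by (metis add_diff_eq diff_add_cancel)
qed

lemma
  fixes a b c :: "'a::comm_ring_1"
  shows component_prime_add: "a \<in> component_prime \<Longrightarrow> b \<in> component_prime \<Longrightarrow> a + b \<in> component_prime"
  and component_prime_mult: "a \<in> component_prime \<Longrightarrow> c * a \<in> component_prime"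
  and component_prime_mult': "a \<in> component_prime \<Longrightarrow> a * c \<in> component_prime"
  and zero_component_prime: "(0 :: 'a) \<in> component_prime"
  and one_component_prime: "(1 :: 'a) \<notin> component_prime"
  and component_prime_prime: "a * b \<in> component_prime \<Longrightarrow> a \<in> component_prime \<or> b \<in> component_prime"
  using component_prime[where 'a = 'a] by (auto simp: is_prime_def is_ideal_def mult.commute[of a c])

lemma component_prime_uminus: "a \<in> component_prime \<Longrightarrow> - a \<in> component_prime"
  using component_prime_mult[of a "- 1"] by simp

instantiation component_ring :: (comm_ring_1) comm_ring_1
begin

lift_definition zero_component_ring :: "'a component_ring" is 0 .
lift_definition one_component_ring :: "'a component_ring" is 1 .

lift_definition plus_component_ring :: "'a component_ring \<Rightarrow> 'a component_ring \<Rightarrow> 'a component_ring"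
  is "(+)" using component_prime_add by (fastforce simp: algebra_simps)

lift_definition uminus_component_ring :: "'a component_ring \<Rightarrow> 'a component_ring"
  is uminus using component_prime_uminus by fastforce

lift_definition times_component_ring :: "'a component_ring \<Rightarrow> 'a component_ring \<Rightarrow> 'a component_ring"
  is "(*)"
proof -
  fix a b c d :: 'a assume "a - b \<in> component_prime" "c - d \<in> component_prime"
  then have "(a - b) * c + b * (c - d) \<in> component_prime"
    by (intro component_prime_add component_prime_mult component_prime_mult')
  then show "a * c - b * d \<in> component_prime" by (simp add: algebra_simps)
qed

definition minus_component_ring :: "'a component_ring \<Rightarrow> 'a component_ring \<Rightarrow> 'a component_ring"
  where "minus_component_ring a b = a + - b"

instance
proof
  fix a b c :: "'a component_ring"
  show "a * b * c = a * (b * c)" "a * b = b * a" "1 * a = a" "a + b + c = a + (b + c)" "a + b = b + a"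
    "0 + a = a" "- a + a = 0" "(a + b) * c = a * c + b * c"
    by (transfer; simp add: zero_component_prime algebra_simps)+
  show "a - b = a + - b" by (simp add: minus_component_ring_def)
  show "(0 :: 'a component_ring) \<noteq> 1"
    by transfer (use one_component_prime component_prime_uminus in force)
qed

end

instance component_ring :: (comm_ring_1) idom
proof
  fix a b :: "'a component_ring"
  assume "a \<noteq> 0" "b \<noteq> 0"
  then show "a * b \<noteq> 0" by transfer (use component_prime_prime in auto)
qed

type_synonym 'a component_field = "'a component_ring fract"

definition restriction :: "'a::comm_ring_1 \<Rightarrow> 'a component_field" where
  "restriction a = Fract (abs_component_ring a) 1"

lemma restriction_add: "restriction (a + b) = restriction a + restriction b"
  by (simp add: restriction_def plus_component_ring.abs_eq[symmetric])

lemma restriction_mult: "restriction (a * b) = restriction a * restriction b"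
  by (simp add: restriction_def times_component_ring.abs_eq[symmetric])

lemma restriction_1: "restriction 1 = 1"
  by (simp add: restriction_def one_component_ring.abs_eq[symmetric] One_fract_def)

lemma restriction_eq_0_iff: "restriction a = 0 \<longleftrightarrow> a \<in> component_prime"
proof -
  have "restriction a = 0 \<longleftrightarrow> abs_component_ring a = 0"
    by (simp add: restriction_def Zero_fract_def eq_fract)
  also have "\<dots> \<longleftrightarrow> a \<in> component_prime"
    by (simp add: zero_component_ring.abs_eq component_ring.abs_eq_iff)
  finally show ?thesis .
qed

lemma restriction_fraction: "\<exists>a b. restriction b \<noteq> 0 \<and> y = restriction a / restriction b"
proof (cases y)
  case (Fract a b)
  obtain a' b' where "a = abs_component_ring a'" "b = abs_component_ring b'"
    by (metis Quotient_abs_rep Quotient_component_ring)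
  with Fract show ?thesis
    by (intro exI[of _ a'] exI[of _ b']) (auto simp: restriction_def Zero_fract_def eq_fract)
qed

text \<open>
  All that the sequel needs to know about the restriction of functions from the curve to the function
  field of a component. Some function \<open>s\<close> vanishes on the other components but not on this one, so it
  annihilates all functions that restrict to \<open>0\<close>; and the component is not a point, so there is a
  transcendental function on it.
\<close>

locale curve_component = vector_space scale
  for scale :: "'k::field_char_0 \<Rightarrow> 'a::comm_ring_1 \<Rightarrow> 'a" +
  fixes res :: "'a \<Rightarrow> 'f::field"
  assumes scale_mult_left: "scale c (a * b) = scale c a * b"
    and finitely_generated:
      "\<exists>S. finite S \<and>
         (\<forall>B. S \<subseteq> B \<and> 1 \<in> B \<and> (\<forall>a\<in>B. \<forall>b\<in>B. a + b \<in> B) \<and> (\<forall>a\<in>B. \<forall>b\<in>B. a * b \<in> B) \<and>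
              (\<forall>c. \<forall>a\<in>B. scale c a \<in> B) \<longrightarrow> B = UNIV)"
    and res_add: "res (a + b) = res a + res b"
    and res_mult: "res (a * b) = res a * res b"
    and res_1: "res 1 = 1"
    and fraction: "\<exists>a b. res b \<noteq> 0 \<and> y = res a / res b"
    and kernel_annihilated: "\<exists>s. res s \<noteq> 0 \<and> (\<forall>a. res a = 0 \<longrightarrow> s * a = 0)"
    and transcendental: "\<exists>t. \<forall>q. (\<forall>i. coeff q i \<in> range (\<lambda>c. res (scale c 1))) \<longrightarrow> poly q (res t) = 0 \<longrightarrow> q = 0"

context affine_curve
begin

text \<open>
  Let \<open>t\<close> lie in a prime \<open>Q\<close> strictly containing the prime \<open>P\<close> of the component, but not in \<open>P\<close>. The
  constant term of an algebraic equation for \<open>t\<close> lies in \<open>Q\<close>, so it is a scalar that is not a unit,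
  that is, \<open>0\<close>; then \<open>t\<close> can be cancelled.
\<close>

lemma transcendental_function:
  "\<exists>t::'a. \<forall>q. (\<forall>i. coeff q i \<in> range (\<lambda>c. restriction (scale c 1))) \<longrightarrow> poly q (restriction t) = 0 \<longrightarrow> q = 0"
proof -
  let ?K = "range (\<lambda>c. restriction (scale c 1))"
  obtain Q :: "'a set" where Q: "is_prime Q" "component_prime \<subset> Q"
    using is_component_component_prime by (auto simp: is_component_def)
  then obtain t where t: "t \<in> Q" "t \<notin> component_prime" by auto
  have evaluation: "\<exists>a. poly q (restriction t) = restriction a" if "\<And>i. coeff q i \<in> ?K" for q
    using that
  proof (induction q)
    case 0
    show ?case by (rule exI[of _ 0]) (simp add: restriction_eq_0_iff[of 0] zero_component_prime)
  next
    case (pCons c q)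
    from pCons.prems[of 0] obtain b where "c = restriction b" by auto
    moreover have "coeff q i \<in> ?K" for i using pCons.prems[of "Suc i"] by simp
    then obtain a where "poly q (restriction t) = restriction a" using pCons.IH by blast
    ultimately have "poly (pCons c q) (restriction t) = restriction (b + t * a)" by (simp add: restriction_add restriction_mult)
    then show ?case ..
  qed
  have "q = 0" if "\<And>i. coeff q i \<in> ?K" "poly q (restriction t) = 0" for q
    using that
  proof (induction q)
    case (pCons c q)
    have coeffs: "coeff q i \<in> ?K" for i using pCons.prems(1)[of "Suc i"] by simp
    from pCons.prems(1)[of 0] obtain d where d: "c = restriction (scale d 1)" by auto
    obtain a where a: "poly q (restriction t) = restriction a" using evaluation coeffs by blast
    have "restriction (scale d 1 + t * a) = 0" using pCons.prems(2) by (simp add: d a restriction_add restriction_mult)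
    then have "scale d 1 + t * a \<in> Q" using Q(2) by (auto simp: restriction_eq_0_iff)
    moreover have "- a * t \<in> Q" using Q(1) t(1) unfolding is_prime_def is_ideal_def by blast
    ultimately have "(scale d 1 + t * a) + - a * t \<in> Q" using Q(1) unfolding is_prime_def is_ideal_def by blast
    then have dQ: "scale d 1 \<in> Q" by (simp add: algebra_simps)
    have "d = 0"
    proof (rule ccontr)
      assume "d \<noteq> 0"
      then have "scale (inverse d) 1 * scale d 1 = 1" by (simp add: scale_1_mult_scale_1)
      moreover have "scale (inverse d) 1 * scale d 1 \<in> Q" using dQ Q(1) by (simp add: is_prime_def is_ideal_def)
      ultimately show False using Q(1) by (simp add: is_prime_def)
    qed
    then have "c = 0" by (simp add: d restriction_eq_0_iff zero_component_prime)
    moreover have "restriction t \<noteq> 0" using t(2) by (simp add: restriction_eq_0_iff)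
    ultimately have "poly q (restriction t) = 0" using pCons.prems(2) by simp
    with pCons.IH coeffs \<open>c = 0\<close> show ?case by simp
  qed simp
  then show ?thesis by blast
qed

lemma curve_component: "curve_component scale (restriction :: 'a \<Rightarrow> 'a component_field)"
  apply unfold_locales
  subgoal by (rule scale_mult_left)
  subgoal by (rule finitely_generated)
  subgoal by (rule restriction_add)
  subgoal by (rule restriction_mult)
  subgoal by (rule restriction_1)
  subgoal by (rule restriction_fraction)
  subgoal using component_prime_annihilated by (auto simp: restriction_eq_0_iff)
  subgoal by (rule transcendental_function)
  done

end

section \<open>Extension of derivations\<close>

definition polys :: "'f::comm_ring_1 set \<Rightarrow> 'f poly set" where
  "polys B = {q. \<forall>i. coeff q i \<in> B}"

definition derivation_on :: "'f::comm_ring_1 set \<Rightarrow> ('f \<Rightarrow> 'f) \<Rightarrow> bool" where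
  "derivation_on B d \<longleftrightarrow> (\<forall>a\<in>B. \<forall>b\<in>B. d (a + b) = d a + d b \<and> d (a * b) = d a * b + a * d b)"

lemma polys_diff: "is_subring B \<Longrightarrow> p \<in> polys B \<Longrightarrow> q \<in> polys B \<Longrightarrow> p - q \<in> polys B"
  and polys_add: "is_subring B \<Longrightarrow> p \<in> polys B \<Longrightarrow> q \<in> polys B \<Longrightarrow> p + q \<in> polys B"
  and polys_mult: "is_subring B \<Longrightarrow> p \<in> polys B \<Longrightarrow> q \<in> polys B \<Longrightarrow> p * q \<in> polys B"
  and polys_monom: "is_subring B \<Longrightarrow> b \<in> B \<Longrightarrow> monom b n \<in> polys B"
  and polys_const: "is_subring B \<Longrightarrow> b \<in> B \<Longrightarrow> [:b:] \<in> polys B"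
  by (auto simp: polys_def coeff_mult coeff_pCons intro: is_subring_intros split: nat.splits)

lemma polys_pderiv:
  assumes "is_subring B" "q \<in> polys B" shows "pderiv q \<in> polys B"
proof -
  have "of_nat n \<in> B" for n
    by (induction n) (use assms(1) in \<open>auto intro: is_subring_intros\<close>)
  with assms show ?thesis by (auto simp: polys_def coeff_pderiv simp del: of_nat_Suc intro: is_subring_mult)
qed

text \<open>
  A derivation defined on a subring \<open>B\<close> of a field, with values in the field. Outside \<open>B\<close> the function
  is arbitrary.
\<close>

locale ring_derivation =
  fixes B :: "'f::field set" and d :: "'f \<Rightarrow> 'f"
  assumes subring: "is_subring B" and derivation: "derivation_on B d"
begin

lemma d_add: "a \<in> B \<Longrightarrow> b \<in> B \<Longrightarrow> d (a + b) = d a + d b"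
  and d_mult: "a \<in> B \<Longrightarrow> b \<in> B \<Longrightarrow> d (a * b) = d a * b + a * d b"
  using derivation by (auto simp: derivation_on_def)

lemma d_0: "d 0 = 0"
  using d_add[of 0 0] is_subring_0[OF subring] by (metis add.right_neutral add_left_cancel)

lemma d_1: "d 1 = 0"
  using d_mult[of 1 1] is_subring_1[OF subring]
  by (metis add.right_neutral add_left_cancel mult.left_neutral mult.right_neutral)

lemma d_sum: "finite A \<Longrightarrow> (\<And>i. i \<in> A \<Longrightarrow> f i \<in> B) \<Longrightarrow> d (sum f A) = (\<Sum>i\<in>A. d (f i))"
proof (induction A rule: finite_induct)
  case (insert x A)
  then have "sum f A \<in> B" by (intro is_subring_sum[OF subring]) auto
  with insert show ?case by (simp add: d_add)
qed (simp add: d_0)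

text \<open>
  The only possible value at \<open>q(x)\<close> of an extension of \<open>d\<close> to \<open>B[x]\<close> that maps \<open>x\<close> to \<open>c\<close>. As a function
  of the polynomial \<open>q\<close> it is a derivation along evaluation at \<open>x\<close>.
\<close>

definition ext :: "'f \<Rightarrow> 'f \<Rightarrow> 'f poly \<Rightarrow> 'f" where
  "ext x c q = poly (map_poly d q) x + poly (pderiv q) x * c"

lemma ext_add: "p \<in> polys B \<Longrightarrow> q \<in> polys B \<Longrightarrow> ext x c (p + q) = ext x c p + ext x c q"
proof -
  assume "p \<in> polys B" "q \<in> polys B"
  then have "map_poly d (p + q) = map_poly d p + map_poly d q"
    by (intro poly_eqI) (simp add: coeff_map_poly d_0 d_add polys_def)
  then show ?thesis by (simp add: ext_def pderiv_add algebra_simps)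
qed

lemma ext_mult:
  assumes "p \<in> polys B" "q \<in> polys B"
  shows "ext x c (p * q) = ext x c p * poly q x + poly p x * ext x c q"
proof -
  have mem: "coeff p i \<in> B" "coeff q i \<in> B" for i using assms by (auto simp: polys_def)
  have "map_poly d (p * q) = map_poly d p * q + p * map_poly d q"
    by (intro poly_eqI)
      (simp add: coeff_map_poly coeff_mult d_0 d_sum d_mult mem is_subring_mult[OF subring] sum.distrib)
  then show ?thesis by (simp add: ext_def pderiv_mult algebra_simps)
qed

lemma ext_0: "ext x c 0 = 0"
  by (simp add: ext_def)

lemma ext_diff: "p \<in> polys B \<Longrightarrow> q \<in> polys B \<Longrightarrow> ext x c (p - q) = ext x c p - ext x c q"
  using ext_add[of "p - q" q x c] polys_diff[OF subring, of p q] by simp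

lemma ext_const: "ext x c [:b:] = d b"
  by (simp add: ext_def map_poly_pCons d_0 pderiv_pCons)

lemma ext_X: "ext x c [:0, 1:] = c"
  by (simp add: ext_def map_poly_pCons d_0 pderiv_pCons d_1)

text \<open>
  The vanishing condition says exactly that the extension is well defined on values of polynomials.
\<close>

lemma extend_derivation:
  assumes vanish: "\<And>q. q \<in> polys B \<Longrightarrow> poly q x = 0 \<Longrightarrow> ext x c q = 0"
  shows "\<exists>C e. is_subring C \<and> derivation_on C e \<and> B \<subseteq> C \<and> x \<in> C \<and> (\<forall>b\<in>B. e b = d b) \<and> e x = c"
proof -
  define C where "C = (\<lambda>q. poly q x) ` polys B"
  define e where "e y = ext x c (SOME q. q \<in> polys B \<and> poly q x = y)" for y
  have e: "e (poly q x) = ext x c q" if "q \<in> polys B" for q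
  proof -
    define p where "p = (SOME p. p \<in> polys B \<and> poly p x = poly q x)"
    have p: "p \<in> polys B \<and> poly p x = poly q x" unfolding p_def by (rule someI[of _ q]) (use that in simp)
    then have "ext x c (p - q) = 0" using that polys_diff[OF subring] by (intro vanish) auto
    then show ?thesis using p that by (simp add: e_def p_def[symmetric] ext_diff)
  qed
  have "1 \<in> polys B" using polys_const[OF subring is_subring_1[OF subring]] by (simp add: one_pCons)
  then have "1 \<in> C" unfolding C_def by (rule rev_image_eqI) simp
  moreover have "y - z \<in> C" "y * z \<in> C" if yz: "y \<in> C" "z \<in> C" for y z
  proof -
    obtain p q where pq: "p \<in> polys B" "q \<in> polys B" "y = poly p x" "z = poly q x"
      using yz by (auto simp: C_def)
    show "y - z \<in> C" unfolding C_def
      by (rule rev_image_eqI[OF polys_diff[OF subring pq(1,2)]]) (simp add: pq)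
    show "y * z \<in> C" unfolding C_def
      by (rule rev_image_eqI[OF polys_mult[OF subring pq(1,2)]]) (simp add: pq)
  qed
  ultimately have "is_subring C" by (simp add: is_subring_def)
  moreover have "derivation_on C e"
    unfolding derivation_on_def C_def
    by (auto simp: e ext_add ext_mult polys_add[OF subring] polys_mult[OF subring] simp flip: poly_add poly_mult)
  moreover have "b \<in> C \<and> e b = d b" if "b \<in> B" for b
    using e[of "[:b:]"] polys_const[OF subring that] by (force simp: C_def ext_const)
  moreover have "[:0, 1:] \<in> polys B"
    using is_subring_0[OF subring] is_subring_1[OF subring]
    by (auto simp: polys_def coeff_pCons split: nat.splits)
  then have "x \<in> C \<and> e x = c" using e[of "[:0, 1:]"] by (force simp: C_def ext_X)
  ultimately show ?thesis by blast
qed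

text \<open>
  If \<open>x\<close> is transcendental over \<open>B\<close>, there is no condition on \<open>c\<close>. Otherwise a polynomial \<open>m\<close> of minimal
  degree with root \<open>x\<close> determines \<open>c\<close>, since \<open>m'(x) \<noteq> 0\<close> in characteristic \<open>0\<close>. The condition for any
  other \<open>q\<close> with root \<open>x\<close> follows by pseudo-division: \<open>B\<close> is not a field, so \<open>q\<close> is multiplied by the
  leading coefficient of \<open>m\<close> before a multiple of \<open>m\<close> is subtracted.
\<close>

lemma exists_vanishing_ext:
  assumes char: "\<And>n. n > 0 \<Longrightarrow> (of_nat n :: 'f) \<noteq> 0"
  shows "\<exists>c. \<forall>q\<in>polys B. poly q x = 0 \<longrightarrow> ext x c q = 0"
proof (cases "\<exists>q\<in>polys B. q \<noteq> 0 \<and> poly q x = 0")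
  case False
  have "ext x 0 q = 0" if "q \<in> polys B" "poly q x = 0" for q
  proof -
    have "q = 0" using False that by blast
    then show ?thesis by (simp add: ext_0)
  qed
  then show ?thesis by blast
next
  case True
  then obtain q where "q \<in> polys B \<and> q \<noteq> 0 \<and> poly q x = 0" by blast
  from ex_has_least_nat[of "\<lambda>q. q \<in> polys B \<and> q \<noteq> 0 \<and> poly q x = 0", OF this, of degree]
  obtain m where m: "m \<in> polys B" "m \<noteq> 0" "poly m x = 0"
    and min: "\<And>q. q \<in> polys B \<Longrightarrow> q \<noteq> 0 \<Longrightarrow> poly q x = 0 \<Longrightarrow> degree m \<le> degree q"
    by blast
  have deg: "degree m > 0" using m(2,3) by (cases "degree m") (auto elim!: degree_eq_zeroE)
  have "coeff (pderiv m) (degree m - 1) = of_nat (degree m) * lead_coeff m"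
    using deg by (simp add: coeff_pderiv del: of_nat_Suc)
  then have "pderiv m \<noteq> 0" using char[OF deg] m(2) by (metis coeff_0 leading_coeff_0_iff mult_eq_0_iff)
  moreover have "degree (pderiv m) < degree m"
  proof -
    have "degree (pderiv m) \<le> degree m - 1"
      by (rule degree_le) (simp add: coeff_pderiv coeff_eq_0 del: of_nat_Suc)
    with deg show ?thesis by linarith
  qed
  ultimately have simple: "poly (pderiv m) x \<noteq> 0"
    using min[OF polys_pderiv[OF subring m(1)]] by force
  define c where "c = - poly (map_poly d m) x / poly (pderiv m) x"
  \<comment> \<open>The choice of \<open>c\<close> solves the condition for \<open>m\<close> itself.\<close>
  have m0: "ext x c m = 0" using simple by (simp add: ext_def c_def)
  have "ext x c q = 0" if "q \<in> polys B" "poly q x = 0" for q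
    using that
  proof (induction "degree q" arbitrary: q rule: less_induct)
    case less
    show ?case
    proof (cases "q = 0")
      case True
      then show ?thesis by (simp add: ext_0)
    next
      case False
      then have le: "degree m \<le> degree q" using min less.prems by blast
      let ?a = "lead_coeff m" and ?b = "monom (lead_coeff q) (degree q - degree m)"
      have aB: "?a \<in> B" and lq: "lead_coeff q \<in> B" using m(1) less.prems(1) by (auto simp: polys_def)
      have a: "[:?a:] \<in> polys B" and b: "?b \<in> polys B" using polys_const[OF subring aB] polys_monom[OF subring lq] by auto
      define r where "r = [:?a:] * q - ?b * m"
      have "r \<in> polys B" unfolding r_def
        by (intro polys_diff[OF subring] polys_mult[OF subring] a b m(1) less.prems(1))
      moreover have "poly r x = 0" using m(3) less.prems(2) by (simp add: r_def)
      ultimately have r: "r \<in> polys B" "poly r x = 0" .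
      have "degree ([:?a:] * q) \<le> degree q" by simp
      moreover have "degree (?b * m) \<le> degree q"
        using degree_mult_le[of ?b m] degree_monom_le[of "lead_coeff q" "degree q - degree m"] le by linarith
      ultimately have "degree r \<le> degree q" unfolding r_def by (rule degree_diff_le)
      moreover have "coeff r (degree q) = 0" using le by (simp add: r_def coeff_monom_mult)
      ultimately have "r = 0 \<or> degree r < degree q" by (rule eq_zero_or_degree_less)
      then have "ext x c r = 0" using less.hyps[OF _ r] by (auto simp: ext_0)
      moreover have "ext x c r = ?a * ext x c q"
        unfolding r_def using a b m less.prems polys_mult[OF subring]
        by (simp add: ext_diff ext_mult m0 del: mult_pCons_left)
      ultimately show ?thesis using m(2) by simp
    qed
  qed
  then show ?thesis by blast
qed

end

section \<open>A vector field that does not vanish on the component\<close>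

context curve_component
begin

lemma res_0: "res 0 = 0" using res_add[of 0 0] by (metis add.right_neutral add_left_cancel)
lemma res_uminus: "res (- a) = - res a" using res_add[of a "- a"] by (simp add: res_0 eq_neg_iff_add_eq_0 add.commute)
lemma res_diff: "res (a - b) = res a - res b" using res_add[of a "- b"] by (simp add: res_uminus)

lemma res_power: "res (a ^ n) = res a ^ n"
  by (induction n) (simp_all add: res_1 res_mult)

definition emb :: "'k \<Rightarrow> 'f" where "emb c = res (scale c 1)"

lemma res_scale: "res (scale c a) = emb c * res a"
  using scale_mult_left[of c 1 a] by (simp add: emb_def res_mult[symmetric])

lemma emb_add: "emb (a + b) = emb a + emb b" by (simp add: emb_def scale_left_distrib res_add)
lemma emb_0: "emb 0 = 0" by (simp add: emb_def res_0)
lemma emb_1: "emb 1 = 1" by (simp add: emb_def res_1)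
lemma emb_mult: "emb (a * b) = emb a * emb b"
  using res_scale[of a "scale b 1"] by (simp add: emb_def)
lemma emb_diff: "emb (a - b) = emb a - emb b" by (simp add: emb_def scale_left_diff_distrib res_diff)

lemma emb_of_nat: "emb (of_nat n) = of_nat n"
  by (induction n) (simp_all add: emb_0 emb_add emb_1)

lemma emb_eq_0_iff: "emb c = 0 \<longleftrightarrow> c = 0"
  using emb_mult[of c "inverse c"] by (cases "c = 0") (auto simp: emb_0 emb_1)

lemma of_nat_neq_0: "n > 0 \<Longrightarrow> (of_nat n :: 'f) \<noteq> 0"
  by (metis emb_of_nat emb_eq_0_iff of_nat_eq_0_iff less_numeral_extra(3))

lemma is_subring_emb: "is_subring (range emb)"
  unfolding is_subring_def
proof (intro conjI ballI)
  show "1 \<in> range emb" by (metis emb_1 rangeI)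
  fix a b assume "a \<in> range emb" "b \<in> range emb"
  then show "a - b \<in> range emb" "a * b \<in> range emb"
    by (auto simp flip: emb_diff emb_mult)
qed

definition generators :: "'a set" where
  "generators = (SOME S. finite S \<and> (\<forall>B. S \<subseteq> B \<and> 1 \<in> B \<and> (\<forall>a\<in>B. \<forall>b\<in>B. a + b \<in> B) \<and> (\<forall>a\<in>B. \<forall>b\<in>B. a * b \<in> B) \<and>
              (\<forall>c. \<forall>a\<in>B. scale c a \<in> B) \<longrightarrow> B = UNIV))"

lemma finite_generators: "finite generators"
  using someI_ex[OF finitely_generated, folded generators_def] by (rule conjunct1)

lemma generators_induct:
  assumes "\<And>a. a \<in> generators \<Longrightarrow> P a" "P 1" "\<And>a b. P a \<Longrightarrow> P b \<Longrightarrow> P (a + b)"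
    "\<And>a b. P a \<Longrightarrow> P b \<Longrightarrow> P (a * b)" "\<And>c a. P a \<Longrightarrow> P (scale c a)"
  shows "P a"
  using spec[OF conjunct2[OF someI_ex[OF finitely_generated, folded generators_def]], of "Collect P"] assms
  by auto

text \<open>
  Start with \<open>d/dt\<close> on \<open>k[t]\<close> and adjoin the generators of the coordinate ring one by one.
\<close>
lemma exists_derivation_to_field:
  assumes t: "\<And>q. q \<in> polys (range emb) \<Longrightarrow> poly q (res t) = 0 \<Longrightarrow> q = 0"
  shows "\<exists>d. derivation_on (range res) d \<and> (\<forall>c. d (emb c) = 0) \<and> d (res t) = 1"
proof -
  interpret K: ring_derivation "range emb" "\<lambda>_. 0"
    by standard (auto simp: is_subring_emb derivation_on_def)
  have "\<exists>B d. is_subring B \<and> derivation_on B d \<and> range emb \<subseteq> B \<and> res t \<in> B \<and>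
      (\<forall>b\<in>range emb. d b = 0) \<and> d (res t) = 1"
  proof (rule K.extend_derivation)
    fix q assume "q \<in> polys (range emb)" "poly q (res t) = 0"
    then have "q = 0" by (rule t)
    then show "K.ext (res t) 1 q = 0" by (simp add: K.ext_0)
  qed
  then have base: "\<exists>B d. is_subring B \<and> derivation_on B d \<and> range emb \<subseteq> B \<and> res t \<in> B \<and>
      (\<forall>b\<in>range emb. d b = 0) \<and> d (res t) = 1 \<and> res ` {} \<subseteq> B" by simp
  have "\<exists>B d. is_subring B \<and> derivation_on B d \<and> range emb \<subseteq> B \<and> res t \<in> B \<and>
      (\<forall>b\<in>range emb. d b = 0) \<and> d (res t) = 1 \<and> res ` S \<subseteq> B" if "finite S" for S
    using that
  proof (induction S rule: finite_induct)
    case empty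
    then show ?case using base .
  next
    case (insert x S)
    then obtain B d where B: "is_subring B" "derivation_on B d" "range emb \<subseteq> B" "res t \<in> B"
      "\<forall>b\<in>range emb. d b = 0" "d (res t) = 1" "res ` S \<subseteq> B" by blast
    then interpret ring_derivation B d by unfold_locales
    obtain c where "\<forall>q\<in>polys B. poly q (res x) = 0 \<longrightarrow> ext (res x) c q = 0"
      using exists_vanishing_ext[OF of_nat_neq_0] by blast
    then obtain C e where C: "is_subring C" "derivation_on C e" "B \<subseteq> C" "res x \<in> C" "\<forall>b\<in>B. e b = d b"
      using extend_derivation[of "res x" c] by blast
    have "\<forall>b\<in>range emb. e b = 0" using B(3,5) C(5) by (metis subsetD)
    moreover have "range emb \<subseteq> C" "res t \<in> C" "e (res t) = 1" "res ` insert x S \<subseteq> C"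
      using B C by auto
    ultimately show ?case using C(1,2) by blast
  qed
  from this[OF finite_generators]
  obtain B d where B: "is_subring B" "derivation_on B d" "range emb \<subseteq> B"
    "\<forall>b\<in>range emb. d b = 0" "d (res t) = 1" "res ` generators \<subseteq> B" by blast
  have "res a \<in> B" for a
    by (induction a rule: generators_induct)
      (use B in \<open>auto simp: res_add res_mult res_1 res_scale intro!: is_subring_intros\<close>)
  then have "derivation_on (range res) d" using B(2) by (auto simp: derivation_on_def)
  with B show ?thesis by blast
qed

text \<open>
  The derivation \<open>d\<close> into the function field is multiplied by a common denominator \<open>h\<close> of its values on
  the generators. The function \<open>e a\<close> represents \<open>h d(a)\<close>, which determines it only up to functions
  vanishing on the component; multiplication by \<open>s\<close> removes the ambiguity.
\<close>

theorem exists_derivation: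
  "\<exists>D t. D \<in> derivations scale \<and> res (D t) \<noteq> 0 \<and> (\<forall>q\<in>polys (range emb). poly q (res t) = 0 \<longrightarrow> q = 0)"
proof -
  obtain t where t: "\<And>q. q \<in> polys (range emb) \<Longrightarrow> poly q (res t) = 0 \<Longrightarrow> q = 0"
    using transcendental by (auto simp: polys_def emb_def[abs_def])
  obtain d where d: "derivation_on (range res) d" "\<And>c. d (emb c) = 0" "d (res t) = 1"
    using exists_derivation_to_field[OF t] by blast
  define \<delta> where "\<delta> a = d (res a)" for a
  have \<delta>_add: "\<delta> (a + b) = \<delta> a + \<delta> b" and \<delta>_mult: "\<delta> (a * b) = \<delta> a * res b + res a * \<delta> b" for a b
    using d(1) by (auto simp: \<delta>_def derivation_on_def res_add res_mult)
  have \<delta>_scale: "\<delta> (scale c a) = emb c * \<delta> a" for c a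
    using \<delta>_mult[of "scale c 1" a] scale_mult_left[of c 1 a] d(2)[of c] by (simp add: \<delta>_def emb_def)
  have "\<exists>h. res h \<noteq> 0 \<and> (\<forall>a\<in>S. \<exists>b. res b = res h * \<delta> a)" if "finite S" for S
    using that
  proof (induction S rule: finite_induct)
    case empty
    show ?case by (rule exI[of _ 1]) (simp add: res_1)
  next
    case (insert x S)
    then obtain h where h: "res h \<noteq> 0" "\<forall>a\<in>S. \<exists>b. res b = res h * \<delta> a" by blast
    obtain p q where pq: "res q \<noteq> 0" "\<delta> x = res p / res q" using fraction by blast
    have "\<exists>b. res b = res (h * q) * \<delta> a" if "a \<in> insert x S" for a
    proof (cases "a = x")
      case True
      have "res (h * p) = res (h * q) * \<delta> x" using pq by (simp add: res_mult)
      with True show ?thesis by blast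
    next
      case False
      with that h obtain b where "res b = res h * \<delta> a" by blast
      then have "res (q * b) = res (h * q) * \<delta> a" by (simp add: res_mult ac_simps)
      then show ?thesis by blast
    qed
    moreover have "res (h * q) \<noteq> 0" using h pq by (simp add: res_mult)
    ultimately show ?case by blast
  qed
  from this[OF finite_generators]
  obtain h where h: "res h \<noteq> 0" "\<forall>a\<in>generators. \<exists>b. res b = res h * \<delta> a"
    by blast
  have "\<exists>b. res b = res h * \<delta> a" for a
  proof (induction a rule: generators_induct)
    case 1
    then show ?case using h(2) by blast
  next
    case 2
    have "\<delta> 1 = 0" using d(2)[of 1] by (simp add: \<delta>_def emb_1 res_1)
    then show ?case using res_0 by auto
  next
    case (3 a b)
    then obtain p q where "res p = res h * \<delta> a" "res q = res h * \<delta> b" by blast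
    then have "res (p + q) = res h * \<delta> (a + b)" by (simp add: res_add \<delta>_add algebra_simps)
    then show ?case by blast
  next
    case (4 a b)
    then obtain p q where "res p = res h * \<delta> a" "res q = res h * \<delta> b" by blast
    then have "res (p * b + a * q) = res h * \<delta> (a * b)" by (simp add: res_add res_mult \<delta>_mult algebra_simps)
    then show ?case by blast
  next
    case (5 c a)
    then obtain p where "res p = res h * \<delta> a" by blast
    then have "res (scale c p) = res h * \<delta> (scale c a)" by (simp add: res_scale \<delta>_scale algebra_simps)
    then show ?case by blast
  qed
  then have "\<forall>a. \<exists>b. res b = res h * \<delta> a" ..
  from choice[OF this] obtain e where e: "\<And>a. res (e a) = res h * \<delta> a" by auto
  obtain s where s: "res s \<noteq> 0" "\<And>a. res a = 0 \<Longrightarrow> s * a = 0" using kernel_annihilated by blast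
  have s_eq: "s * a = s * b" if "res a = res b" for a b
    using s(2)[of "a - b"] that by (simp add: res_diff algebra_simps)
  define D where "D a = s * e a" for a
  have "D (a * b) = D a * b + a * D b" for a b
    using s_eq[of "e (a * b)" "e a * b + a * e b"]
    by (simp add: D_def e res_add res_mult \<delta>_mult algebra_simps)
  moreover have "Vector_Spaces.linear scale scale D"
  proof
    show "D (a + b) = D a + D b" for a b
      using s_eq[of "e (a + b)" "e a + e b"] by (simp add: D_def e res_add \<delta>_add algebra_simps)
    show "D (scale c a) = scale c (D a)" for c a
      using s_eq[of "e (scale c a)" "scale c (e a)"] scale_mult_left[of c "e a" s]
      by (simp add: D_def e res_scale \<delta>_scale mult.commute mult.left_commute)
  qed
  ultimately have "D \<in> derivations scale" by (simp add: derivations_def)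
  moreover have "res (D t) \<noteq> 0" using s(1) h(1) d(3) by (simp add: D_def e res_mult \<delta>_def)
  ultimately show ?thesis using t by blast
qed

end

section \<open>The divergence\<close>

interpretation fun_field: vector_space "\<lambda>(c::'f::field) (U :: 'f \<Rightarrow> 'f) y. c * U y"
  by standard (auto simp: fun_eq_iff algebra_simps)

lemma sum_apply: "sum f A x = (\<Sum>i\<in>A. f i x)"
  by (induction A rule: infinite_finite_induct) auto

text \<open>
  Restriction to the finite set \<open>S\<close> is injective on the span and maps it into a space spanned by
  finitely many functions.
\<close>

lemma finite_if_separated_by_finite_set:
  fixes B :: "('f::field \<Rightarrow> 'f) set"
  assumes S: "finite S" "\<And>U. U \<in> fun_field.span B \<Longrightarrow> (\<And>s. s \<in> S \<Longrightarrow> U s = 0) \<Longrightarrow> U = 0"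
    and B: "fun_field.independent B"
  shows "finite B"
proof -
  let ?sc = "\<lambda>(c::'f) (U :: 'f \<Rightarrow> 'f) y. c * U y"
  define r where "r U = (\<lambda>y. if y \<in> S then U y else 0)" for U :: "'f \<Rightarrow> 'f"
  interpret vector_space_pair ?sc ?sc ..
  interpret r: Vector_Spaces.linear ?sc ?sc r by standard (auto simp: r_def fun_eq_iff)
  have inj: "inj_on r (fun_field.span B)"
    unfolding r.inj_on_iff_eq_0[OF fun_field.subspace_span]
    using S(2) by (metis r_def zero_fun_apply)
  have "r U \<in> fun_field.span ((\<lambda>s y. if y = s then 1 else 0) ` S)" for U
  proof -
    have *: "r U = (\<Sum>s\<in>S. ?sc (U s) (\<lambda>y. if y = s then 1 else 0))"
      by (rule ext) (simp add: r_def sum_apply S(1) if_distrib cong: if_cong)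
    show ?thesis
      unfolding * by (rule fun_field.span_sum, rule fun_field.span_scale, rule fun_field.span_base, rule imageI)
  qed
  then have "finite (r ` B)"
    using fun_field.independent_span_bound[OF finite_imageI[OF S(1)] r.independent_injective_image[OF B inj]] by blast
  then show ?thesis using finite_imageD inj_on_subset[OF inj fun_field.span_superset] by blast
qed

lemma derivation_on_UNIV:
  assumes "derivation_on UNIV U"
  shows "U (a + b) = U a + U b" "U (a * b) = U a * b + a * U b" "U 0 = 0" "U (- a) = - U a" "U (a - b) = U a - U b"
    "U (sum f A) = (\<Sum>i\<in>A. U (f i))"
proof -
  show add: "U (a + b) = U a + U b" for a b using assms by (simp add: derivation_on_def)
  show "U (a * b) = U a * b + a * U b" using assms by (simp add: derivation_on_def)
  show X0: "U 0 = 0" using add[of 0 0] by (metis add.right_neutral add_left_cancel)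
  show uminus: "U (- a) = - U a" for a using add[of a "- a"] by (simp add: X0 eq_neg_iff_add_eq_0 add.commute)
  show "U (a - b) = U a - U b" using add[of a "- b"] by (simp add: uminus)
  show "U (sum f A) = (\<Sum>i\<in>A. U (f i))"
    by (induction A rule: infinite_finite_induct) (simp_all add: X0 add)
qed

text \<open>
  Choose a basis \<open>B\<close> of the \<open>F\<close>-span of \<open>V\<close> consisting of elements of \<open>V\<close>, and let \<open>M U\<close> be the matrix of
  \<open>b \<mapsto> [U, b]\<close> in this basis. The divergence of \<open>U\<close>, with respect to the volume form dual to \<open>B\<close>, is minus
  the trace of \<open>M U\<close>. The Jacobi identity gives \<open>M [U, Y] = U(M Y) - Y(M U)\<close> plus a commutator of
  matrices, which has trace \<open>0\<close>, so the trace is a cocycle. As \<open>[a U, b] = a [U, b] - b(a) U\<close>, the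
  divergence of \<open>a U\<close> picks up \<open>\<Sum>b. coord U b * b(a) = U a\<close>.
\<close>

theorem exists_divergence:
  fixes V :: "('f::field \<Rightarrow> 'f) set"
  assumes der: "\<And>U. U \<in> V \<Longrightarrow> derivation_on UNIV U"
    and comm: "\<And>U Y. U \<in> V \<Longrightarrow> Y \<in> V \<Longrightarrow> commutator U Y \<in> V"
    and S: "finite S" "\<And>U. U \<in> fun_field.span V \<Longrightarrow> (\<And>s. s \<in> S \<Longrightarrow> U s = 0) \<Longrightarrow> U = 0"
  obtains \<delta> :: "('f \<Rightarrow> 'f) \<Rightarrow> 'f"
  where "\<And>U Y. U \<in> V \<Longrightarrow> Y \<in> V \<Longrightarrow> \<delta> (\<lambda>y. U y + Y y) = \<delta> U + \<delta> Y"
    and "\<And>a U. U \<in> V \<Longrightarrow> \<delta> (\<lambda>y. a * U y) = a * \<delta> U + U a"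
    and "\<And>U Y. U \<in> V \<Longrightarrow> Y \<in> V \<Longrightarrow> \<delta> (commutator U Y) = U (\<delta> Y) - Y (\<delta> U)"
proof -
  let ?sc = "\<lambda>(c::'f) (U :: 'f \<Rightarrow> 'f) y. c * U y"
  obtain B where B: "B \<subseteq> V" "fun_field.independent B" "V \<subseteq> fun_field.span B"
    by (rule fun_field.maximal_independent_subset)
  have "finite B"
    using S(2) fun_field.span_mono[OF B(1)] by (intro finite_if_separated_by_finite_set[OF S(1) _ B(2)]) blast
  define coord where "coord U b = fun_field.representation B U b" for U b
  have coord_add: "coord (\<lambda>y. U y + Y y) b = coord U b + coord Y b"
    and coord_diff: "coord (\<lambda>y. U y - Y y) b = coord U b - coord Y b"
    and coord_scale: "coord (\<lambda>y. a * U y) b = a * coord U b"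
    if "U \<in> fun_field.span B" "Y \<in> fun_field.span B" for U Y a b
    using fun_field.representation_add[OF B(2) that(2,1)] fun_field.representation_diff[OF B(2) that(2,1)]
      fun_field.representation_scale[OF B(2) that(1), of a]
    by (simp_all add: coord_def plus_fun_def fun_diff_def)
  have coord_sum: "coord (\<lambda>y. \<Sum>i\<in>A. Z i y) b = (\<Sum>i\<in>A. coord (Z i) b)"
    if "\<And>i. i \<in> A \<Longrightarrow> Z i \<in> fun_field.span B" for A and Z :: "('f \<Rightarrow> 'f) \<Rightarrow> 'f \<Rightarrow> 'f" and b
  proof -
    have "(\<lambda>y. \<Sum>i\<in>A. Z i y) = sum Z A" by (rule ext) (simp add: sum_apply)
    then show ?thesis using fun_field.representation_sum[OF B(2), of A Z] that by (simp add: coord_def)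
  qed
  have coord_basis: "coord b c = (if c = b then 1 else 0)" if "b \<in> B" for b c
    using fun_field.representation_basis[OF B(2) that] by (simp add: coord_def)
  have expand: "U y = (\<Sum>b\<in>B. coord U b * b y)" if "U \<in> fun_field.span B" for U y
    using fun_cong[OF fun_field.sum_representation_eq[OF B(2) that \<open>finite B\<close> order_refl], of y]
    by (simp add: coord_def sum_apply)
  have span: "commutator U b \<in> fun_field.span B" if "U \<in> V" "b \<in> B" for U b using comm that B by blast
  have base: "U \<in> fun_field.span B" if "U \<in> V" for U using that B(3) by blast
  have span_scale: "(\<lambda>y. a * U y) \<in> fun_field.span B" if "U \<in> fun_field.span B" for a U
    using fun_field.span_scale[OF that] .
  define M where "M U b c = coord (commutator U b) c" for U b c
  define \<delta> where "\<delta> U = - (\<Sum>b\<in>B. M U b b)" for U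
  show ?thesis
  proof (rule that)
    fix U Y assume XY: "U \<in> V" "Y \<in> V"
    have "M (\<lambda>y. U y + Y y) b b = M U b b + M Y b b" if "b \<in> B" for b
    proof -
      have "commutator (\<lambda>y. U y + Y y) b = (\<lambda>y. commutator U b y + commutator Y b y)"
        using derivation_on_UNIV(1)[OF der[of b]] that B(1) by (auto simp: commutator_def fun_eq_iff)
      then show ?thesis using coord_add[OF span[OF XY(1) that] span[OF XY(2) that]] by (simp add: M_def)
    qed
    then show "\<delta> (\<lambda>y. U y + Y y) = \<delta> U + \<delta> Y" by (simp add: \<delta>_def sum.distrib)
  next
    fix a U assume U: "U \<in> V"
    have "M (\<lambda>y. a * U y) b b = a * M U b b - coord U b * b a" if "b \<in> B" for b
    proof -
      have "commutator (\<lambda>y. a * U y) b = (\<lambda>y. a * commutator U b y - b a * U y)"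
        using derivation_on_UNIV(2)[OF der[of b]] that B(1)
        by (auto simp: commutator_def fun_eq_iff algebra_simps)
      then show ?thesis
        using coord_diff[OF span_scale[OF span[OF U that]] span_scale[OF base[OF U]], of a "b a" b]
          coord_scale[OF span[OF U that] span[OF U that], of a b] coord_scale[OF base[OF U] base[OF U], of "b a" b]
        by (simp add: M_def)
    qed
    then show "\<delta> (\<lambda>y. a * U y) = a * \<delta> U + U a"
      by (simp add: \<delta>_def sum_subtractf sum_distrib_left expand[OF base[OF U], of a])
  next
    fix U Y assume XY: "U \<in> V" "Y \<in> V"
    note U = derivation_on_UNIV[OF der[OF XY(1)]] and Y = derivation_on_UNIV[OF der[OF XY(2)]]
    \<comment> \<open>Expand \<open>[W, b]\<close> in the basis and apply the Leibniz rule to each coefficient times basis vector.\<close>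
    have second: "coord (commutator Z (commutator W b)) b = Z (M W b b) + (\<Sum>c\<in>B. M W b c * M Z c b)"
      if ZW: "Z \<in> V" "W \<in> V" and b: "b \<in> B" for Z W b
    proof -
      note Z = derivation_on_UNIV[OF der[OF ZW(1)]]
      note W = span[OF ZW(2) b]
      have "commutator Z (commutator W b) y = (\<Sum>c\<in>B. Z (M W b c) * c y + M W b c * commutator Z c y)" for y
      proof -
        have "Z (commutator W b y) = (\<Sum>c\<in>B. Z (M W b c) * c y + M W b c * Z (c y))"
          by (subst expand[OF W, of y]) (simp add: Z(2,6) M_def)
        moreover have "commutator W b (Z y) = (\<Sum>c\<in>B. M W b c * c (Z y))"
          by (subst expand[OF W, of "Z y"]) (simp add: M_def)
        ultimately show ?thesis
          by (simp add: commutator_def[of Z] sum_subtractf[symmetric] algebra_simps)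
      qed
      then have "commutator Z (commutator W b) = (\<lambda>y. \<Sum>c\<in>B. Z (M W b c) * c y + M W b c * commutator Z c y)" by (rule ext)
      then have "coord (commutator Z (commutator W b)) b =
          coord (\<lambda>y. \<Sum>c\<in>B. Z (M W b c) * c y + M W b c * commutator Z c y) b" by simp
      also have "\<dots> = (\<Sum>c\<in>B. coord (\<lambda>y. Z (M W b c) * c y + M W b c * commutator Z c y) b)"
      proof (rule coord_sum)
        fix c assume c: "c \<in> B"
        show "(\<lambda>y. Z (M W b c) * c y + M W b c * commutator Z c y) \<in> fun_field.span B"
          using fun_field.span_add[OF span_scale[OF fun_field.span_base[OF c]] span_scale[OF span[OF ZW(1) c]]]
          by (simp add: plus_fun_def)
      qed
      also have "\<dots> = (\<Sum>c\<in>B. Z (M W b c) * (if b = c then 1 else 0) + M W b c * M Z c b)"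
      proof (rule sum.cong[OF refl])
        fix c assume c: "c \<in> B"
        note sc = fun_field.span_base[OF c] span[OF ZW(1) c]
        show "coord (\<lambda>y. Z (M W b c) * c y + M W b c * commutator Z c y) b =
          Z (M W b c) * (if b = c then 1 else 0) + M W b c * M Z c b"
          using coord_add[OF span_scale[OF sc(1)] span_scale[OF sc(2)], of "Z (M W b c)" "M W b c" b]
            coord_scale[OF sc(1) sc(1), of "Z (M W b c)" b] coord_scale[OF sc(2) sc(2), of "M W b c" b]
          by (simp add: coord_basis[OF c] M_def)
      qed
      also have "\<dots> = Z (M W b b) + (\<Sum>c\<in>B. M W b c * M Z c b)"
        using b \<open>finite B\<close> by (simp add: sum.distrib if_distrib[of "(*) _"] cong: if_cong)
      finally show ?thesis .
    qed
    have "M (commutator U Y) b b = U (M Y b b) - Y (M U b b) +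
        ((\<Sum>c\<in>B. M Y b c * M U c b) - (\<Sum>c\<in>B. M U b c * M Y c b))" if b: "b \<in> B" for b
    proof -
      have bV: "b \<in> V" using b B(1) by blast
      have "commutator (commutator U Y) b = (\<lambda>y. commutator U (commutator Y b) y - commutator Y (commutator U b) y)"
        using derivation_on_UNIV(5)[OF der[OF bV]] by (auto simp: commutator_def fun_eq_iff U(5) Y(5))
      then show ?thesis
        using coord_diff[OF base[OF comm[OF XY(1) comm[OF XY(2) bV]]] base[OF comm[OF XY(2) comm[OF XY(1) bV]]], of b]
          second[OF XY(1,2) b] second[OF XY(2,1) b]
        by (simp add: M_def[of "commutator U Y"])
    qed
    then have "\<delta> (commutator U Y) = - (\<Sum>b\<in>B. U (M Y b b)) + (\<Sum>b\<in>B. Y (M U b b)) -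
      ((\<Sum>b\<in>B. \<Sum>c\<in>B. M Y b c * M U c b) - (\<Sum>b\<in>B. \<Sum>c\<in>B. M U b c * M Y c b))"
      by (simp add: \<delta>_def sum.distrib sum_subtractf)
    \<comment> \<open>The trace of a commutator of matrices vanishes.\<close>
    also have "(\<Sum>b\<in>B. \<Sum>c\<in>B. M Y b c * M U c b) = (\<Sum>b\<in>B. \<Sum>c\<in>B. M U b c * M Y c b)"
      by (subst sum.swap) (simp add: mult.commute)
    finally show "\<delta> (commutator U Y) = U (\<delta> Y) - Y (\<delta> U)"
      by (simp add: \<delta>_def U(4,6) Y(4,6))
  qed
qed

section \<open>Extending vector fields to the function field\<close>

context curve_component
begin

definition lift :: "('a \<Rightarrow> 'a) \<Rightarrow> 'f \<Rightarrow> 'f" where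
  "lift D y = (let (a, b) = (SOME (a, b). res b \<noteq> 0 \<and> y = res a / res b)
     in (res (D a) * res b - res a * res (D b)) / (res b)\<^sup>2)"

lemma derivationsD:
  assumes "D \<in> derivations scale"
  shows "D (a + b) = D a + D b" "D (scale c a) = scale c (D a)" "D (a * b) = D a * b + a * D b"
    "D (a - b) = D a - D b" "D 0 = 0" "D 1 = 0"
proof -
  interpret D: Vector_Spaces.linear scale scale D using assms by (simp add: derivations_def)
  show "D (a + b) = D a + D b" "D (scale c a) = scale c (D a)" "D (a - b) = D a - D b" "D 0 = 0"
    by (fact D.add D.scale D.diff D.zero)+
  show mult: "D (a * b) = D a * b + a * D b" for a b using assms by (simp add: derivations_def)
  show "D 1 = 0" using mult[of 1 1] by (metis add.right_neutral add_left_cancel mult.left_neutral mult.right_neutral)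
qed

text \<open>
  Vector fields are tangent to the component: if \<open>s\<close> annihilates \<open>a\<close> and does not vanish on the
  component, then applying \<open>D\<close> to \<open>s a = 0\<close> gives \<open>s D a = 0\<close> there.
\<close>

lemma derivation_kernel:
  assumes D: "D \<in> derivations scale" and a: "res a = 0" shows "res (D a) = 0"
proof -
  obtain s where s: "res s \<noteq> 0" "s * a = 0" using kernel_annihilated a by blast
  have "res (D (s * a)) = res s * res (D a)" by (simp add: derivationsD(3)[OF D] res_add res_mult a)
  with s show ?thesis by (simp add: derivationsD(5)[OF D] res_0)
qed

text \<open>
  The quotient rule does not depend on the fraction chosen for \<open>y\<close>: if \<open>a/b = c/d\<close>, then \<open>a d - c b\<close>
  restricts to \<open>0\<close>, and hence so does its image under \<open>D\<close>.
\<close>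

lemma lift_fraction:
  assumes D: "D \<in> derivations scale" and b: "res b \<noteq> 0"
  shows "lift D (res a / res b) = (res (D a) * res b - res a * res (D b)) / (res b)\<^sup>2"
proof -
  define p where "p = (SOME (a', b'). res b' \<noteq> 0 \<and> res a / res b = res a' / res b')"
  obtain c d where p: "p = (c, d)" by (cases p)
  have "case p of (a', b') \<Rightarrow> res b' \<noteq> 0 \<and> res a / res b = res a' / res b'"
    unfolding p_def by (rule someI[of _ "(a, b)"]) (use b in simp)
  then have cd: "res d \<noteq> 0" "res a * res d = res c * res b" using b by (auto simp: p field_simps)
  have "res (D (a * d - c * b)) = 0"
    by (rule derivation_kernel[OF D]) (simp add: res_diff res_mult cd)
  then have *: "res (D a) * res d + res a * res (D d) = res (D c) * res b + res c * res (D b)"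
    by (simp add: derivationsD[OF D] res_diff res_add res_mult)
  have "(res (D a) * res b - res a * res (D b)) * (res d)\<^sup>2 = (res (D c) * res d - res c * res (D d)) * (res b)\<^sup>2"
  proof -
    have "(res (D a) * res b - res a * res (D b)) * (res d)\<^sup>2 =
        res (D a) * res b * (res d)\<^sup>2 - (res a * res d) * res (D b) * res d"
      by (simp add: power2_eq_square algebra_simps)
    also have "\<dots> = res b * res d * (res (D a) * res d - res c * res (D b))"
      unfolding cd(2) by (simp add: power2_eq_square algebra_simps)
    also have "res (D a) * res d - res c * res (D b) = res (D c) * res b - res a * res (D d)"
      using * by (simp add: algebra_simps)
    also have "res b * res d * \<dots> = res b * res b * res d * res (D c) - res b * (res a * res d) * res (D d)"
      by (simp add: algebra_simps)
    also have "\<dots> = (res (D c) * res d - res c * res (D d)) * (res b)\<^sup>2"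
      unfolding cd(2) by (simp add: power2_eq_square algebra_simps)
    finally show ?thesis .
  qed
  then have "(res (D c) * res d - res c * res (D d)) / (res d)\<^sup>2 = (res (D a) * res b - res a * res (D b)) / (res b)\<^sup>2"
    using b cd(1) by (simp add: frac_eq_eq)
  then show ?thesis by (simp add: lift_def p_def[symmetric] p)
qed

lemma lift_res: "D \<in> derivations scale \<Longrightarrow> lift D (res a) = res (D a)"
  using lift_fraction[of D 1 a] by (simp add: res_1 derivationsD(6) res_0)

lemma derivation_on_lift:
  assumes D: "D \<in> derivations scale" shows "derivation_on UNIV (lift D)"
  unfolding derivation_on_def
proof (intro ballI conjI)
  fix y z :: 'f
  obtain a b c d where *: "res b \<noteq> 0" "y = res a / res b" "res d \<noteq> 0" "z = res c / res d" using fraction by meson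
  then have sum: "y + z = res (a * d + c * b) / res (b * d)" and mult: "y * z = res (a * c) / res (b * d)"
    and bd: "res (b * d) \<noteq> 0"
    by (simp_all add: res_add res_mult add_frac_eq)
  show "lift D (y + z) = lift D y + lift D z"
    unfolding sum lift_fraction[OF D bd] unfolding *(2,4) lift_fraction[OF D *(1)] lift_fraction[OF D *(3)]
    using *(1,3) by (simp add: derivationsD[OF D] res_add res_mult field_simps power2_eq_square)
  show "lift D (y * z) = lift D y * z + y * lift D z"
    unfolding mult lift_fraction[OF D bd] unfolding *(2,4) lift_fraction[OF D *(1)] lift_fraction[OF D *(3)]
    using *(1,3) by (simp add: derivationsD[OF D] res_add res_mult field_simps power2_eq_square)
qed

lemma derivation_eq_0I:
  assumes U: "derivation_on UNIV U" and zero: "\<And>a. U (res a) = 0"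
  shows "U y = 0"
proof -
  obtain a b where ab: "res b \<noteq> 0" "y = res a / res b" using fraction by blast
  then have "U (res a) = U y * res b + y * U (res b)"
    using derivation_on_UNIV(2)[OF U, of y "res b"] by simp
  with ab(1) show ?thesis by (simp add: zero)
qed

lemma derivation_eqI:
  assumes U: "derivation_on UNIV U" "derivation_on UNIV Y" and eq: "\<And>a. U (res a) = Y (res a)"
  shows "U = Y"
proof
  fix y
  have "derivation_on UNIV (\<lambda>y. U y - Y y)"
    using U by (auto simp: derivation_on_def algebra_simps)
  from derivation_eq_0I[OF this, of y] eq show "U y = Y y" by simp
qed

lemma lift_add:
  assumes "D \<in> derivations scale" "E \<in> derivations scale" "(\<lambda>a. D a + E a) \<in> derivations scale"
  shows "lift (\<lambda>a. D a + E a) = (\<lambda>y. lift D y + lift E y)"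
  by (rule derivation_eqI)
    (use assms derivation_on_lift in \<open>auto simp: lift_res res_add derivation_on_def algebra_simps\<close>)

lemma lift_scale:
  assumes "D \<in> derivations scale" "(\<lambda>a. scale c (D a)) \<in> derivations scale"
  shows "lift (\<lambda>a. scale c (D a)) = (\<lambda>y. emb c * lift D y)"
  by (rule derivation_eqI)
    (use assms derivation_on_lift in \<open>auto simp: lift_res res_scale derivation_on_def algebra_simps\<close>)

lemma lift_mult:
  assumes "D \<in> derivations scale" "(\<lambda>a. f * D a) \<in> derivations scale"
  shows "lift (\<lambda>a. f * D a) = (\<lambda>y. res f * lift D y)"
  by (rule derivation_eqI)
    (use assms derivation_on_lift in \<open>auto simp: lift_res res_mult derivation_on_def algebra_simps\<close>)

lemma derivation_commutator:
  assumes "derivation_on UNIV U" "derivation_on UNIV Y"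
  shows "derivation_on UNIV (commutator U Y)"
  using assms by (simp add: derivation_on_def commutator_def algebra_simps)

lemma lift_commutator:
  assumes "D \<in> derivations scale" "E \<in> derivations scale" "commutator D E \<in> derivations scale"
  shows "lift (commutator D E) = commutator (lift D) (lift E)"
proof (rule derivation_eqI)
  show "lift (commutator D E) (res a) = commutator (lift D) (lift E) (res a)" for a
    using assms by (simp add: lift_res commutator_def[of "lift D"]) (simp add: commutator_def res_diff)
qed (use assms in \<open>auto intro: derivation_on_lift derivation_commutator\<close>)

lemma derivationsI:
  assumes "\<And>a b. D (a + b) = D a + D b" "\<And>c a. D (scale c a) = scale c (D a)" "\<And>a b. D (a * b) = D a * b + a * D b"
  shows "D \<in> derivations scale"
proof -
  have "Vector_Spaces.linear scale scale D" by standard (fact assms)+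
  with assms(3) show ?thesis by (simp add: derivations_def)
qed

lemma scale_mult_right: "scale c (a * b) = a * scale c b"
  using scale_mult_left[of c b a] by (simp add: mult.commute)

lemma derivations_closed:
  assumes "D \<in> derivations scale" "E \<in> derivations scale"
  shows "(\<lambda>a. D a + E a) \<in> derivations scale" "(\<lambda>a. scale c (D a)) \<in> derivations scale"
    "(\<lambda>a. f * D a) \<in> derivations scale" "commutator D E \<in> derivations scale"
proof -
  note D = derivationsD[OF assms(1)] and E = derivationsD[OF assms(2)]
  show "(\<lambda>a. D a + E a) \<in> derivations scale"
    by (rule derivationsI) (simp_all add: D(1-3) E(1-3) scale_right_distrib algebra_simps)
  show "(\<lambda>a. scale c (D a)) \<in> derivations scale"
  proof (rule derivationsI)
    show "scale c (D (a * b)) = scale c (D a) * b + a * scale c (D b)" for a b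
      unfolding D(3) scale_right_distrib scale_mult_left[of c "D a"] scale_mult_right[of c a] ..
  qed (simp_all add: D(1,2) scale_right_distrib scale_left_commute)
  show "(\<lambda>a. f * D a) \<in> derivations scale"
  proof (rule derivationsI)
    show "f * D (scale c a) = scale c (f * D a)" for c a
      unfolding D(2) scale_mult_right ..
  qed (simp_all add: D(1,3) algebra_simps)
  show "commutator D E \<in> derivations scale"
    by (rule derivationsI)
      (simp_all add: commutator_def D(1-4) E(1-4) scale_right_diff_distrib algebra_simps)
qed

sublocale emb: vector_space "\<lambda>c (y::'f). emb c * y"
  by standard (auto simp: emb_add emb_mult emb_1 algebra_simps)

text \<open>
  A linear relation would be an algebraic equation for \<open>t\<close>.
\<close>

lemma powers_independent:
  assumes t: "\<forall>q\<in>polys (range emb). poly q (res t) = 0 \<longrightarrow> q = 0" and w: "w \<noteq> 0"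
  shows "w * res t ^ n \<notin> emb.span ((\<lambda>i. w * res t ^ i) ` {..<n})"
proof
  define Q where "Q = {q \<in> polys (range emb). \<forall>i\<ge>n. coeff q i = 0}"
  assume "w * res t ^ n \<in> emb.span ((\<lambda>i. w * res t ^ i) ` {..<n})"
  then have "\<exists>q\<in>Q. w * res t ^ n = w * poly q (res t)"
  proof (induction rule: emb.span_induct_alt)
    case base
    then show ?case using is_subring_0[OF is_subring_emb] by (intro bexI[of _ 0]) (auto simp: Q_def polys_def)
  next
    case (step c x y)
    then obtain i q where q: "i < n" "x = w * res t ^ i" "q \<in> Q" "y = w * poly q (res t)" by auto
    have "monom (emb c) i + q \<in> Q"
      using q(1,3) polys_add[OF is_subring_emb] polys_monom[OF is_subring_emb rangeI, of c i] by (auto simp: Q_def)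
    moreover have "emb c * x + y = w * poly (monom (emb c) i + q) (res t)"
      by (simp add: q poly_monom algebra_simps)
    ultimately show ?case by blast
  qed
  then obtain q where q: "q \<in> Q" "res t ^ n = poly q (res t)" using w by auto
  let ?p = "monom 1 n - q"
  have "?p \<in> polys (range emb)"
    using q(1) by (intro polys_diff polys_monom is_subring_emb is_subring_1) (auto simp: Q_def)
  from bspec[OF t this] q(2) have "?p = 0" by (simp add: poly_monom)
  moreover have "coeff ?p n = 1" using q(1) by (simp add: Q_def)
  ultimately show False by simp
qed

end

section \<open>Vector fields and differential operators\<close>

context curve_component
begin

lemma derivations_commutator_closed: "U \<in> lift ` derivations scale \<Longrightarrow> V \<in> lift ` derivations scale \<Longrightarrow>
    commutator U V \<in> lift ` derivations scale"
  using lift_commutator derivations_closed(4) by force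

lemma lift_emb: "D \<in> derivations scale \<Longrightarrow> lift D (emb c) = 0"
  by (simp add: emb_def lift_res derivationsD(2,6) res_0)

text \<open>
  A derivation over \<open>k\<close> is determined by its values on generators. This makes the \<open>F\<close>-span of the vector
  fields finite-dimensional, so that their divergence exists.
\<close>

lemma lift_separated:
  assumes "U \<in> fun_field.span (lift ` derivations scale)" "\<And>s. s \<in> res ` generators \<Longrightarrow> U s = 0"
  shows "U = 0"
proof -
  let ?W = "{U. derivation_on UNIV U \<and> (\<forall>c. U (emb c) = 0)}"
  have "fun_field.subspace ?W"
    unfolding fun_field.subspace_def by (auto simp: derivation_on_def algebra_simps)
  moreover have "lift ` derivations scale \<subseteq> ?W" using derivation_on_lift lift_emb by auto
  ultimately have U: "derivation_on UNIV U" "\<And>c. U (emb c) = 0"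
    using assms(1) fun_field.span_minimal by blast+
  note D = derivation_on_UNIV[OF U(1)]
  have "U (res a) = 0" for a
    by (induction a rule: generators_induct)
      (use assms(2) U(2)[of 1] in \<open>auto simp: res_add res_mult res_scale D(1,2) U(2) emb_1 res_1\<close>)
  with derivation_eq_0I[OF U(1)] show ?thesis by (simp add: fun_eq_iff)
qed

text \<open>
  The cocycle is the divergence of the extension to the function field. The letter \<open>\<sigma> a\<close> is a
  preimage of the vector field \<open>a D\<close>, and \<open>u n\<close> is the element attached to \<open>(t \<otimes> 1 - 1 \<otimes> t)\<^sup>2\<close> and \<open>p = t\<^sup>n\<close>
  in the introduction.
\<close>

theorem not_noetherian_if_onto_derivations:
  fixes L :: "('k, 'l) module" (structure) and \<pi> :: "'l \<Rightarrow> 'a \<Rightarrow> 'a"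
  assumes closed: "\<And>x y. x \<in> carrier L \<Longrightarrow> y \<in> carrier L \<Longrightarrow> x \<oplus> y \<in> carrier L"
      "\<And>c x. x \<in> carrier L \<Longrightarrow> c \<odot> x \<in> carrier L"
      "\<And>x y. x \<in> carrier L \<Longrightarrow> y \<in> carrier L \<Longrightarrow> x \<otimes> y \<in> carrier L"
    and hom: "\<And>x y. x \<in> carrier L \<Longrightarrow> y \<in> carrier L \<Longrightarrow> \<pi> (x \<oplus> y) = (\<lambda>a. \<pi> x a + \<pi> y a)"
      "\<And>c x. x \<in> carrier L \<Longrightarrow> \<pi> (c \<odot> x) = (\<lambda>a. scale c (\<pi> x a))"
      "\<And>x y. x \<in> carrier L \<Longrightarrow> y \<in> carrier L \<Longrightarrow> \<pi> (x \<otimes> y) = commutator (\<pi> x) (\<pi> y)"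
    and onto: "\<pi> ` carrier L = derivations scale"
  shows "\<not> noetherian (universal_enveloping_algebra L)"
proof -
  obtain D t where D: "D \<in> derivations scale" "res (D t) \<noteq> 0"
    and t: "\<forall>q\<in>polys (range emb). poly q (res t) = 0 \<longrightarrow> q = 0"
    using exists_derivation by blast
  obtain \<delta> :: "('f \<Rightarrow> 'f) \<Rightarrow> 'f" where
    \<delta>_add: "\<And>U V. U \<in> lift ` derivations scale \<Longrightarrow> V \<in> lift ` derivations scale \<Longrightarrow>
      \<delta> (\<lambda>y. U y + V y) = \<delta> U + \<delta> V" and
    \<delta>_mult: "\<And>a U. U \<in> lift ` derivations scale \<Longrightarrow> \<delta> (\<lambda>y. a * U y) = a * \<delta> U + U a" and
    \<delta>_comm: "\<And>U V. U \<in> lift ` derivations scale \<Longrightarrow> V \<in> lift ` derivations scale \<Longrightarrow>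
      \<delta> (commutator U V) = U (\<delta> V) - V (\<delta> U)"
  proof (rule exists_divergence[of "lift ` derivations scale" "res ` generators"])
    show "derivation_on UNIV U" if "U \<in> lift ` derivations scale" for U
      using that derivation_on_lift by auto
  qed (auto intro: derivations_commutator_closed finite_imageI finite_generators lift_separated)
  have \<pi>: "\<pi> x \<in> derivations scale" if "x \<in> carrier L" for x using onto that by blast
  have \<pi>': "lift (\<pi> x) \<in> lift ` derivations scale" if "x \<in> carrier L" for x using \<pi>[OF that] by blast
  interpret N: lie_cocycle "\<lambda>c (y::'f). emb c * y" L UNIV "\<lambda>x. lift (\<pi> x)" "\<lambda>x. \<delta> (lift (\<pi> x))"
  proof
    fix x y c and m :: 'f assume x: "x \<in> carrier L"
    note D = derivation_on_UNIV[OF derivation_on_lift[OF \<pi>[OF x]]]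
    show "lift (\<pi> x) (a + b) = lift (\<pi> x) a + lift (\<pi> x) b" for a b by (rule D(1))
    show "lift (\<pi> x) (emb a * b) = emb a * lift (\<pi> x) b" for a b
      by (simp add: D(2) lift_emb[OF \<pi>[OF x]])
    have scale: "lift (\<pi> (c \<odot> x)) = (\<lambda>y. emb c * lift (\<pi> x) y)"
      using lift_scale[OF \<pi>[OF x]] \<pi>[OF closed(2)[OF x]] hom(2)[OF x] by simp
    then show "lift (\<pi> (c \<odot> x)) m = emb c * lift (\<pi> x) m" by simp
    show "\<delta> (lift (\<pi> (c \<odot> x))) = emb c * \<delta> (lift (\<pi> x))"
      unfolding scale \<delta>_mult[OF \<pi>'[OF x]] by (simp add: lift_emb[OF \<pi>[OF x]])
    assume y: "y \<in> carrier L"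
    have add: "lift (\<pi> (x \<oplus> y)) = (\<lambda>z. lift (\<pi> x) z + lift (\<pi> y) z)"
      using lift_add[OF \<pi>[OF x] \<pi>[OF y]] \<pi>[OF closed(1)[OF x y]] hom(1)[OF x y] by simp
    then show "lift (\<pi> (x \<oplus> y)) m = lift (\<pi> x) m + lift (\<pi> y) m" by simp
    show "\<delta> (lift (\<pi> (x \<oplus> y))) = \<delta> (lift (\<pi> x)) + \<delta> (lift (\<pi> y))"
      unfolding add by (rule \<delta>_add[OF \<pi>'[OF x] \<pi>'[OF y]])
    have comm: "lift (\<pi> (x \<otimes> y)) = commutator (lift (\<pi> x)) (lift (\<pi> y))"
      using lift_commutator[OF \<pi>[OF x] \<pi>[OF y]] \<pi>[OF closed(3)[OF x y]] hom(3)[OF x y] by simp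
    then show "lift (\<pi> (x \<otimes> y)) m = lift (\<pi> x) (lift (\<pi> y) m) - lift (\<pi> y) (lift (\<pi> x) m)"
      by (simp add: commutator_def)
    show "\<delta> (lift (\<pi> (x \<otimes> y))) = lift (\<pi> x) (\<delta> (lift (\<pi> y))) - lift (\<pi> y) (\<delta> (lift (\<pi> x)))"
      unfolding comm by (rule \<delta>_comm[OF \<pi>'[OF x] \<pi>'[OF y]])
  qed (use closed in \<open>auto simp: emb.subspace_UNIV\<close>)
  define \<sigma> where "\<sigma> a = (SOME x. x \<in> carrier L \<and> \<pi> x = (\<lambda>b. a * D b))" for a
  have \<sigma>: "\<sigma> a \<in> carrier L" "\<pi> (\<sigma> a) = (\<lambda>b. a * D b)" for a
  proof -
    have "(\<lambda>b. a * D b) \<in> \<pi> ` carrier L" using derivations_closed(3)[OF D(1) D(1)] by (simp add: onto)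
    then have "\<exists>x. x \<in> carrier L \<and> \<pi> x = (\<lambda>b. a * D b)" by auto
    from someI_ex[OF this] show "\<sigma> a \<in> carrier L" "\<pi> (\<sigma> a) = (\<lambda>b. a * D b)" by (simp_all add: \<sigma>_def)
  qed
  define U where "U = lift D"
  note U = derivation_on_UNIV[OF derivation_on_lift[OF D(1)], folded U_def]
  have lift_\<sigma>: "lift (\<pi> (\<sigma> a)) = (\<lambda>y. res a * U y)" for a
    using lift_mult[OF D(1), of a] derivations_closed(3)[OF D(1) D(1), of a] by (simp add: \<sigma>(2) U_def)
  have \<delta>_\<sigma>: "\<delta> (lift (\<pi> (\<sigma> a))) = res a * \<delta> U + U (res a)" for a
    unfolding lift_\<sigma> by (rule \<delta>_mult) (use D(1) in \<open>simp add: U_def\<close>)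
  have U1: "U 1 = 0" using lift_emb[OF D(1), of 1] by (simp add: U_def emb_1)
  have U2: "U 2 = 0" using U(1)[of 1 1] U1 by simp
  have U_t: "U (res t) = res (D t)" by (simp add: U_def lift_res D(1))
  have emb2: "emb 2 = 2" using emb_of_nat[of 2] by simp
  define u where "u n = Poly_Mapping.single [\<sigma> (t ^ n * t\<^sup>2), \<sigma> 1] (1::'k) -
    Poly_Mapping.single [\<sigma> (t ^ n * t), \<sigma> t] 2 + Poly_Mapping.single [\<sigma> (t ^ n), \<sigma> (t\<^sup>2)] 1" for n
  have act: "N.act (u n) (c, m) = (0, emb c * (2 * (res (D t))\<^sup>2 * res t ^ n))" for n c m
    unfolding u_def N.pair.alg_act_add N.pair.alg_act_diff N.act_word2[OF \<sigma>(1)] \<delta>_\<sigma>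
    unfolding lift_\<sigma> 
    by (simp add: emb_1 emb2 res_mult res_power res_1 U U1 U2 U_t power2_eq_square algebra_simps)
  show ?thesis
  proof (rule N.not_noetherian[where u = u])
    fix n
    show "Poly_Mapping.keys (u n) \<subseteq> lists (carrier L)"
    proof -
      have "Poly_Mapping.keys (u n) \<subseteq> {[\<sigma> (t ^ n * t\<^sup>2), \<sigma> 1], [\<sigma> (t ^ n * t), \<sigma> t], [\<sigma> (t ^ n), \<sigma> (t\<^sup>2)]}"
        by (auto simp: u_def in_keys_iff lookup_add lookup_minus lookup_single when_def split: if_splits)
      also have "\<dots> \<subseteq> lists (carrier L)" using \<sigma>(1) by auto
      finally show ?thesis .
    qed
    show "N.act (u n) (0, m) = 0" for m by (simp add: act emb_0 zero_prod_def)
    show "N.act (u n) (1, 0) = (0, 2 * (res (D t))\<^sup>2 * res t ^ n)" by (simp add: act emb_1)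
    have "(2 :: 'f) \<noteq> 0" using of_nat_neq_0[of 2] by simp
    then show "2 * (res (D t))\<^sup>2 * res t ^ n \<notin> emb.span ((\<lambda>n. 2 * (res (D t))\<^sup>2 * res t ^ n) ` {..<n})"
      using D(2) by (intro powers_independent[OF t]) simp
  qed
qed

corollary krichever_novikov_not_noetherian: 
  "\<not> noetherian (universal_enveloping_algebra (krichever_novikov scale))"
  by (rule not_noetherian_if_onto_derivations[where \<pi> = "\<lambda>D. D"])
    (auto simp: krichever_novikov_def derivations_closed)

corollary diff_operators_le_1_not_noetherian:
  "\<not> noetherian (universal_enveloping_algebra (diff_operators_le_1 scale))"
  by (rule not_noetherian_if_onto_derivations[where \<pi> = snd])
    (auto simp: diff_operators_le_1_def derivations_closed)

end

section \<open>Tensor products and current algebras\<close>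

lemma bilinear_ext_eq_linear_ext:
  "bilinear_ext m p q = linear_ext pm_scale (\<lambda>x. linear_ext pm_scale (\<lambda>y. Poly_Mapping.single (m x y) 1) q) p"
  by (simp add: bilinear_ext_def linear_ext_def pm_scale_single pm.scale_sum_right)

lemma bilinear_ext_eq_linear_ext':
  "bilinear_ext m p q = linear_ext pm_scale (\<lambda>y. linear_ext pm_scale (\<lambda>x. Poly_Mapping.single (m x y) 1) p) q"
  by (simp add: bilinear_ext_def linear_ext_def pm_scale_single pm.scale_sum_right mult.commute sum.swap[of _ "Poly_Mapping.keys p"])

locale current = lie_algebra \<gg> + vector_space scale
  for \<gg> :: "('k::field, 'g) module" (structure) and scale :: "'k \<Rightarrow> 'a::comm_ring_1 \<Rightarrow> 'a" +
  assumes scale_mult_left: "scale c (a * b) = scale c a * b"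
begin

abbreviation "Rel \<equiv> tensor_relations \<gg> scale"
abbreviation "N \<equiv> pm.span Rel"
abbreviation "T \<equiv> tensor_free \<gg> :: ('g \<times> 'a \<Rightarrow>\<^sub>0 'k) set"
abbreviation "teq \<equiv> tensor_equiv \<gg> scale"
abbreviation cls ("\<lbrakk>_\<rbrakk>") where "\<lbrakk>p\<rbrakk> \<equiv> teq `` {p}"
abbreviation tb where "tb \<equiv> bilinear_ext (\<lambda>(x, f) (y, g). (x \<otimes> y, f * g :: 'a)) :: ('g \<times> 'a \<Rightarrow>\<^sub>0 'k) \<Rightarrow> _"

lemma subspace_T: "pm.subspace T"
  unfolding pm.subspace_def tensor_free_def
  using keys_add keys_pm_scale by (fastforce simp: subset_iff)

lemma single_T: "x \<in> carrier \<gg> \<Longrightarrow> Poly_Mapping.single (x, f) c \<in> T"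
  by (auto simp: tensor_free_def)

lemma equiv_eq: "equiv T teq"
proof (rule equivI)
  show "teq \<subseteq> T \<times> T" by (auto simp: tensor_equiv_def)
  show "refl_on T teq" by (auto simp: refl_on_def tensor_equiv_def pm.span_zero)
  show "sym teq" unfolding sym_def tensor_equiv_def using pm.span_neg by fastforce
  show "trans teq" unfolding trans_def tensor_equiv_def using pm.span_add by fastforce
qed

lemma linear_ext_mem:
  assumes "pm.subspace W" "\<And>x. x \<in> Poly_Mapping.keys p \<Longrightarrow> f x \<in> W"
  shows "linear_ext pm_scale f p \<in> W"
  unfolding linear_ext_def using assms by (intro pm.subspace_sum pm.subspace_scale) auto

lemma tb_T: assumes "p \<in> T" "q \<in> T" shows "tb p q \<in> T"
  unfolding bilinear_ext_eq_linear_ext using assms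
  by (intro linear_ext_mem[OF subspace_T]) (auto simp: tensor_free_def subset_iff intro!: bracket_closed)

lemma R_intros:
  "x \<in> carrier \<gg> \<Longrightarrow> y \<in> carrier \<gg> \<Longrightarrow>
     Poly_Mapping.single (x \<oplus> y, f) 1 - Poly_Mapping.single (x, f) 1 - Poly_Mapping.single (y, f) 1 \<in> Rel"
  "x \<in> carrier \<gg> \<Longrightarrow>
     Poly_Mapping.single (x, f + g) 1 - Poly_Mapping.single (x, f) 1 - Poly_Mapping.single (x, g) 1 \<in> Rel"
  "x \<in> carrier \<gg> \<Longrightarrow> Poly_Mapping.single (c \<odot> x, f) 1 - Poly_Mapping.single (x, f) c \<in> Rel"
  "x \<in> carrier \<gg> \<Longrightarrow> Poly_Mapping.single (x, scale c f) 1 - Poly_Mapping.single (x, f) c \<in> Rel"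
  unfolding tensor_relations_def by blast+

lemma relation_cases:
  assumes "r \<in> Rel"
  obtains x y f where "x \<in> carrier \<gg>" "y \<in> carrier \<gg>"
      "r = Poly_Mapping.single (x \<oplus> y, f) 1 - Poly_Mapping.single (x, f) 1 - Poly_Mapping.single (y, f) 1"
    | x f g where "x \<in> carrier \<gg>"
      "r = Poly_Mapping.single (x, f + g) 1 - Poly_Mapping.single (x, f) 1 - Poly_Mapping.single (x, g) 1"
    | c x f where "x \<in> carrier \<gg>" "r = Poly_Mapping.single (c \<odot> x, f) 1 - Poly_Mapping.single (x, f) c"
    | c x f where "x \<in> carrier \<gg>" "r = Poly_Mapping.single (x, scale c f) 1 - Poly_Mapping.single (x, f) c"
  using assms unfolding tensor_relations_def
  apply (elim UnE CollectE exE conjE)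
  subgoal by (rule that(1))
  subgoal by (rule that(2))
  subgoal by (rule that(3))
  subgoal by (rule that(4))
  done

text \<open>
  Bracketing with a pure tensor maps defining relations to defining relations; this is what makes the
  bracket of cosets well defined.
\<close>

lemma relation_left:
  assumes r: "r \<in> Rel" and z: "z \<in> carrier \<gg>"
  shows "linear_ext pm_scale (\<lambda>(x, f). Poly_Mapping.single (x \<otimes> z, f * g) 1) r \<in> N"
proof -
  have scale_r: "scale c f * g = scale c (f * g)" for c f by (simp add: scale_mult_left)
  from r have "linear_ext pm_scale (\<lambda>(x, f). Poly_Mapping.single (x \<otimes> z, f * g) 1) r \<in> Rel"
    by (cases rule: relation_cases) (simp_all add: pm.linear_ext_diff pm.linear_ext_single pm_scale_single bracket_add_left bracket_smult_left
        z distrib_right scale_r R_intros bracket_closed)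
  then show ?thesis by (rule pm.span_base)
qed

lemma relation_right:
  assumes r: "r \<in> Rel" and z: "z \<in> carrier \<gg>"
  shows "linear_ext pm_scale (\<lambda>(x, f). Poly_Mapping.single (z \<otimes> x, g * f) 1) r \<in> N"
proof -
  have scale_r: "g * scale c f = scale c (g * f)" for c f using scale_mult_left[of c f g] by (simp add: mult.commute)
  from r have "linear_ext pm_scale (\<lambda>(x, f). Poly_Mapping.single (z \<otimes> x, g * f) 1) r \<in> Rel"
    by (cases rule: relation_cases) (simp_all add: pm.linear_ext_diff pm.linear_ext_single pm_scale_single bracket_add_right bracket_smult_right
        z distrib_left scale_r R_intros bracket_closed)
  then show ?thesis by (rule pm.span_base)
qed

lemma linear_ext_span:
  assumes "pm.subspace W" "\<And>r. r \<in> Rel \<Longrightarrow> linear_ext pm_scale f r \<in> W" "n \<in> N"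
  shows "linear_ext pm_scale f n \<in> W"
  using assms(3)
proof (induction rule: pm.span_induct_alt)
  case base
  then show ?case using pm.subspace_0[OF assms(1)] by (simp add: pm.linear_ext_zero)
next
  case (step c r p)
  then show ?case
    using assms(1,2) by (simp add: pm.linear_ext_add pm.linear_ext_pm_scale pm.subspace_add pm.subspace_scale)
qed

lemma tb_N_left:
  assumes "n \<in> N" "q \<in> T" shows "tb n q \<in> N"
  unfolding bilinear_ext_eq_linear_ext'
proof (rule linear_ext_mem[OF pm.subspace_span])
  fix k assume "k \<in> Poly_Mapping.keys q"
  then obtain z g where k: "k = (z, g)" "z \<in> carrier \<gg>" using assms(2) by (auto simp: tensor_free_def)
  show "linear_ext pm_scale (\<lambda>l. Poly_Mapping.single ((case l of (x, f) \<Rightarrow> \<lambda>(y, g). (x \<otimes> y, f * g)) k) 1) n \<in> N"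
    using linear_ext_span[OF pm.subspace_span relation_left[OF _ k(2), of _ g] assms(1)]
    by (simp add: k(1) case_prod_unfold)
qed

lemma tb_N_right:
  assumes "n \<in> N" "q \<in> T" shows "tb q n \<in> N"
  unfolding bilinear_ext_eq_linear_ext
proof (rule linear_ext_mem[OF pm.subspace_span])
  fix k assume "k \<in> Poly_Mapping.keys q"
  then obtain z g where k: "k = (z, g)" "z \<in> carrier \<gg>" using assms(2) by (auto simp: tensor_free_def)
  show "linear_ext pm_scale (\<lambda>l. Poly_Mapping.single ((case k of (x, f) \<Rightarrow> \<lambda>(y, g). (x \<otimes> y, f * g)) l) 1) n \<in> N"
    using linear_ext_span[OF pm.subspace_span relation_right[OF _ k(2), of _ g] assms(1)]
    by (simp add: k(1) case_prod_unfold)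
qed

lemma tb_diff_left: "tb (p - p') q = tb p q - tb p' q"
  by (simp add: bilinear_ext_eq_linear_ext pm.linear_ext_diff)

lemma tb_diff_right: "tb p (q - q') = tb p q - tb p q'"
  by (simp add: bilinear_ext_eq_linear_ext' pm.linear_ext_diff)

lemma eq_iff: "(p, q) \<in> teq \<longleftrightarrow> p \<in> T \<and> q \<in> T \<and> p - q \<in> N"
  by (simp add: tensor_equiv_def)

lemma current_add: 
  assumes "p \<in> T" "q \<in> T"
  shows "\<lbrakk>p\<rbrakk> \<oplus>\<^bsub>current_algebra \<gg> scale\<^esub> \<lbrakk>q\<rbrakk> = \<lbrakk>p + q\<rbrakk>"
proof -
  have "\<lbrakk>p' + q'\<rbrakk> = \<lbrakk>p + q\<rbrakk>" if "(p, p') \<in> teq" "(q, q') \<in> teq" for p' q'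
  proof -
    have "(p + q, p' + q') \<in> teq"
      using that pm.span_add[of "p - p'" Rel "q - q'"] pm.subspace_add[OF subspace_T]
      by (simp add: eq_iff algebra_simps)
    then show ?thesis using equiv_class_eq[OF equiv_eq] by blast
  qed
  note * = this
  have mem: "p \<in> \<lbrakk>p\<rbrakk>" "q \<in> \<lbrakk>q\<rbrakk>" using equiv_class_self[OF equiv_eq] assms by auto
  have "(\<Union>p'\<in>\<lbrakk>p\<rbrakk>. \<Union>q'\<in>\<lbrakk>q\<rbrakk>. \<lbrakk>p' + q'\<rbrakk>) = \<lbrakk>p + q\<rbrakk>"
    by (intro UN_constant_eq[OF mem(1)] UN_constant_eq[OF mem(2)] ballI *) simp_all
  then show ?thesis by (simp add: current_algebra_def)
qed

lemma current_bracket: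
  assumes "p \<in> T" "q \<in> T"
  shows "\<lbrakk>p\<rbrakk> \<otimes>\<^bsub>current_algebra \<gg> scale\<^esub> \<lbrakk>q\<rbrakk> = \<lbrakk>tb p q\<rbrakk>"
proof -
  have "\<lbrakk>tb p' q'\<rbrakk> = \<lbrakk>tb p q\<rbrakk>" if "(p, p') \<in> teq" "(q, q') \<in> teq" for p' q'
  proof -
    have T: "p' \<in> T" "q' \<in> T" and N: "p - p' \<in> N" "q - q' \<in> N" using that by (auto simp: eq_iff)
    have "tb (p - p') q + tb p' (q - q') \<in> N" by (intro pm.span_add tb_N_left tb_N_right N T assms)
    then have "(tb p q, tb p' q') \<in> teq"
      using tb_T assms T by (simp add: eq_iff tb_diff_left tb_diff_right)
    then show ?thesis using equiv_class_eq[OF equiv_eq] by blast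
  qed
  note * = this
  have mem: "p \<in> \<lbrakk>p\<rbrakk>" "q \<in> \<lbrakk>q\<rbrakk>" using equiv_class_self[OF equiv_eq] assms by auto
  have "(\<Union>p'\<in>\<lbrakk>p\<rbrakk>. \<Union>q'\<in>\<lbrakk>q\<rbrakk>. \<lbrakk>tb p' q'\<rbrakk>) = \<lbrakk>tb p q\<rbrakk>"
    by (intro UN_constant_eq[OF mem(1)] UN_constant_eq[OF mem(2)] ballI *) simp_all
  then show ?thesis by (simp add: current_algebra_def)
qed

lemma current_smult:
  assumes "p \<in> T"
  shows "c \<odot>\<^bsub>current_algebra \<gg> scale\<^esub> \<lbrakk>p\<rbrakk> = \<lbrakk>pm_scale c p\<rbrakk>"
proof -
  have "\<lbrakk>pm_scale c p'\<rbrakk> = \<lbrakk>pm_scale c p\<rbrakk>" if "(p, p') \<in> teq" for p'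
  proof -
    have "(pm_scale c p, pm_scale c p') \<in> teq"
      using that pm.span_scale[of "p - p'" Rel c] pm.subspace_scale[OF subspace_T]
      by (simp add: eq_iff pm.scale_right_diff_distrib)
    then show ?thesis using equiv_class_eq[OF equiv_eq] by blast
  qed
  note * = this
  have mem: "p \<in> \<lbrakk>p\<rbrakk>" using equiv_class_self[OF equiv_eq] assms by auto
  have "(\<Union>p'\<in>\<lbrakk>p\<rbrakk>. \<lbrakk>pm_scale c p'\<rbrakk>) = \<lbrakk>pm_scale c p\<rbrakk>"
    by (intro UN_constant_eq[OF mem] ballI *) simp
  then show ?thesis by (simp add: current_algebra_def)
qed

lemma carrier_current: "carrier (current_algebra \<gg> scale) = (\<lambda>p. \<lbrakk>p\<rbrakk>) ` T"
  by (auto simp: current_algebra_def quotient_def)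

text \<open>
  Linear maps out of the tensor product are evaluated on a chosen representative of a coset. The
  choice does not matter for maps induced by bilinear ones.
\<close>

definition rep :: "('g \<times> 'a \<Rightarrow>\<^sub>0 'k) set \<Rightarrow> ('g \<times> 'a \<Rightarrow>\<^sub>0 'k)" where
  "rep P = (SOME p. p \<in> P)"

lemma rep_class: assumes "p \<in> T" shows "(p, rep \<lbrakk>p\<rbrakk>) \<in> teq"
proof -
  have "rep \<lbrakk>p\<rbrakk> \<in> \<lbrakk>p\<rbrakk>" unfolding rep_def using equiv_class_self[OF equiv_eq assms] by (rule someI)
  then show ?thesis by simp
qed

definition bilinear :: "('k \<Rightarrow> 'w::ab_group_add \<Rightarrow> 'w) \<Rightarrow> ('g \<Rightarrow> 'a \<Rightarrow> 'w) \<Rightarrow> bool" where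
  "bilinear sc \<beta> \<longleftrightarrow>
     (\<forall>x\<in>carrier \<gg>. \<forall>y\<in>carrier \<gg>. \<forall>f. \<beta> (x \<oplus> y) f = \<beta> x f + \<beta> y f) \<and>
     (\<forall>x\<in>carrier \<gg>. \<forall>f g. \<beta> x (f + g) = \<beta> x f + \<beta> x g) \<and>
     (\<forall>x\<in>carrier \<gg>. \<forall>c f. \<beta> (c \<odot> x) f = sc c (\<beta> x f)) \<and>
     (\<forall>x\<in>carrier \<gg>. \<forall>c f. \<beta> x (scale c f) = sc c (\<beta> x f))"

definition induced :: "('k \<Rightarrow> 'w::ab_group_add \<Rightarrow> 'w) \<Rightarrow> ('g \<Rightarrow> 'a \<Rightarrow> 'w) \<Rightarrow> ('g \<times> 'a \<Rightarrow>\<^sub>0 'k) set \<Rightarrow> 'w" where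
  "induced sc \<beta> P = linear_ext sc (case_prod \<beta>) (rep P)"

lemma induced_class:
  assumes "vector_space sc" "bilinear sc \<beta>" "p \<in> T"
  shows "induced sc \<beta> \<lbrakk>p\<rbrakk> = linear_ext sc (case_prod \<beta>) p"
proof -
  interpret W: vector_space sc by fact
  have zero: "linear_ext sc (case_prod \<beta>) n = 0" if "n \<in> N" for n
    using that
  proof (induction rule: pm.span_induct_alt)
    case (step c r p)
    have "linear_ext sc (case_prod \<beta>) r = 0"
      using step(1) by (cases rule: relation_cases)
        (use assms(2) in \<open>simp_all add: bilinear_def W.linear_ext_diff W.linear_ext_single\<close>)
    with step show ?case by (simp add: W.linear_ext_add W.linear_ext_pm_scale)
  qed (simp add: W.linear_ext_zero)
  show ?thesis using zero[of "p - rep \<lbrakk>p\<rbrakk>"] rep_class[OF assms(3)]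
    by (simp add: induced_def W.linear_ext_diff eq_iff)
qed

lemma carrier_currentE:
  assumes "P \<in> carrier (current_algebra \<gg> scale)"
  obtains p where "p \<in> T" "P = \<lbrakk>p\<rbrakk>"
  using assms unfolding carrier_current by blast

lemma class_in_carrier: "p \<in> T \<Longrightarrow> \<lbrakk>p\<rbrakk> \<in> carrier (current_algebra \<gg> scale)"
  unfolding carrier_current by blast

text \<open>
  Modules over a current algebra and cocycles on it are given by bilinear data on pure tensors; the
  identities for all tensors follow by expanding both arguments.
\<close>

lemma lie_cocycle_current:
  fixes sc :: "'k \<Rightarrow> 'm::ab_group_add \<Rightarrow> 'm" and A :: "'g \<Rightarrow> 'a \<Rightarrow> 'm \<Rightarrow> 'm" and \<beta> :: "'g \<Rightarrow> 'a \<Rightarrow> 'm"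
  assumes W: "vector_space sc" and M: "module.subspace sc M"
    and lin: "\<And>x f. x \<in> carrier \<gg> \<Longrightarrow> Vector_Spaces.linear sc sc (A x f)"
    and A_bil: "\<And>m. m \<in> M \<Longrightarrow> bilinear sc (\<lambda>x f. A x f m)"
    and A_closed: "\<And>x f m. x \<in> carrier \<gg> \<Longrightarrow> m \<in> M \<Longrightarrow> A x f m \<in> M"
    and A_bracket: "\<And>x y f g m. x \<in> carrier \<gg> \<Longrightarrow> y \<in> carrier \<gg> \<Longrightarrow> m \<in> M \<Longrightarrow>
      A (x \<otimes> y) (f * g) m = A x f (A y g m) - A y g (A x f m)"
    and \<beta>_bil: "bilinear sc \<beta>"
    and \<beta>_closed: "\<And>x f. x \<in> carrier \<gg> \<Longrightarrow> \<beta> x f \<in> M"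
    and \<beta>_bracket: "\<And>x y f g. x \<in> carrier \<gg> \<Longrightarrow> y \<in> carrier \<gg> \<Longrightarrow>
      \<beta> (x \<otimes> y) (f * g) = A x f (\<beta> y g) - A y g (\<beta> x f)"
  shows "lie_cocycle sc (current_algebra \<gg> scale) M (\<lambda>P m. induced sc (\<lambda>x f. A x f m) P) (induced sc \<beta>)"
proof -
  interpret W: vector_space sc by fact
  have A_ind: "induced sc (\<lambda>x f. A x f m) \<lbrakk>p\<rbrakk> = linear_ext sc (\<lambda>(x, f). A x f m) p" if "p \<in> T" "m \<in> M" for p m
    using induced_class[OF W A_bil] that by simp
  have \<beta>_ind: "induced sc \<beta> \<lbrakk>p\<rbrakk> = linear_ext sc (case_prod \<beta>) p" if "p \<in> T" for p
    using induced_class[OF W \<beta>_bil] that by simp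
  have T: "p + q \<in> T" "pm_scale c p \<in> T" "tb p q \<in> T" if "p \<in> T" "q \<in> T" for p q c
    using that tb_T pm.subspace_add[OF subspace_T] pm.subspace_scale[OF subspace_T] by auto
  have ext_M: "linear_ext sc (case_prod h) p \<in> M" if "p \<in> T" "\<And>x f. x \<in> carrier \<gg> \<Longrightarrow> h x f \<in> M" for p h
    unfolding linear_ext_def using that
    by (intro W.subspace_sum[OF M] W.subspace_scale[OF M]) (auto simp: tensor_free_def)
  have double: "linear_ext sc (\<lambda>(x, f). A x f (linear_ext sc h q)) p =
      (\<Sum>k\<in>Poly_Mapping.keys p. \<Sum>l\<in>Poly_Mapping.keys q.
         sc (Poly_Mapping.lookup p k * Poly_Mapping.lookup q l) (case k of (x, f) \<Rightarrow> A x f (h l)))"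
    if p: "p \<in> T" for p q h
    unfolding linear_ext_def[of sc _ p]
  proof (rule sum.cong[OF refl])
    fix k assume "k \<in> Poly_Mapping.keys p"
    then obtain x f where k: "k = (x, f)" "x \<in> carrier \<gg>" using p by (auto simp: tensor_free_def)
    interpret A: Vector_Spaces.linear sc sc "A x f" using lin[OF k(2)] .
    show "sc (Poly_Mapping.lookup p k) (case k of (x, f) \<Rightarrow> A x f (linear_ext sc h q)) =
      (\<Sum>l\<in>Poly_Mapping.keys q. sc (Poly_Mapping.lookup p k * Poly_Mapping.lookup q l) (case k of (x, f) \<Rightarrow> A x f (h l)))"
      by (simp add: k(1) linear_ext_def A.sum A.scale W.scale_sum_right)
  qed
  have ext_bracket: "linear_ext sc (case_prod h) (tb p q) =
      linear_ext sc (\<lambda>(x, f). A x f (linear_ext sc (case_prod h) q)) p -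
      linear_ext sc (\<lambda>(x, f). A x f (linear_ext sc (case_prod h) p)) q"
    if pq: "p \<in> T" "q \<in> T" and h: "\<And>x y f g. x \<in> carrier \<gg> \<Longrightarrow> y \<in> carrier \<gg> \<Longrightarrow>
      h (x \<otimes> y) (f * g) = A x f (h y g) - A y g (h x f)" for p q and h :: "'g \<Rightarrow> 'a \<Rightarrow> 'm"
  proof -
    have "linear_ext sc (case_prod h) (tb p q) = (\<Sum>k\<in>Poly_Mapping.keys p. \<Sum>l\<in>Poly_Mapping.keys q.
         sc (Poly_Mapping.lookup p k * Poly_Mapping.lookup q l)
           ((case k of (x, f) \<Rightarrow> A x f (case_prod h l)) - (case l of (x, f) \<Rightarrow> A x f (case_prod h k))))"
      unfolding W.linear_ext_bilinear_ext
    proof (intro sum.cong refl)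
      fix k l assume "k \<in> Poly_Mapping.keys p" "l \<in> Poly_Mapping.keys q"
      then obtain x f y g where "k = (x, f)" "l = (y, g)" "x \<in> carrier \<gg>" "y \<in> carrier \<gg>"
        using pq by (cases k, cases l) (auto simp: tensor_free_def)
      then show "sc (Poly_Mapping.lookup p k * Poly_Mapping.lookup q l)
          (case_prod h ((case k of (x, f) \<Rightarrow> \<lambda>(y, g). (x \<otimes> y, f * g)) l)) =
        sc (Poly_Mapping.lookup p k * Poly_Mapping.lookup q l)
           ((case k of (x, f) \<Rightarrow> A x f (case_prod h l)) - (case l of (x, f) \<Rightarrow> A x f (case_prod h k)))"
        by (simp add: h)
    qed
    also have "\<dots> = linear_ext sc (\<lambda>(x, f). A x f (linear_ext sc (case_prod h) q)) p -
      linear_ext sc (\<lambda>(x, f). A x f (linear_ext sc (case_prod h) p)) q"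
      unfolding double[OF pq(1)] double[OF pq(2)] sum.swap[of _ "Poly_Mapping.keys p" "Poly_Mapping.keys q"]
      by (simp add: W.scale_right_diff_distrib sum_subtractf mult.commute)
    finally show ?thesis .
  qed
  show ?thesis
  proof
    fix P assume P: "P \<in> carrier (current_algebra \<gg> scale)"
    then obtain p where p: "p \<in> T" "P = \<lbrakk>p\<rbrakk>" by (rule carrier_currentE)
    have "rep P \<in> T" using rep_class[OF p(1)] p(2) by (simp add: eq_iff)
    then have "Vector_Spaces.linear sc sc (\<lambda>m. induced sc (\<lambda>x f. A x f m) P)"
    proof -
      assume r: "rep P \<in> T"
      interpret vector_space_pair sc sc ..
      have "Vector_Spaces.linear sc sc (case k of (x, f) \<Rightarrow> A x f)" if "k \<in> Poly_Mapping.keys (rep P)" for k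
        using that r lin by (cases k) (auto simp: tensor_free_def)
      then have "Vector_Spaces.linear sc sc (\<lambda>m. \<Sum>k\<in>Poly_Mapping.keys (rep P).
          sc (Poly_Mapping.lookup (rep P) k) ((case k of (x, f) \<Rightarrow> A x f) m))"
        by (intro linear_compose_sum ballI linear_compose_scale_right)
      then show ?thesis by (simp add: induced_def linear_ext_def case_prod_unfold)
    qed
    then interpret L: Vector_Spaces.linear sc sc "\<lambda>m. induced sc (\<lambda>x f. A x f m) P" .
    show "induced sc (\<lambda>x f. A x f (a + b)) P = induced sc (\<lambda>x f. A x f a) P + induced sc (\<lambda>x f. A x f b) P"
      "induced sc (\<lambda>x f. A x f (sc c a)) P = sc c (induced sc (\<lambda>x f. A x f a) P)" for a b c
      by (rule L.add L.scale)+
    show "induced sc \<beta> P \<in> M" unfolding p(2) \<beta>_ind[OF p(1)] by (rule ext_M[OF p(1) \<beta>_closed])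
    show "c \<odot>\<^bsub>current_algebra \<gg> scale\<^esub> P \<in> carrier (current_algebra \<gg> scale)" for c
      unfolding p(2) current_smult[OF p(1)] by (rule class_in_carrier[OF T(2)[OF p(1) p(1)]])
    show "induced sc \<beta> (c \<odot>\<^bsub>current_algebra \<gg> scale\<^esub> P) = sc c (induced sc \<beta> P)" for c
      by (simp add: p current_smult T(2)[OF p(1) p(1)] \<beta>_ind W.linear_ext_pm_scale)
    have closed: "induced sc (\<lambda>x f. A x f m) \<lbrakk>q\<rbrakk> \<in> M" if "m \<in> M" "q \<in> T" for m q
      using ext_M[OF that(2) A_closed[OF _ that(1)]] A_ind[OF that(2,1)] by simp
    show "induced sc (\<lambda>x f. A x f m) P \<in> M" if "m \<in> M" for m using closed[OF that p(1)] p(2) by simp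
    show "induced sc (\<lambda>x f. A x f m) (c \<odot>\<^bsub>current_algebra \<gg> scale\<^esub> P) = sc c (induced sc (\<lambda>x f. A x f m) P)"
      if "m \<in> M" for m c
      using that by (simp add: p current_smult T(2)[OF p(1) p(1)] A_ind W.linear_ext_pm_scale)
    fix Q assume "Q \<in> carrier (current_algebra \<gg> scale)"
    then obtain q where q: "q \<in> T" "Q = \<lbrakk>q\<rbrakk>" by (rule carrier_currentE)
    show "P \<oplus>\<^bsub>current_algebra \<gg> scale\<^esub> Q \<in> carrier (current_algebra \<gg> scale)"
      "P \<otimes>\<^bsub>current_algebra \<gg> scale\<^esub> Q \<in> carrier (current_algebra \<gg> scale)"
      unfolding p(2) q(2) current_add[OF p(1) q(1)] current_bracket[OF p(1) q(1)]
      by (intro class_in_carrier T p(1) q(1))+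
    show "induced sc \<beta> (P \<oplus>\<^bsub>current_algebra \<gg> scale\<^esub> Q) = induced sc \<beta> P + induced sc \<beta> Q"
      using p q T by (simp add: current_add \<beta>_ind W.linear_ext_add)
    show "induced sc (\<lambda>x f. A x f m) (P \<oplus>\<^bsub>current_algebra \<gg> scale\<^esub> Q) =
      induced sc (\<lambda>x f. A x f m) P + induced sc (\<lambda>x f. A x f m) Q" if "m \<in> M" for m
      using that p q T by (simp add: current_add A_ind W.linear_ext_add)
    show "induced sc \<beta> (P \<otimes>\<^bsub>current_algebra \<gg> scale\<^esub> Q) =
      induced sc (\<lambda>x f. A x f (induced sc \<beta> Q)) P - induced sc (\<lambda>x f. A x f (induced sc \<beta> P)) Q"
      unfolding p(2) q(2) current_bracket[OF p(1) q(1)]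
      using p(1) q(1) T(3) ext_M[OF p(1) \<beta>_closed] ext_M[OF q(1) \<beta>_closed]
      by (simp add: A_ind \<beta>_ind ext_bracket[of p q \<beta>, OF _ _ \<beta>_bracket])
    show "induced sc (\<lambda>x f. A x f m) (P \<otimes>\<^bsub>current_algebra \<gg> scale\<^esub> Q) =
      induced sc (\<lambda>x f. A x f (induced sc (\<lambda>x f. A x f m) Q)) P -
      induced sc (\<lambda>x f. A x f (induced sc (\<lambda>x f. A x f m) P)) Q" if m: "m \<in> M" for m
      unfolding p(2) q(2) current_bracket[OF p(1) q(1)]
      using p(1) q(1) T(3) ext_M[OF p(1) A_closed[OF _ m]] ext_M[OF q(1) A_closed[OF _ m]] m
      by (simp add: A_ind ext_bracket[of p q "\<lambda>x f. A x f m", OF _ _ A_bracket[OF _ _ m]])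
  qed (fact M)
qed

definition tensor :: "'g \<Rightarrow> 'a \<Rightarrow> ('g \<times> 'a \<Rightarrow>\<^sub>0 'k) set" where
  "tensor x f = \<lbrakk>Poly_Mapping.single (x, f) 1\<rbrakk>"

lemma tensor_in_carrier: "x \<in> carrier \<gg> \<Longrightarrow> tensor x f \<in> carrier (current_algebra \<gg> scale)"
  unfolding tensor_def by (rule class_in_carrier[OF single_T])

lemma induced_tensor:
  assumes "vector_space sc" "bilinear sc \<beta>" "x \<in> carrier \<gg>"
  shows "induced sc \<beta> (tensor x f) = \<beta> x f"
proof -
  interpret W: vector_space sc by fact
  show ?thesis unfolding tensor_def induced_class[OF assms(1,2) single_T[OF assms(3)]]
    by (simp add: W.linear_ext_single)
qed

section \<open>Linear functionals on a Lie algebra\<close>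

definition functionals :: "('g \<Rightarrow> 'k) set" where
  "functionals = {l. (\<forall>x\<in>carrier \<gg>. \<forall>y\<in>carrier \<gg>. l (x \<oplus> y) = l x + l y) \<and>
     (\<forall>x\<in>carrier \<gg>. \<forall>c. l (c \<odot> x) = c * l x)}"

end

context current
begin

lemma smult_facts:
  "x \<in> carrier \<gg> \<Longrightarrow> c \<odot> x \<in> carrier \<gg>"
  "x \<in> carrier \<gg> \<Longrightarrow> (a + b) \<odot> x = a \<odot> x \<oplus> b \<odot> x"
  "x \<in> carrier \<gg> \<Longrightarrow> y \<in> carrier \<gg> \<Longrightarrow> c \<odot> (x \<oplus> y) = c \<odot> x \<oplus> c \<odot> y"
  "x \<in> carrier \<gg> \<Longrightarrow> (a * b) \<odot> x = a \<odot> (b \<odot> x)"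
  "x \<in> carrier \<gg> \<Longrightarrow> 1 \<odot> x = x"
  "x \<in> carrier \<gg> \<Longrightarrow> 0 \<odot> x = \<zero>"
  "c \<odot> \<zero> = \<zero>"
  using smult_closed[of c x] smult_l_distr[of a b x] smult_r_distr[of c x y] smult_assoc1[of a b x] smult_one[of x]
    smult_l_null[of x] smult_r_null[of c]
  by (simp_all add: ring_of_type_algebra_def)

definition is_subspace :: "'g set \<Rightarrow> bool" where
  "is_subspace H \<longleftrightarrow> H \<subseteq> carrier \<gg> \<and> \<zero> \<in> H \<and> (\<forall>x\<in>H. \<forall>y\<in>H. x \<oplus> y \<in> H) \<and> (\<forall>c. \<forall>x\<in>H. c \<odot> x \<in> H)"

lemma exists_maximal_subspace_avoiding:
  assumes "z \<noteq> \<zero>"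
  obtains H where "is_subspace H" "z \<notin> H" "\<And>K. is_subspace K \<Longrightarrow> z \<notin> K \<Longrightarrow> H \<subseteq> K \<Longrightarrow> K = H"
proof -
  let ?A = "{H. is_subspace H \<and> z \<notin> H}"
  have "\<exists>M\<in>?A. \<forall>H\<in>?A. M \<subseteq> H \<longrightarrow> H = M"
  proof (rule subset_Zorn_nonempty)
    have "is_subspace {\<zero>}" by (auto simp: is_subspace_def smult_facts)
    then show "?A \<noteq> {}" using assms by blast
    fix \<C> assume "\<C> \<noteq> {}" and chain: "subset.chain ?A \<C>"
    then have C: "\<And>H. H \<in> \<C> \<Longrightarrow> is_subspace H \<and> z \<notin> H" by (auto simp: subset.chain_def)
    have "x \<oplus> y \<in> \<Union>\<C>" if xy: "x \<in> \<Union>\<C>" "y \<in> \<Union>\<C>" for x y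
    proof -
      obtain H K where HK: "H \<in> \<C>" "K \<in> \<C>" "x \<in> H" "y \<in> K" using xy by auto
      then consider "H \<subseteq> K" | "K \<subseteq> H" using subset.chain_total[OF chain] by blast
      then show ?thesis
      proof cases
        case 1
        with HK have "x \<oplus> y \<in> K" using C[OF HK(2)] by (auto simp: is_subspace_def)
        with HK show ?thesis by blast
      next
        case 2
        with HK have "x \<oplus> y \<in> H" using C[OF HK(1)] by (auto simp: is_subspace_def)
        with HK show ?thesis by blast
      qed
    qed
    moreover have "\<Union>\<C> \<subseteq> carrier \<gg>" "\<zero> \<in> \<Union>\<C>" "\<And>c x. x \<in> \<Union>\<C> \<Longrightarrow> c \<odot> x \<in> \<Union>\<C>" "z \<notin> \<Union>\<C>"
      using C \<open>\<C> \<noteq> {}\<close> unfolding is_subspace_def by blast+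
    ultimately show "\<Union>\<C> \<in> ?A" by (simp add: is_subspace_def)
  qed
  then show ?thesis using that by auto
qed

text \<open>
  A maximal subspace \<open>H\<close> avoiding \<open>z\<close> is a hyperplane complementary to the line of \<open>z\<close>. The value of the
  functional at \<open>x\<close> is the coefficient \<open>c\<close> with \<open>x - c z \<in> H\<close>, which is expressed by \<open>P x c\<close>.
\<close>

lemma exists_functional:
  assumes z: "z \<in> carrier \<gg>" "z \<noteq> \<zero>"
  shows "\<exists>l\<in>functionals. l z = 1"
proof -
  obtain H where H: "is_subspace H" "z \<notin> H"
    and max: "\<And>K. is_subspace K \<Longrightarrow> z \<notin> K \<Longrightarrow> H \<subseteq> K \<Longrightarrow> K = H"
    using exists_maximal_subspace_avoiding[OF z(2)] by blast
  have sub: "\<And>x. x \<in> H \<Longrightarrow> x \<in> carrier \<gg>" "\<zero> \<in> H" "\<And>x y. x \<in> H \<Longrightarrow> y \<in> H \<Longrightarrow> x \<oplus> y \<in> H"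
    "\<And>c x. x \<in> H \<Longrightarrow> c \<odot> x \<in> H" using H(1) by (auto simp: is_subspace_def)
  note ac = M.a_assoc M.a_comm M.a_lcomm
  define P where "P x c \<longleftrightarrow> x \<oplus> (- c) \<odot> z \<in> H" for x c
  have P_add: "P (x \<oplus> y) (a + b)" if "P x a" "P y b" "x \<in> carrier \<gg>" "y \<in> carrier \<gg>" for x y a b
  proof -
    have "(x \<oplus> y) \<oplus> (- (a + b)) \<odot> z = (x \<oplus> (- a) \<odot> z) \<oplus> (y \<oplus> (- b) \<odot> z)"
      using that(3,4) z(1) smult_facts(2)[OF z(1), of "- a" "- b"] by (simp add: smult_facts(1) ac)
    with that(1,2) sub(3) show ?thesis by (simp add: P_def)
  qed
  have P_scale: "P (c \<odot> x) (c * a)" if "P x a" "x \<in> carrier \<gg>" for x a c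
  proof -
    have "(c \<odot> x) \<oplus> (- (c * a)) \<odot> z = c \<odot> (x \<oplus> (- a) \<odot> z)"
      using that(2) z(1) smult_facts(4)[OF z(1), of c "- a"] by (simp add: smult_facts(1,3))
    with that(1) sub(4) show ?thesis by (simp add: P_def)
  qed
  have P_0: "a = 0" if "P \<zero> a" for a
  proof (rule ccontr)
    assume "a \<noteq> 0"
    have "(- inverse a) \<odot> ((- a) \<odot> z) \<in> H" using that sub(4) z(1) by (simp add: P_def smult_facts(1))
    moreover have "(- inverse a) \<odot> ((- a) \<odot> z) = z"
      using \<open>a \<noteq> 0\<close> z(1) smult_facts(4)[OF z(1), of "- inverse a" "- a"] by (simp add: smult_facts(5))
    ultimately show False using H(2) by simp
  qed
  have neg: "x \<oplus> (- 1) \<odot> x = \<zero>" if "x \<in> carrier \<gg>" for x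
    using smult_facts(2)[OF that, of 1 "- 1"] that by (simp add: smult_facts(5,6))
  have P_unique: "a = b" if "P x a" "P x b" "x \<in> carrier \<gg>" for x a b
    using P_0[of "a - b"] P_add[OF that(1) P_scale[OF that(2), of "- 1"]] that(3) by (simp add: neg smult_facts(1))
  have P_exists: "\<exists>c. P x c" if x: "x \<in> carrier \<gg>" for x
  proof (cases "x \<in> H")
    case True
    then show ?thesis using x z(1) by (intro exI[of _ 0]) (simp add: P_def smult_facts(6))
  next
    case False
    \<comment> \<open>By maximality \<open>H + k x\<close> contains \<open>z\<close>, which can be solved for \<open>x\<close>.\<close>
    let ?K = "{h \<oplus> a \<odot> x |h a. h \<in> H}"
    have mem: "h \<oplus> a \<odot> x \<in> ?K" if "h \<in> H" for h a using that by blast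
    have "is_subspace ?K"
      unfolding is_subspace_def
    proof (intro conjI ballI allI)
      show "?K \<subseteq> carrier \<gg>" using sub(1) x by (auto simp: smult_facts(1))
      show "\<zero> \<in> ?K" using mem[OF sub(2), of 0] x by (simp add: smult_facts(6))
      fix y w c assume "y \<in> ?K"
      then obtain h a where y: "y = h \<oplus> a \<odot> x" "h \<in> H" by blast
      have "c \<odot> y = c \<odot> h \<oplus> (c * a) \<odot> x" using sub(1)[OF y(2)] x by (simp add: y smult_facts(1,3,4))
      then show "c \<odot> y \<in> ?K" using mem[OF sub(4)[OF y(2)]] by simp
      assume "w \<in> ?K"
      then obtain k b where w: "w = k \<oplus> b \<odot> x" "k \<in> H" by blast
      have "y \<oplus> w = (h \<oplus> k) \<oplus> (a + b) \<odot> x"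
        using sub(1)[OF y(2)] sub(1)[OF w(2)] x by (simp add: y w smult_facts(1,2) ac)
      then show "y \<oplus> w \<in> ?K" using mem[OF sub(3)[OF y(2) w(2)]] by simp
    qed
    moreover have "H \<subseteq> ?K"
    proof
      fix h assume "h \<in> H"
      then show "h \<in> ?K" using mem[of h 0] sub(1) x by (simp add: smult_facts(6))
    qed
    moreover have "x \<in> ?K" using mem[OF sub(2), of 1] x by (simp add: smult_facts(5))
    ultimately have "z \<in> ?K" using max[of ?K] False by blast
    then obtain h a where h: "z = h \<oplus> a \<odot> x" "h \<in> H" by blast
    have "a \<noteq> 0" using h H(2) sub(1)[OF h(2)] x by (auto simp: smult_facts(6))
    have "x \<oplus> (- inverse a) \<odot> z = (- inverse a) \<odot> h \<oplus> (x \<oplus> (- 1) \<odot> x)"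
      using sub(1)[OF h(2)] x \<open>a \<noteq> 0\<close> smult_facts(4)[OF x, of "- inverse a" a] by (simp add: h(1) smult_facts(1,3) ac)
    also have "\<dots> = (- inverse a) \<odot> h" using sub(1)[OF h(2)] x by (simp add: neg smult_facts(1))
    finally have "P x (inverse a)" using sub(4)[OF h(2)] by (simp add: P_def)
    then show ?thesis by blast
  qed
  define l where "l x = (SOME c. P x c)" for x
  have l: "P x (l x)" if "x \<in> carrier \<gg>" for x unfolding l_def by (rule someI_ex[OF P_exists[OF that]])
  have l_eq: "l x = c" if "P x c" "x \<in> carrier \<gg>" for x c using P_unique[OF l[OF that(2)] that] .
  have "l \<in> functionals"
    unfolding functionals_def using l P_add P_scale by (auto intro!: l_eq smult_facts(1))
  moreover have "l z = 1" using z(1) sub(2) by (intro l_eq) (simp_all add: P_def neg)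
  ultimately show ?thesis by blast
qed

lemma functionalsD:
  assumes "l \<in> functionals" "x \<in> carrier \<gg>" "y \<in> carrier \<gg>"
  shows "l (x \<oplus> y) = l x + l y" "l (c \<odot> x) = c * l x" "l \<zero> = 0"
  using assms smult_facts(6)[OF assms(2)] unfolding functionals_def by (auto, metis mult_zero_left)

lemma functional_antisym:
  assumes l: "l \<in> functionals" and xy: "x \<in> carrier \<gg>" "y \<in> carrier \<gg>"
  shows "l (y \<otimes> x) = - l (x \<otimes> y)"
proof -
  have "\<zero> = (x \<oplus> y) \<otimes> (x \<oplus> y)" using xy by (simp add: bracket_alternating)
  also have "\<dots> = (x \<otimes> x \<oplus> y \<otimes> x) \<oplus> (x \<otimes> y \<oplus> y \<otimes> y)"
    using xy by (simp add: bracket_add_left bracket_add_right bracket_closed)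
  finally have "l \<zero> = l ((x \<otimes> x \<oplus> y \<otimes> x) \<oplus> (x \<otimes> y \<oplus> y \<otimes> y))" by simp
  also have "\<dots> = l (x \<otimes> y) + l (y \<otimes> x)"
    using xy by (simp add: functionalsD[OF l] bracket_closed bracket_alternating)
  finally show ?thesis using functionalsD(3)[OF l xy] by (simp add: eq_neg_iff_add_eq_0 add.commute)
qed

text \<open>
  Up to sign the coadjoint action. Functionals carry no information outside the carrier, and the value
  \<open>0\<close> there makes the identities below hold as equations between functions.
\<close>

definition coad :: "'g \<Rightarrow> ('g \<Rightarrow> 'k) \<Rightarrow> 'g \<Rightarrow> 'k" where
  "coad x l = (\<lambda>z. if z \<in> carrier \<gg> then l (x \<otimes> z) else 0)"

lemma coad_functional: "x \<in> carrier \<gg> \<Longrightarrow> l \<in> functionals \<Longrightarrow> coad x l \<in> functionals"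
  by (auto simp: functionals_def coad_def bracket_add_right bracket_smult_right bracket_closed smult_facts(1))

lemma coad_add: "x \<in> carrier \<gg> \<Longrightarrow> y \<in> carrier \<gg> \<Longrightarrow> l \<in> functionals \<Longrightarrow>
    coad (x \<oplus> y) l = (\<lambda>z. coad x l z + coad y l z)"
  by (auto simp: functionals_def coad_def bracket_add_left bracket_closed fun_eq_iff)

lemma coad_smult: "x \<in> carrier \<gg> \<Longrightarrow> l \<in> functionals \<Longrightarrow> coad (c \<odot> x) l = (\<lambda>z. c * coad x l z)"
  by (auto simp: functionals_def coad_def bracket_smult_left bracket_closed fun_eq_iff)

text \<open>
  The Jacobi identity, tested on functionals.
\<close>

lemma coad_bracket:
  assumes x: "x \<in> carrier \<gg>" and y: "y \<in> carrier \<gg>" and l: "l \<in> functionals"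
  shows "coad y (coad x l) = (\<lambda>z. coad (x \<otimes> y) l z + coad x (coad y l) z)"
proof
  fix z
  show "coad y (coad x l) z = coad (x \<otimes> y) l z + coad x (coad y l) z"
  proof (cases "z \<in> carrier \<gg>")
    case z: True
    have "l ((x \<otimes> (y \<otimes> z)) \<oplus> (y \<otimes> (z \<otimes> x)) \<oplus> (z \<otimes> (x \<otimes> y))) = 0"
      using jacobi[OF x y z] functionalsD(3)[OF l x x] by simp
    then have "l (x \<otimes> (y \<otimes> z)) + l (y \<otimes> (z \<otimes> x)) + l (z \<otimes> (x \<otimes> y)) = 0"
      using x y z by (simp add: functionalsD(1)[OF l] bracket_closed)
    moreover have "l (y \<otimes> (z \<otimes> x)) = - l (y \<otimes> (x \<otimes> z))"
      using functional_antisym[OF coad_functional[OF y l] x z] x z by (simp add: coad_def bracket_closed)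
    moreover have "l (z \<otimes> (x \<otimes> y)) = - l ((x \<otimes> y) \<otimes> z)"
      using functional_antisym[OF l bracket_closed[OF x y] z] .
    ultimately show ?thesis using x y z by (simp add: coad_def bracket_closed algebra_simps)
  qed (simp add: coad_def)
qed

end

section \<open>Enveloping algebras of current algebras\<close>

locale current_on_curve = current \<gg> scale + curve_component scale res
  for \<gg> :: "('k::field_char_0, 'g) module" (structure) and scale :: "'k \<Rightarrow> 'a::comm_ring_1 \<Rightarrow> 'a"
    and res :: "'a \<Rightarrow> 'f::field"
begin

sublocale fun_emb: vector_space "\<lambda>c (m :: ('g \<Rightarrow> 'k) \<Rightarrow> 'f) l. emb c * m l"
  by standard (auto simp: fun_eq_iff emb_add emb_mult emb_1 algebra_simps)

text \<open>
  Linear maps from the dual of \<open>\<gg>\<close> to \<open>F\<close>. The space \<open>\<gg> \<otimes> F\<close> embeds into them, the tensor \<open>x \<otimes> f\<close>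
  becoming evaluation at \<open>x\<close> times \<open>f\<close>, and \<open>current_act\<close> below extends the adjoint action. In this form elements of the module
  are tested for being nonzero by a single functional.
\<close>

definition functional_maps :: "(('g \<Rightarrow> 'k) \<Rightarrow> 'f) set" where
  "functional_maps = {m. \<forall>l\<in>functionals. (\<forall>l'\<in>functionals. m (\<lambda>z. l z + l' z) = m l + m l') \<and>
     (\<forall>c. m (\<lambda>z. c * l z) = emb c * m l)}"

definition current_act :: "'g \<Rightarrow> 'a \<Rightarrow> (('g \<Rightarrow> 'k) \<Rightarrow> 'f) \<Rightarrow> ('g \<Rightarrow> 'k) \<Rightarrow> 'f" where
  "current_act x f m = (\<lambda>l. if l \<in> functionals then res f * m (coad x l) else 0)"

text \<open>
  The cocycle \<open>x \<otimes> f \<mapsto> x \<otimes> D f\<close>, under the embedding of \<open>\<gg> \<otimes> F\<close>.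
\<close>

definition current_cocycle :: "('a \<Rightarrow> 'a) \<Rightarrow> 'g \<Rightarrow> 'a \<Rightarrow> ('g \<Rightarrow> 'k) \<Rightarrow> 'f" where
  "current_cocycle D x f = (\<lambda>l. if l \<in> functionals then emb (l x) * res (D f) else 0)"

lemma functionals_closed:
  "l \<in> functionals \<Longrightarrow> l' \<in> functionals \<Longrightarrow> (\<lambda>z. l z + l' z) \<in> functionals"
  "l \<in> functionals \<Longrightarrow> (\<lambda>z. c * l z) \<in> functionals"
  by (auto simp: functionals_def algebra_simps)

lemma coad_linear:
  "coad x (\<lambda>z. l z + l' z) = (\<lambda>z. coad x l z + coad x l' z)"
  "coad x (\<lambda>z. c * l z) = (\<lambda>z. c * coad x l z)"
  by (auto simp: coad_def)

lemma bilinear_current_act: "m \<in> functional_maps \<Longrightarrow> bilinear (\<lambda>c m l. emb c * m l) (\<lambda>x f. current_act x f m)"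
    unfolding bilinear_def current_act_def
    by (auto simp: fun_eq_iff coad_add coad_smult functional_maps_def coad_functional res_add res_scale algebra_simps)

lemma bilinear_current_cocycle: "D \<in> derivations scale \<Longrightarrow> bilinear (\<lambda>c m l. emb c * m l) (current_cocycle D)"
    unfolding bilinear_def current_cocycle_def
    by (auto simp: fun_eq_iff functionalsD derivationsD(1,2) emb_add emb_mult res_add res_scale algebra_simps)

lemma lie_cocycle_current_act:
  assumes D: "D \<in> derivations scale"
  shows "lie_cocycle (\<lambda>c m l. emb c * m l) (current_algebra \<gg> scale) functional_maps
    (\<lambda>P m. induced (\<lambda>c m l. emb c * m l) (\<lambda>x f. current_act x f m) P)
    (induced (\<lambda>c m l. emb c * m l) (current_cocycle D))"
proof (rule lie_cocycle_current)
  let ?sc = "\<lambda>c (m :: ('g \<Rightarrow> 'k) \<Rightarrow> 'f) l. emb c * m l"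
  note D' = derivationsD[OF D]
  show "vector_space ?sc" ..
  show "fun_emb.subspace functional_maps"
    unfolding fun_emb.subspace_def by (auto simp: functional_maps_def algebra_simps)
  fix x f assume x: "x \<in> carrier \<gg>"
  show "Vector_Spaces.linear ?sc ?sc (current_act x f)"
    by standard (auto simp: current_act_def fun_eq_iff algebra_simps)
  show "current_act x f m \<in> functional_maps" if "m \<in> functional_maps" for m
    using that coad_functional[OF x]
    by (auto simp: functional_maps_def current_act_def functionals_closed coad_linear algebra_simps)
  show "current_cocycle D x f \<in> functional_maps"
    by (auto simp: functional_maps_def current_cocycle_def functionals_closed emb_add emb_mult algebra_simps)
  fix y g assume y: "y \<in> carrier \<gg>"
  show "current_act (x \<otimes> y) (f * g) m = current_act x f (current_act y g m) - current_act y g (current_act x f m)"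
    if m: "m \<in> functional_maps" for m
  proof
    fix l
    have "m (coad y (coad x l)) = m (coad (x \<otimes> y) l) + m (coad x (coad y l))" if l: "l \<in> functionals"
      unfolding coad_bracket[OF x y l]
      using m coad_functional[OF bracket_closed[OF x y] l] coad_functional[OF x coad_functional[OF y l]]
      by (simp add: functional_maps_def)
    then show "current_act (x \<otimes> y) (f * g) m l =
        (current_act x f (current_act y g m) - current_act y g (current_act x f m)) l"
      using coad_functional[OF x] coad_functional[OF y]
      by (auto simp: current_act_def res_mult algebra_simps)
  qed
  show "current_cocycle D (x \<otimes> y) (f * g) =
    current_act x f (current_cocycle D y g) - current_act y g (current_cocycle D x f)"
  proof
    fix l
    have "emb (l (y \<otimes> x)) = - emb (l (x \<otimes> y))" if "l \<in> functionals"
      using functional_antisym[OF that x y] emb_diff[of 0 "l (x \<otimes> y)"] by (simp add: emb_0)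
    then show "current_cocycle D (x \<otimes> y) (f * g) l =
      (current_act x f (current_cocycle D y g) - current_act y g (current_cocycle D x f)) l"
      using coad_functional[OF x] coad_functional[OF y] x y
      by (auto simp: current_act_def current_cocycle_def coad_def[of x] coad_def[of y] D'(3) res_add res_mult algebra_simps)
  qed
qed (use bilinear_current_act bilinear_current_cocycle[OF D] in auto)

text \<open>
  Independence is tested at a functional \<open>l\<close> with \<open>l [x, y] = 1\<close>, where the vectors become multiples of
  the powers of \<open>t\<close> by one nonzero element of \<open>F\<close>.
\<close>

theorem not_noetherian_if_bracket_nonzero:
  assumes xy: "x \<in> carrier \<gg>" "y \<in> carrier \<gg>" "x \<otimes> y \<noteq> \<zero>"
  shows "\<not> noetherian (universal_enveloping_algebra (current_algebra \<gg> scale))"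
proof -
  let ?sc = "\<lambda>c (m :: ('g \<Rightarrow> 'k) \<Rightarrow> 'f) l. emb c * m l"
  obtain D t where D: "D \<in> derivations scale" "res (D t) \<noteq> 0"
    and t: "\<forall>q\<in>polys (range emb). poly q (res t) = 0 \<longrightarrow> q = 0"
    using exists_derivation by blast
  obtain l where l: "l \<in> functionals" "l (x \<otimes> y) = 1"
    using exists_functional[OF bracket_closed[OF xy(1,2)] xy(3)] by blast
  interpret C: lie_cocycle ?sc "current_algebra \<gg> scale" functional_maps
    "\<lambda>P m. induced ?sc (\<lambda>x f. current_act x f m) P" "induced ?sc (current_cocycle D)"
    by (rule lie_cocycle_current_act[OF D(1)])
  have W: "vector_space ?sc" ..
  note act = induced_tensor[OF W bilinear_current_act] and cocycle = induced_tensor[OF W bilinear_current_cocycle[OF D(1)]]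
  have in_maps: "current_act x f m \<in> functional_maps" "current_cocycle D x f \<in> functional_maps"
    if "x \<in> carrier \<gg>" "m \<in> functional_maps" for x f m
    using C.\<rho>_closed[OF tensor_in_carrier[OF that(1)] that(2), of f] C.\<phi>_closed[OF tensor_in_carrier[OF that(1)], of f]
    by (simp_all add: act that cocycle)
  define u where "u n = Poly_Mapping.single [tensor x (t ^ n * t), tensor y 1] (1::'k) -
    Poly_Mapping.single [tensor x (t ^ n), tensor y t] 1" for n
  define v where "v n = (\<lambda>l. if l \<in> functionals then - emb (l (x \<otimes> y)) * res (D t) * res t ^ n else 0)" for n
  have act_u: "C.act (u n) (c, m) = (0, \<lambda>l. emb c * v n l)" if m: "m \<in> functional_maps" for n c m
  proof -
    have "current_act x (t ^ n * t) (current_act y 1 m) - current_act x (t ^ n) (current_act y t m) = 0"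
      using coad_functional[OF xy(1)] by (auto simp: fun_eq_iff current_act_def res_mult res_1 algebra_simps)
    moreover have "current_act x (t ^ n * t) (current_cocycle D y 1) - current_act x (t ^ n) (current_cocycle D y t) = v n"
      using coad_functional[OF xy(1)] xy(2)
      by (auto simp: fun_eq_iff current_act_def current_cocycle_def v_def coad_def[of x] derivationsD(6)[OF D(1)] res_0 res_power)
    ultimately show ?thesis
      unfolding u_def C.pair.alg_act_diff C.act_word2[OF tensor_in_carrier[OF xy(1)]]
      using m xy
      by (simp add: act cocycle in_maps) (simp add: fun_eq_iff emb_1 algebra_simps)
  qed
  have zero: "0 \<in> functional_maps" by (rule fun_emb.subspace_0[OF C.subspace_M])
  show ?thesis
  proof (rule C.not_noetherian[where u = u and v = v])
    fix n
    have "Poly_Mapping.keys (u n) \<subseteq> {[tensor x (t ^ n * t), tensor y 1], [tensor x (t ^ n), tensor y t]}"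
      by (auto simp: u_def in_keys_iff lookup_minus lookup_single when_def split: if_splits)
    also have "\<dots> \<subseteq> lists (carrier (current_algebra \<gg> scale))" using tensor_in_carrier xy by auto
    finally show "Poly_Mapping.keys (u n) \<subseteq> lists (carrier (current_algebra \<gg> scale))" .
    show "C.act (u n) (0, m) = 0" if "m \<in> functional_maps" for m
      using act_u[OF that, of n 0] by (simp add: emb_0 zero_prod_def zero_fun_def)
    show "C.act (u n) (1, 0) = (0, v n)" using act_u[OF zero, of n 1] by (simp add: emb_1)
    define w where "w = - res (D t)"
    have vl: "v i l = w * res t ^ i" for i using l by (simp add: v_def w_def emb_1)
    have "m l \<in> emb.span ((\<lambda>i. w * res t ^ i) ` {..<n})" if "m \<in> fun_emb.span (v ` {..<n})" for m
      using that
    proof (induction rule: fun_emb.span_induct_alt)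
      case (step c m m')
      then have "m l \<in> (\<lambda>i. w * res t ^ i) ` {..<n}" by (auto simp: vl)
      with step show ?case by (auto intro: emb.span_add emb.span_scale emb.span_base)
    qed (simp add: emb.span_zero)
    moreover have "w * res t ^ n \<notin> emb.span ((\<lambda>i. w * res t ^ i) ` {..<n})"
      using D(2) by (intro powers_independent[OF t]) (simp add: w_def)
    ultimately show "v n \<notin> fun_emb.span (v ` {..<n})" using vl by metis
  qed
qed

text \<open>
  The current algebra is abelian, so any functional \<open>l\<close> gives a cocycle \<open>x \<otimes> f \<mapsto> l(x) f\<close> with values in the
  trivial module \<open>F\<close>.
\<close>

theorem not_noetherian_if_abelian:
  assumes abelian: "\<And>x y. x \<in> carrier \<gg> \<Longrightarrow> y \<in> carrier \<gg> \<Longrightarrow> x \<otimes> y = \<zero>"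
    and z: "z \<in> carrier \<gg>" "z \<noteq> \<zero>"
  shows "\<not> noetherian (universal_enveloping_algebra (current_algebra \<gg> scale))"
proof -
  let ?sc = "\<lambda>c (y :: 'f). emb c * y"
  obtain t where t: "\<forall>q\<in>polys (range emb). poly q (res t) = 0 \<longrightarrow> q = 0"
    using exists_derivation by blast
  obtain l where l: "l \<in> functionals" "l z = 1" using exists_functional[OF z] by blast
  have W: "vector_space ?sc" ..
  have bil: "bilinear ?sc (\<lambda>x f. emb (l x) * res f)" "bilinear ?sc (\<lambda>x f. 0)"
    unfolding bilinear_def by (auto simp: functionalsD[OF l(1)] emb_add emb_mult res_add res_scale algebra_simps)
  interpret C: lie_cocycle ?sc "current_algebra \<gg> scale" UNIV "\<lambda>P m. induced ?sc (\<lambda>x f. 0) P"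
    "induced ?sc (\<lambda>x f. emb (l x) * res f)"
  proof (rule lie_cocycle_current)
    show "Vector_Spaces.linear ?sc ?sc (\<lambda>_. 0)" by standard auto
  qed (auto simp: W bil emb.subspace_UNIV abelian functionalsD(3)[OF l(1) z(1) z(1)] emb_0)
  define u where "u n = Poly_Mapping.single [tensor z (t ^ n)] (1::'k)" for n
  have act_u: "C.act (u n) (c, m) = (0, emb c * res t ^ n)" for n c m
    unfolding u_def C.act_word1
    by (simp add: induced_tensor[OF W bil(1) z(1)] induced_tensor[OF W bil(2) z(1)] l(2) emb_1 res_power)
  show ?thesis
  proof (rule C.not_noetherian[where u = u and v = "\<lambda>n. 1 * res t ^ n"])
    fix n
    show "Poly_Mapping.keys (u n) \<subseteq> lists (carrier (current_algebra \<gg> scale))"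
      using tensor_in_carrier[OF z(1)] by (simp add: u_def)
    show "C.act (u n) (0, m) = 0" for m by (simp add: act_u emb_0 zero_prod_def)
    show "C.act (u n) (1, 0) = (0, 1 * res t ^ n)" by (simp add: act_u emb_1)
    show "1 * res t ^ n \<notin> emb.span ((\<lambda>n. 1 * res t ^ n) ` {..<n})"
      by (rule powers_independent[OF t]) simp
  qed
qed

end

theorem corollary2p16:
  fixes scale :: "'k::field_char_0 \<Rightarrow> 'a::comm_ring_1 \<Rightarrow> 'a"
    and \<gg> :: "('k, 'g) module"
  assumes "affine_curve scale"
  shows "\<not> noetherian (universal_enveloping_algebra (krichever_novikov scale)) \<and>
    \<not> noetherian (universal_enveloping_algebra (diff_operators_le_1 scale)) \<and>
    (lie_algebra \<gg> \<and> finite_dimensional \<gg> \<and> carrier \<gg> \<noteq> {\<zero>\<^bsub>\<gg>\<^esub>} \<longrightarrow>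
      \<not> noetherian (universal_enveloping_algebra (current_algebra \<gg> scale)))"
proof (intro conjI impI)
  interpret affine_curve scale by fact
  interpret curve_component scale "restriction :: 'a \<Rightarrow> 'a component_field" by (rule curve_component)
  show "\<not> noetherian (universal_enveloping_algebra (krichever_novikov scale))"
    by (rule krichever_novikov_not_noetherian)
  show "\<not> noetherian (universal_enveloping_algebra (diff_operators_le_1 scale))"
    by (rule diff_operators_le_1_not_noetherian)
  assume \<gg>: "lie_algebra \<gg> \<and> finite_dimensional \<gg> \<and> carrier \<gg> \<noteq> {\<zero>\<^bsub>\<gg>\<^esub>}"
  then interpret lie_algebra \<gg> by simp
  interpret current_on_curve \<gg> scale "restriction :: 'a \<Rightarrow> 'a component_field"
    by unfold_locales (rule scale_mult_left)
  obtain z where z: "z \<in> carrier \<gg>" "z \<noteq> \<zero>\<^bsub>\<gg>\<^esub>" using \<gg> M.zero_closed by blast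
  show "\<not> noetherian (universal_enveloping_algebra (current_algebra \<gg> scale))"
    using not_noetherian_if_bracket_nonzero not_noetherian_if_abelian[OF _ z] by blast
qed

end
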